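(* Let $G$ be a finitely generated abelian group, $\mathcal{L}=(g_e)_{e\in E}$ a finite list in $G$ with $E$ totally ordered, and let $\mathcal{B}$ be the set of bases of the matroid of $\mathcal{L}$. For each $B\in\mathcal{B}$ let $R_B=B\setminus I(B)$ and let $\mathcal{L}'^B=(f_e)_{e\in I(B)}$ be a list in some $\mathbb{Z}^{n_B}$ such that for every $K\subseteq I(B)$ there is a group isomorphism $G/\langle\mathcal{L}_{R_B\cup K}\rangle\cong\mathbb{Z}^{n_B}/\langle\mathcal{L}'^B_K\rangle\oplus G_{R_B}$. Then $$M_\mathcal{L}(x,y)=\sum_{B\in\mathcal{B}}\Big(\sum_{p\in\mathcal{P}_B}x^{\iota(p)}\Big)\Big(\sum_{c\in\mathcal{C}_B}y^{\eta(c)}\Big).$$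
   Context: For $A\subseteq E$, $\mathcal{L}_A=(g_e)_{e\in A}$, $\langle\mathcal{L}_A\rangle$ its generated subgroup, $\rk(A)$ its rank, $G_A$ the torsion subgroup of $G/\langle\mathcal{L}_A\rangle$, $m(A)=|G_A|$; $\mathcal{L}'^B_K=(f_e)_{e\in K}$. The matroid of $\mathcal{L}$ has rank function $\rk$; bases are maximal independent sets. $M_\mathcal{L}(x,y)=\sum_{A\subseteq E}m(A)(x-1)^{\rk(E)-\rk(A)}(y-1)^{|A|-\rk(A)}$. For a basis $B$: $e\in E\setminus B$ is externally active if $\rk(\{b\in B:b>e\}\cup\{e\})=\rk(\{b\in B:b>e\})$; $e\in B$ is internally active if no $f\in E$ preceding $e$ makes $(B\setminus\{e\})\cup\{f\}$ a basis; $E(B)$, $I(B)$ denote these sets. $\mathcal{P}_B$ is the set of $p\in\mathbb{Z}^{n_B}$ of the form $p=\sum_{e\in I(B)}t_ef_e$ with $0\le t_e<1$, and $\iota(p)$ is the number of $e$ with $t_e=0$ (the $f_e$ are linearly independent, so the $t_e$ are unique). With $\mathbb{S}^1$ the circle group, $H_e=\{\varphi\in\Hom(G,\mathbb{S}^1):\varphi(g_e)=1\}$; $\mathcal{C}_B$ is the set of connected components of $\bigcap_{e\in R_B}H_e$ (the whole group if $R_B=\emptyset$), and for $c\in\mathcal{C}_B$, $\eta(c)$ is the number of $e\in E(B)$ with $H_e\supseteq c$. *)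

theory Defs
  imports "HOL-Analysis.Analysis" "HOL-Algebra.Product_Groups" "HOL-Algebra.FiniteProduct"
begin

text \<open>
  Abelian groups are HOL-Algebra groups, written multiplicatively. A list in a group is a family
  \<open>g :: 'e \<Rightarrow> 'a\<close> restricted to an index set \<open>E\<close>; the total order on \<open>E\<close> is that of the type \<open>'e\<close>.
\<close>

section \<open>Finitely generated abelian groups\<close>

definition finitely_generated_group :: "('a, 'm) monoid_scheme \<Rightarrow> bool" where
  "finitely_generated_group G \<longleftrightarrow>
     (\<exists>S. finite S \<and> S \<subseteq> carrier G \<and> generate G S = carrier G)"

definition span_list :: "('a, 'm) monoid_scheme \<Rightarrow> ('e \<Rightarrow> 'a) \<Rightarrow> 'e set \<Rightarrow> 'a set" where
  "span_list G g A = generate G (g ` A)"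

definition Z_independent :: "('a, 'm) monoid_scheme \<Rightarrow> 'a set \<Rightarrow> bool" where
  "Z_independent G S \<longleftrightarrow> finite S \<and> S \<subseteq> carrier G \<and>
     (\<forall>c :: 'a \<Rightarrow> int. finprod G (\<lambda>s. s [^]\<^bsub>G\<^esub> c s) S = \<one>\<^bsub>G\<^esub> \<longrightarrow> (\<forall>s\<in>S. c s = 0))"

text \<open>The rank of a subgroup \<open>H\<close> of \<open>G\<close>. The maximum is over a finite set of numbers as soon as
  \<open>H\<close> is contained in a finitely generated abelian group.\<close>

definition subgroup_rank :: "('a, 'm) monoid_scheme \<Rightarrow> 'a set \<Rightarrow> nat" where
  "subgroup_rank G H = Max {card S | S. S \<subseteq> H \<and> Z_independent G S}"

definition torsion_group :: "('a, 'm) monoid_scheme \<Rightarrow> ('a, 'm) monoid_scheme" where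
  "torsion_group G = G\<lparr>carrier := {x \<in> carrier G. \<exists>k::nat. k > 0 \<and> x [^]\<^bsub>G\<^esub> k = \<one>\<^bsub>G\<^esub>}\<rparr>"

definition free_Z :: "nat \<Rightarrow> (nat \<Rightarrow> int) monoid" where
  "free_Z n = product_group {..<n} (\<lambda>_. integer_group)"

section \<open>The arithmetic matroid of a list\<close>

definition list_rk :: "('a, 'm) monoid_scheme \<Rightarrow> ('e \<Rightarrow> 'a) \<Rightarrow> 'e set \<Rightarrow> nat" where
  "list_rk G g A = subgroup_rank G (span_list G g A)"

definition list_torsion :: "('a, 'm) monoid_scheme \<Rightarrow> ('e \<Rightarrow> 'a) \<Rightarrow> 'e set \<Rightarrow> 'a set monoid" where
  "list_torsion G g A = torsion_group (G Mod span_list G g A)"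

definition list_mult :: "('a, 'm) monoid_scheme \<Rightarrow> ('e \<Rightarrow> 'a) \<Rightarrow> 'e set \<Rightarrow> nat" where
  "list_mult G g A = order (list_torsion G g A)"

definition list_indep :: "('a, 'm) monoid_scheme \<Rightarrow> ('e \<Rightarrow> 'a) \<Rightarrow> 'e set \<Rightarrow> 'e set \<Rightarrow> bool" where
  "list_indep G g E A \<longleftrightarrow> A \<subseteq> E \<and> list_rk G g A = card A"

definition list_bases :: "('a, 'm) monoid_scheme \<Rightarrow> ('e \<Rightarrow> 'a) \<Rightarrow> 'e set \<Rightarrow> 'e set set" where
  "list_bases G g E =
     {B. list_indep G g E B \<and> (\<forall>A. list_indep G g E A \<and> B \<subseteq> A \<longrightarrow> A = B)}"

text \<open>The arithmetic Tutte polynomial, as a polynomial expression in elements \<open>x\<close>, \<open>y\<close> of an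
  arbitrary commutative ring; the indeterminates are the case of \<open>int poly poly\<close>. The natural
  number subtractions in the exponents do not truncate.\<close>

definition arith_Tutte ::
  "('a, 'm) monoid_scheme \<Rightarrow> ('e \<Rightarrow> 'a) \<Rightarrow> 'e set \<Rightarrow> 'r::comm_ring_1 \<Rightarrow> 'r \<Rightarrow> 'r" where
  "arith_Tutte G g E x y =
     (\<Sum>A\<in>Pow E. of_nat (list_mult G g A)
        * (x - 1) ^ (list_rk G g E - list_rk G g A)
        * (y - 1) ^ (card A - list_rk G g A))"

section \<open>Activities\<close>

definition ext_active ::
  "('a, 'm) monoid_scheme \<Rightarrow> ('e::linorder \<Rightarrow> 'a) \<Rightarrow> 'e set \<Rightarrow> 'e set \<Rightarrow> 'e set" where
  "ext_active G g E B =
     {e \<in> E - B. list_rk G g ({b \<in> B. b > e} \<union> {e}) = list_rk G g {b \<in> B. b > e}}"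

definition int_active ::
  "('a, 'm) monoid_scheme \<Rightarrow> ('e::linorder \<Rightarrow> 'a) \<Rightarrow> 'e set \<Rightarrow> 'e set \<Rightarrow> 'e set" where
  "int_active G g E B =
     {e \<in> B. \<not> (\<exists>f\<in>E. f < e \<and> (B - {e}) \<union> {f} \<in> list_bases G g E)}"

definition nonactive_part ::
  "('a, 'm) monoid_scheme \<Rightarrow> ('e::linorder \<Rightarrow> 'a) \<Rightarrow> 'e set \<Rightarrow> 'e set \<Rightarrow> 'e set" where
  "nonactive_part G g E B = B - int_active G g E B"

section \<open>Lattice points of a half-open parallelepiped\<close>

text \<open>The coefficient families \<open>t\<close> are extensional on \<open>I\<close>, so that \<open>t\<close> is unique as a function
  when \<open>f\<close> is linearly independent on \<open>I\<close>.\<close>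

definition box_coeffs :: "nat \<Rightarrow> ('e \<Rightarrow> nat \<Rightarrow> int) \<Rightarrow> 'e set \<Rightarrow> (nat \<Rightarrow> int) \<Rightarrow> ('e \<Rightarrow> real) \<Rightarrow> bool" where
  "box_coeffs n f I p t \<longleftrightarrow>
     t \<in> I \<rightarrow>\<^sub>E {0..<1} \<and> (\<forall>i<n. real_of_int (p i) = (\<Sum>e\<in>I. t e * real_of_int (f e i)))"

definition box_points :: "nat \<Rightarrow> ('e \<Rightarrow> nat \<Rightarrow> int) \<Rightarrow> 'e set \<Rightarrow> (nat \<Rightarrow> int) set" where
  "box_points n f I = {p \<in> carrier (free_Z n). \<exists>t. box_coeffs n f I p t}"

definition box_iota :: "nat \<Rightarrow> ('e \<Rightarrow> nat \<Rightarrow> int) \<Rightarrow> 'e set \<Rightarrow> (nat \<Rightarrow> int) \<Rightarrow> nat" where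
  "box_iota n f I p = card {e \<in> I. (THE t. box_coeffs n f I p t) e = 0}"

section \<open>The toric arrangement\<close>

definition circle_group :: "complex monoid" where
  "circle_group = \<lparr>carrier = sphere 0 1, monoid.mult = (*), one = 1\<rparr>"

text \<open>Characters are extensional on \<open>carrier G\<close>, so that they are determined by their values there.\<close>

definition characters :: "('a, 'm) monoid_scheme \<Rightarrow> ('a \<Rightarrow> complex) set" where
  "characters G = hom G circle_group \<inter> extensional (carrier G)"

text \<open>The topology of pointwise convergence, which for discrete \<open>G\<close> is the compact-open topology.\<close>

definition character_topology :: "('a, 'm) monoid_scheme \<Rightarrow> ('a \<Rightarrow> complex) topology" where
  "character_topology G =
     subtopology (product_topology (\<lambda>_. top_of_set (sphere 0 1)) (carrier G)) (characters G)"

definition toric_hyp :: "('a, 'm) monoid_scheme \<Rightarrow> ('e \<Rightarrow> 'a) \<Rightarrow> 'e \<Rightarrow> ('a \<Rightarrow> complex) set" where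
  "toric_hyp G g e = {h \<in> characters G. h (g e) = 1}"

definition toric_components ::
  "('a, 'm) monoid_scheme \<Rightarrow> ('e \<Rightarrow> 'a) \<Rightarrow> 'e set \<Rightarrow> ('a \<Rightarrow> complex) set set" where
  "toric_components G g R =
     connected_components_of
       (subtopology (character_topology G) (characters G \<inter> (\<Inter>e\<in>R. toric_hyp G g e)))"

definition toric_eta ::
  "('a, 'm) monoid_scheme \<Rightarrow> ('e \<Rightarrow> 'a) \<Rightarrow> 'e set \<Rightarrow> ('a \<Rightarrow> complex) set \<Rightarrow> nat" where
  "toric_eta G g X c = card {e \<in> X. c \<subseteq> toric_hyp G g e}"

end

theory Submission
  imports Defs
begin

text \<open>
  Crapo's intervals \<open>[R\<^sub>B, B \<union> E(B)]\<close> partition the power set of \<open>E\<close>, so every \<open>A\<close> is uniquely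
  \<open>R\<^sub>B \<union> K \<union> L\<close> with \<open>K \<subseteq> I(B)\<close> and \<open>L \<subseteq> E(B)\<close>. Externally active elements lie in the closure of
  \<open>R\<^sub>B\<close>, hence such an interval is a molecule of the arithmetic matroid and
  \<open>m(R\<^sub>B \<union> K \<union> L) m(R\<^sub>B) = m(R\<^sub>B \<union> K) m(R\<^sub>B \<union> L)\<close>; the isomorphism hypothesis gives
  \<open>m(R\<^sub>B \<union> K) = m'(K) m(R\<^sub>B)\<close>, where \<open>m'\<close> is the multiplicity of the list \<open>f\<close>. The summand of \<open>B\<close> thus
  splits into a sum over \<open>K\<close> of \<open>m'(K) (x - 1)\<close>-powers and a sum over \<open>L\<close> of
  \<open>m(R\<^sub>B \<union> L) (y - 1)\<close>-powers. The first is the sum over lattice points, since the points of the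
  half-open box with \<open>t\<close> vanishing off \<open>K\<close> represent the torsion of \<open>\<int>\<^sup>n / \<langle>f\<^sub>K\<rangle>\<close>. The second is the
  sum over components, since the components of the intersection of the \<open>H\<^sub>e\<close>, \<open>e \<in> R\<^sub>B\<close>, are the fibres of
  the restriction of characters to the isolator \<open>T\<close> of \<open>\<langle>g\<^sub>R\<rangle>\<close>, and those contained in all \<open>H\<^sub>e\<close>,
  \<open>e \<in> L\<close>, correspond to the characters of \<open>T\<close> trivial on \<open>\<langle>g\<^bsub>R \<union> L\<^esub>\<rangle>\<close>.
\<close>

section \<open>Pregeometries and Crapo's partition\<close>

text \<open>One closure operator carries the proof: \<open>isolator G S\<close>, the elements with a
  positive power in the subgroup generated by \<open>S\<close>. It is a pregeometry on
  \<open>carrier G\<close> and, pulled back along the list, the matroid on \<open>E\<close>, so one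
  Steinitz lemma serves subgroups, lists and whole groups. Multiplicities become indices of a span
  in its isolator; finite generation makes them positive, hence cancellable. Linear independence of
  \<open>f\<close> on \<open>I(B)\<close> is extracted from the isomorphisms for the empty set and
  for \<open>I(B)\<close> itself: the torsion summand has rank 0, so comparing ranks leaves no room
  for a relation. Homomorphisms are built one generator at a time. The obstacle is the connectedness
  of a fibre: a character trivial on \<open>T\<close> must be \<open>cis\<close> of a real
  homomorphism. A generator of order \<open>k\<close> over the subgroup already treated has its real
  value forced, and its \<open>cis\<close> may miss the character by a k-th root of unity, so the
  construction controls only an N-th power. As \<open>G\<close> modulo \<open>T\<close> is
  torsion-free, characters trivial on \<open>T\<close> have N-th roots that are again trivial on
  \<open>T\<close>, which removes the loss.\<close>

locale pregeometry =
  fixes U :: "'a set" and cl :: "'a set \<Rightarrow> 'a set"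
  assumes cl_closed: "S \<subseteq> U \<Longrightarrow> cl S \<subseteq> U"
    and cl_extensive: "S \<subseteq> U \<Longrightarrow> S \<subseteq> cl S"
    and cl_mono: "S \<subseteq> T \<Longrightarrow> T \<subseteq> U \<Longrightarrow> cl S \<subseteq> cl T"
    and cl_idem: "S \<subseteq> U \<Longrightarrow> cl (cl S) \<subseteq> cl S"
    and cl_exchange: "S \<subseteq> U \<Longrightarrow> x \<in> U \<Longrightarrow> y \<in> U \<Longrightarrow> x \<in> cl (insert y S) \<Longrightarrow> x \<notin> cl S
                      \<Longrightarrow> y \<in> cl (insert x S)"
begin

definition indep :: "'a set \<Rightarrow> bool" where
  "indep S \<longleftrightarrow> finite S \<and> S \<subseteq> U \<and> (\<forall>s\<in>S. s \<notin> cl (S - {s}))"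

lemma cl_least: "S \<subseteq> cl T \<Longrightarrow> T \<subseteq> U \<Longrightarrow> cl S \<subseteq> cl T"
  by (meson cl_closed cl_idem cl_mono order_trans)

lemma indep_empty: "indep {}"
  by (simp add: indep_def)

lemma indep_subset:
  assumes "indep S" "T \<subseteq> S" shows "indep T"
proof -
  have "t \<notin> cl (T - {t})" if "t \<in> T" for t
  proof -
    have "cl (T - {t}) \<subseteq> cl (S - {t})" by (rule cl_mono) (use assms in \<open>auto simp: indep_def\<close>)
    then show ?thesis using assms that by (auto simp: indep_def)
  qed
  then show ?thesis using assms by (auto simp: indep_def intro: finite_subset)
qed

text \<open>If some \<open>s\<close> in \<open>S\<close> became dependent on the rest together with
  \<open>x\<close>, exchange would put \<open>x\<close> into \<open>cl S\<close>.\<close>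

lemma indep_insert:
  assumes S: "indep S" and x: "x \<in> U" "x \<notin> cl S"
  shows "indep (insert x S)"
proof -
  have SU: "S \<subseteq> U" and xS: "x \<notin> S" using S x cl_extensive by (auto simp: indep_def)
  have "s \<notin> cl (insert x S - {s})" if s: "s \<in> insert x S" for s
  proof (cases "s = x")
    case True
    then show ?thesis using x xS by simp
  next
    case False
    then have sS: "s \<in> S" using s by simp
    have eq: "insert x S - {s} = insert x (S - {s})" using False by auto
    have "x \<in> cl (insert s (S - {s}))" if "s \<in> cl (insert x (S - {s}))"
      by (rule cl_exchange) (use that S sS x SU in \<open>auto simp: indep_def\<close>)
    then show ?thesis using x sS by (auto simp: eq insert_absorb)
  qed
  then show ?thesis using S x by (auto simp: indep_def)
qed

text \<open>Some \<open>x\<close> in \<open>S\<close> outside \<open>T\<close> is traded for a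
  \<open>t\<close> in \<open>T\<close> outside \<open>cl (S - {x})\<close>, which shrinks
  \<open>S - T\<close> and keeps the cardinality. Such a \<open>t\<close> exists, since otherwise
  \<open>cl T\<close>, and with it \<open>x\<close>, would lie in
  \<open>cl (S - {x})\<close>.\<close>

theorem steinitz:
  assumes "indep S" "finite T" "T \<subseteq> U" "S \<subseteq> cl T"
  shows "card S \<le> card T" using assms
proof (induction "card (S - T)" arbitrary: S rule: less_induct)
  case less
  note S = \<open>indep S\<close> and T = \<open>finite T\<close> \<open>T \<subseteq> U\<close>
  show ?case
  proof (cases "S \<subseteq> T")
    case True
    then show ?thesis using T card_mono by blast
  next
    case False
    then obtain x where x: "x \<in> S" "x \<notin> T" by auto
    have xn: "x \<notin> cl (S - {x})" and SU: "S \<subseteq> U" and fS: "finite S"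
      using S x by (auto simp: indep_def)
    have "\<not> T \<subseteq> cl (S - {x})" using less.prems x xn SU cl_least[of T "S - {x}"] by blast
    then obtain t where t: "t \<in> T" "t \<notin> cl (S - {x})" by auto
    have tS: "t \<notin> S - {x}" using t SU cl_extensive[of "S - {x}"] by auto
    define S' where "S' = insert t (S - {x})"
    have "indep S'" unfolding S'_def using t T S by (intro indep_insert) (auto intro: indep_subset)
    moreover have "S' - T \<subset> S - T" using t x by (auto simp: S'_def)
    then have "card (S' - T) < card (S - T)" using fS by (simp add: psubset_card_mono)
    moreover have "S' \<subseteq> cl T" using less.prems t cl_extensive[of T] by (auto simp: S'_def)
    ultimately have "card S' \<le> card T" using less.hyps T by blast
    moreover have "card S' = card S"
      using card.insert[of "S - {x}" t] card_Suc_Diff1[of S x] tS x fS by (simp add: S'_def)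
    ultimately show ?thesis by simp
  qed
qed

lemma basis_extend:
  assumes "finite A" "A \<subseteq> U" "indep J" "J \<subseteq> A"
  obtains J' where "J \<subseteq> J'" "J' \<subseteq> A" "indep J'" "A \<subseteq> cl J'"
proof -
  let ?F = "{S. J \<subseteq> S \<and> S \<subseteq> A \<and> indep S}"
  have "finite ?F" by (rule finite_subset[of _ "Pow A"]) (use assms in auto)
  moreover have "J \<in> ?F" using assms by simp
  ultimately have "\<exists>J'\<in>?F. J \<subseteq> J' \<and> (\<forall>S\<in>?F. J' \<subseteq> S \<longrightarrow> J' = S)" by (rule finite_has_maximal2)
  then obtain J' where J': "J \<subseteq> J'" "J' \<subseteq> A" "indep J'" and max: "\<forall>S\<in>?F. J' \<subseteq> S \<longrightarrow> J' = S" by blast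
  have "x \<in> cl J'" if "x \<in> A" for x
  proof (rule ccontr)
    assume x: "x \<notin> cl J'"
    then have "indep (insert x J')" using that assms(2) J' by (intro indep_insert) auto
    then have "J' = insert x J'" using max[rule_format, of "insert x J'"] J' that by blast
    then show False using x J' assms(2) cl_extensive[of J'] by blast
  qed
  then show ?thesis using J' that by blast
qed

text \<open>For an independent \<open>S\<close> and \<open>x\<close> outside it, \<open>T\<close>
  together with \<open>x\<close> is the fundamental circuit of \<open>x\<close>; minimality is the
  form in which exchange can use it.\<close>

lemma minimal_spanning_subset:
  assumes "finite S" "x \<in> cl S"
  obtains T where "T \<subseteq> S" "x \<in> cl T" "\<And>t. t \<in> T \<Longrightarrow> x \<notin> cl (T - {t})"
proof -
  let ?F = "{T. T \<subseteq> S \<and> x \<in> cl T}"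
  have "finite ?F" by (rule finite_subset[of _ "Pow S"]) (use assms in auto)
  moreover have "S \<in> ?F" using assms by simp
  ultimately have "\<exists>T\<in>?F. T \<subseteq> S \<and> (\<forall>T'\<in>?F. T' \<subseteq> T \<longrightarrow> T = T')" by (rule finite_has_minimal2)
  then obtain T where T: "T \<subseteq> S" "x \<in> cl T" and min: "\<forall>T'\<in>?F. T' \<subseteq> T \<longrightarrow> T = T'" by blast
  have "x \<notin> cl (T - {t})" if "t \<in> T" for t using min[rule_format, of "T - {t}"] T(1) that by blast
  then show ?thesis using that T by blast
qed

text \<open>A list may repeat elements. Closure is therefore pulled back to the index set, where
  indices with equal values lie in each other's closure.\<close>

lemma pregeometry_comap:
  assumes "g ` E \<subseteq> U"
  shows "pregeometry E (\<lambda>A. {e \<in> E. g e \<in> cl (g ` A)})"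
proof
  show "{e \<in> E. g e \<in> cl (g ` S)} \<subseteq> {e \<in> E. g e \<in> cl (g ` T)}" if "S \<subseteq> T" "T \<subseteq> E" for S T
    using cl_mono[of "g ` S" "g ` T"] that assms by blast
  show "S \<subseteq> {e \<in> E. g e \<in> cl (g ` S)}" if "S \<subseteq> E" for S
    using cl_extensive[of "g ` S"] that assms by blast
  show "{e \<in> E. g e \<in> cl (g ` {e \<in> E. g e \<in> cl (g ` S)})} \<subseteq> {e \<in> E. g e \<in> cl (g ` S)}"
    if "S \<subseteq> E" for S using cl_least[of "g ` {e \<in> E. g e \<in> cl (g ` S)}" "g ` S"] that assms by blast
  show "y \<in> {e \<in> E. g e \<in> cl (g ` insert x S)}"
    if "S \<subseteq> E" "x \<in> E" "y \<in> E" "x \<in> {e \<in> E. g e \<in> cl (g ` insert y S)}"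
       "x \<notin> {e \<in> E. g e \<in> cl (g ` S)}" for S x y
    using cl_exchange[of "g ` S" "g x" "g y"] that assms by auto
qed auto

end

section \<open>Activities in an ordered matroid\<close>

locale ordered_matroid = pregeometry E cl
  for E :: "'e::linorder set" and cl :: "'e set \<Rightarrow> 'e set" +
  assumes finite_ground: "finite E"
begin

definition bases :: "'e set set" where
  "bases = {B. indep B \<and> E \<subseteq> cl B}"

text \<open>Both activities are phrased by closure, which suits exchange arguments; for bases
  \<open>ext_active_eq\<close> and \<open>int_active_eq\<close> match them with the rank and
  exchange versions.\<close>

definition external :: "'e set \<Rightarrow> 'e set" where
  "external B = {e \<in> E - B. e \<in> cl {b \<in> B. e < b}}"

definition internal :: "'e set \<Rightarrow> 'e set" where
  "internal B = {b \<in> B. \<forall>e\<in>E. e < b \<longrightarrow> e \<in> cl (B - {b})}"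

text \<open>The greedy basis of \<open>A\<close> from the largest element down, and its greedy extension to a basis of
  \<open>E\<close> from the smallest element up. Their union is the basis whose interval contains \<open>A\<close>.\<close>

definition first_part :: "'e set \<Rightarrow> 'e set" where
  "first_part A = {a \<in> A. a \<notin> cl {a' \<in> A. a < a'}}"

definition second_part :: "'e set \<Rightarrow> 'e set" where
  "second_part A = {e \<in> E. e \<notin> cl (A \<union> {e' \<in> E. e' < e})}"

definition basis_of :: "'e set \<Rightarrow> 'e set" where
  "basis_of A = first_part A \<union> second_part A"

text \<open>With the elements of \<open>D\<close> inserted from the smallest up, each one is outside
  the closure of what is already there, so \<open>indep_insert\<close> applies every time.\<close>

lemma indep_ascending:
  assumes A: "indep A" and "finite D" "D \<subseteq> E" "\<And>d. d \<in> D \<Longrightarrow> d \<notin> cl (A \<union> {d' \<in> D. d' < d})"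
  shows "indep (A \<union> D)" using assms(2-)
proof (induction D rule: finite_linorder_max_induct)
  case empty
  then show ?case using A by simp
next
  case (insert b D)
  have "indep (A \<union> D)"
  proof (rule insert.IH)
    fix d assume d: "d \<in> D"
    then have "{d' \<in> insert b D. d' < d} = {d' \<in> D. d' < d}" using insert.hyps by auto
    then show "d \<notin> cl (A \<union> {d' \<in> D. d' < d})" using insert.prems(2)[of d] d by auto
  qed (use insert.prems in auto)
  moreover have "{d' \<in> insert b D. d' < b} = D" using insert.hyps by auto
  then have "b \<notin> cl (A \<union> D)" using insert.prems(2)[of b] by auto
  ultimately show ?case using indep_insert[of "A \<union> D" b] insert.prems by simp
qed

lemma indep_descending:
  assumes "finite D" "D \<subseteq> E" "\<And>d. d \<in> D \<Longrightarrow> d \<notin> cl {d' \<in> D. d < d'}"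
  shows "indep D" using assms
proof (induction D rule: finite_linorder_min_induct)
  case empty
  then show ?case by (simp add: indep_empty)
next
  case (insert b D)
  have "indep D"
  proof (rule insert.IH)
    fix d assume d: "d \<in> D"
    then have "{d' \<in> insert b D. d < d'} = {d' \<in> D. d < d'}" using insert.hyps by auto
    then show "d \<notin> cl {d' \<in> D. d < d'}" using insert.prems(2)[of d] d by auto
  qed (use insert.prems in auto)
  moreover have "{d' \<in> insert b D. b < d'} = D" using insert.hyps by auto
  then have "b \<notin> cl D" using insert.prems(2)[of b] by auto
  ultimately show ?case using indep_insert[of D b] insert.prems by simp
qed

text \<open>An element rejected by the greedy choice lies in the closure of larger elements of
  \<open>A\<close>, and these are spanned inductively. The bound \<open>a \<le> b\<close> is kept
  because it is what later makes rejected elements externally active.\<close>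

lemma first_part_spans:
  assumes "A \<subseteq> E" "a \<in> A"
  shows "a \<in> cl {b \<in> first_part A. a \<le> b}" using assms(2)
proof (induction "card {b \<in> A. a < b}" arbitrary: a rule: less_induct)
  case less
  have fA: "finite A" and FA: "first_part A \<subseteq> A"
    using assms finite_ground finite_subset by (auto simp: first_part_def)
  show ?case
  proof (cases "a \<in> first_part A")
    case True
    then show ?thesis using cl_extensive[of "{b \<in> first_part A. a \<le> b}"] FA assms by auto
  next
    case False
    then have a: "a \<in> cl {a' \<in> A. a < a'}" using less.prems by (auto simp: first_part_def)
    have "a' \<in> cl {b \<in> first_part A. a \<le> b}" if a': "a' \<in> A" "a < a'" for a'
    proof -
      have "card {b \<in> A. a' < b} < card {b \<in> A. a < b}"
        by (rule psubset_card_mono) (use fA a' in auto)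
      then have "a' \<in> cl {b \<in> first_part A. a' \<le> b}" using less.hyps a' by blast
      moreover have "cl {b \<in> first_part A. a' \<le> b} \<subseteq> cl {b \<in> first_part A. a \<le> b}"
        by (rule cl_mono) (use a' FA assms in auto)
      ultimately show ?thesis by blast
    qed
    then have "cl {a' \<in> A. a < a'} \<subseteq> cl {b \<in> first_part A. a \<le> b}"
      using FA assms by (intro cl_least) auto
    then show ?thesis using a by blast
  qed
qed

text \<open>The mirror image, by induction on the number of smaller elements. Here the bound
  \<open>d \<le> e\<close> is what later yields internal activity.\<close>

lemma second_part_spans:
  assumes "A \<subseteq> E" "e \<in> E"
  shows "e \<in> cl (A \<union> {d \<in> second_part A. d \<le> e})" using assms(2)
proof (induction "card {e' \<in> E. e' < e}" arbitrary: e rule: less_induct)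
  case less
  have DE: "second_part A \<subseteq> E" by (auto simp: second_part_def)
  show ?case
  proof (cases "e \<in> second_part A")
    case True
    then show ?thesis using cl_extensive[of "A \<union> {d \<in> second_part A. d \<le> e}"] DE assms by auto
  next
    case False
    then have e: "e \<in> cl (A \<union> {e' \<in> E. e' < e})" using less.prems by (auto simp: second_part_def)
    have "e' \<in> cl (A \<union> {d \<in> second_part A. d \<le> e})" if e': "e' \<in> E" "e' < e" for e'
    proof -
      have "card {b \<in> E. b < e'} < card {b \<in> E. b < e}"
        by (rule psubset_card_mono) (use finite_ground e' in auto)
      then have "e' \<in> cl (A \<union> {d \<in> second_part A. d \<le> e'})" using less.hyps e' by blast
      moreover have "cl (A \<union> {d \<in> second_part A. d \<le> e'}) \<subseteq> cl (A \<union> {d \<in> second_part A. d \<le> e})"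
        by (rule cl_mono) (use e' DE assms in auto)
      ultimately show ?thesis by blast
    qed
    moreover have "A \<subseteq> cl (A \<union> {d \<in> second_part A. d \<le> e})"
      using cl_extensive[of "A \<union> {d \<in> second_part A. d \<le> e}"] DE assms by auto
    ultimately have "cl (A \<union> {e' \<in> E. e' < e}) \<subseteq> cl (A \<union> {d \<in> second_part A. d \<le> e})"
      using DE assms by (intro cl_least) auto
    then show ?thesis using e by blast
  qed
qed

lemma cl_first_part:
  assumes "A \<subseteq> E" shows "A \<subseteq> cl (first_part A)"
proof
  fix a assume "a \<in> A"
  then have "a \<in> cl {b \<in> first_part A. a \<le> b}" by (rule first_part_spans[OF assms])
  moreover have "cl {b \<in> first_part A. a \<le> b} \<subseteq> cl (first_part A)"
    by (rule cl_mono) (use assms in \<open>auto simp: first_part_def\<close>)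
  ultimately show "a \<in> cl (first_part A)" by blast
qed

lemma second_part_disjoint:
  assumes "A \<subseteq> E" shows "second_part A \<inter> A = {}"
  using cl_extensive[of "A \<union> {e' \<in> E. e' < e}" for e] assms by (fastforce simp: second_part_def)

lemma basis_of_subset: "A \<subseteq> E \<Longrightarrow> basis_of A \<subseteq> E"
  by (auto simp: basis_of_def first_part_def second_part_def)

lemma basis_of_in_bases:
  assumes A: "A \<subseteq> E" shows "basis_of A \<in> bases"
proof -
  have FE: "first_part A \<subseteq> E" and DE: "second_part A \<subseteq> E" and FA: "first_part A \<subseteq> A"
    using A by (auto simp: first_part_def second_part_def)
  have "indep (first_part A)"
  proof (rule indep_descending)
    fix d assume d: "d \<in> first_part A"
    have "cl {d' \<in> first_part A. d < d'} \<subseteq> cl {d' \<in> A. d < d'}" by (rule cl_mono) (use A FA in auto)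
    then show "d \<notin> cl {d' \<in> first_part A. d < d'}" using d by (auto simp: first_part_def)
  qed (use FE finite_ground finite_subset in auto)
  then have "indep (basis_of A)" unfolding basis_of_def
  proof (rule indep_ascending)
    fix d assume d: "d \<in> second_part A"
    have "cl (first_part A \<union> {d' \<in> second_part A. d' < d}) \<subseteq> cl (A \<union> {e' \<in> E. e' < d})"
      by (rule cl_mono) (use A FA DE in auto)
    then show "d \<notin> cl (first_part A \<union> {d' \<in> second_part A. d' < d})"
      using d by (auto simp: second_part_def)
  qed (use DE finite_ground finite_subset in auto)
  moreover have "E \<subseteq> cl (basis_of A)"
  proof
    fix e assume "e \<in> E"
    then have "e \<in> cl (A \<union> {d \<in> second_part A. d \<le> e})" by (rule second_part_spans[OF A])
    moreover have "cl (A \<union> {d \<in> second_part A. d \<le> e}) \<subseteq> cl (basis_of A)"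
    proof (rule cl_least)
      have "cl (first_part A) \<subseteq> cl (basis_of A)"
        using basis_of_subset[OF A] by (intro cl_mono) (auto simp: basis_of_def)
      moreover have "basis_of A \<subseteq> cl (basis_of A)"
        using basis_of_subset[OF A] by (rule cl_extensive)
      ultimately show "A \<union> {d \<in> second_part A. d \<le> e} \<subseteq> cl (basis_of A)"
        using cl_first_part[OF A] by (auto simp: basis_of_def)
    qed (rule basis_of_subset[OF A])
    ultimately show "e \<in> cl (basis_of A)" by blast
  qed
  ultimately show ?thesis by (simp add: bases_def)
qed

text \<open>An element \<open>e < d\<close> is spanned by \<open>A\<close> and the accepted elements
  up to \<open>e\<close>, among which \<open>d\<close> does not occur. As \<open>A\<close> is
  spanned by its first part, which also omits \<open>d\<close>, the basis without \<open>d\<close>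
  spans \<open>e\<close>.\<close>

lemma second_part_internal:
  assumes A: "A \<subseteq> E" shows "second_part A \<subseteq> internal (basis_of A)"
proof
  fix d assume d: "d \<in> second_part A"
  have "e \<in> cl (basis_of A - {d})" if e: "e \<in> E" "e < d" for e
  proof -
    have sub: "basis_of A - {d} \<subseteq> E" using basis_of_subset[OF A] by auto
    have "e \<in> cl (A \<union> {d' \<in> second_part A. d' \<le> e})" using e by (intro second_part_spans[OF A])
    moreover have "cl (A \<union> {d' \<in> second_part A. d' \<le> e}) \<subseteq> cl (basis_of A - {d})"
    proof (rule cl_least[OF _ sub])
      have "first_part A \<subseteq> basis_of A - {d}"
        using d second_part_disjoint[OF A] by (auto simp: basis_of_def first_part_def)
      then have "cl (first_part A) \<subseteq> cl (basis_of A - {d})" using sub by (rule cl_mono)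
      then show "A \<union> {d' \<in> second_part A. d' \<le> e} \<subseteq> cl (basis_of A - {d})"
        using cl_first_part[OF A] cl_extensive[OF sub] e by (auto simp: basis_of_def)
    qed
    ultimately show ?thesis by blast
  qed
  then show "d \<in> internal (basis_of A)" using d by (auto simp: internal_def basis_of_def)
qed

text \<open>A rejected \<open>a\<close> is spanned by accepted elements that are at least
  \<open>a\<close>; being rejected itself, it is spanned by strictly larger ones.\<close>

lemma diff_first_part_external:
  assumes A: "A \<subseteq> E" shows "A - first_part A \<subseteq> external (basis_of A)"
proof
  fix a assume a: "a \<in> A - first_part A"
  have sub: "{b \<in> basis_of A. a < b} \<subseteq> E" using basis_of_subset[OF A] by auto
  have "a \<in> cl {b \<in> first_part A. a \<le> b}" using a by (intro first_part_spans[OF A]) auto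
  moreover have "cl {b \<in> first_part A. a \<le> b} \<subseteq> cl {b \<in> basis_of A. a < b}"
    by (rule cl_mono[OF _ sub]) (use a in \<open>auto simp: basis_of_def order_less_le\<close>)
  ultimately show "a \<in> external (basis_of A)"
    using a A second_part_disjoint[OF A] by (auto simp: external_def basis_of_def)
qed

text \<open>An internally active element of the fundamental circuit of \<open>e\<close> cannot exceed \<open>e\<close>.\<close>

lemma circuit_internal:
  assumes B: "indep B" and T: "T \<subseteq> B" and e: "e \<in> E" "e \<in> cl T" and t: "t \<in> T" "e < t"
    and min: "e \<notin> cl (T - {t})"
  shows "t \<notin> internal B"
proof
  assume "t \<in> internal B"
  then have eB: "e \<in> cl (B - {t})" using e t by (auto simp: internal_def)
  have BE: "B \<subseteq> E" using B by (simp add: indep_def)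
  have "insert t (T - {t}) = T" using t by auto
  \<comment> \<open>Minimality makes \<open>e\<close> and \<open>t\<close> exchangeable. With
    \<open>e\<close> spanned by \<open>B - {t}\<close>, this puts \<open>t\<close> into that closure
    too, against independence.\<close>
  then have "t \<in> cl (insert e (T - {t}))" using cl_exchange[of "T - {t}" e t] BE T t e min by auto
  moreover have "cl (insert e (T - {t})) \<subseteq> cl (B - {t})"
  proof (rule cl_least)
    show "insert e (T - {t}) \<subseteq> cl (B - {t})" using eB T BE cl_extensive[of "B - {t}"] by auto
  qed (use BE in auto)
  ultimately show False using B T t by (auto simp: indep_def)
qed

text \<open>All other elements of the circuit of \<open>e\<close> exceed \<open>e\<close>, so by
  \<open>circuit_internal\<close> none of them is internally active.\<close>

lemma external_in_cl:
  assumes B: "indep B" and e: "e \<in> external B"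
  shows "e \<in> cl {b \<in> B - internal B. e < b}"
proof -
  have BE: "B \<subseteq> E" and eE: "e \<in> E" and ecl: "e \<in> cl {b \<in> B. e < b}" and "finite B"
    using B e by (auto simp: indep_def external_def)
  then obtain T where T: "T \<subseteq> {b \<in> B. e < b}" "e \<in> cl T" "\<And>t. t \<in> T \<Longrightarrow> e \<notin> cl (T - {t})"
    using minimal_spanning_subset[of "{b \<in> B. e < b}" e] by auto
  have "t \<notin> internal B" if "t \<in> T" for t
    by (rule circuit_internal[OF B _ eE T(2) that]) (use T that in auto)
  then have "cl T \<subseteq> cl {b \<in> B - internal B. e < b}" using T BE by (intro cl_mono) auto
  then show ?thesis using T by auto
qed

lemma external_subset_cl:
  assumes "indep B" shows "external B \<subseteq> cl (B - internal B)"
proof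
  fix e assume "e \<in> external B"
  then have "e \<in> cl {b \<in> B - internal B. e < b}" by (rule external_in_cl[OF assms])
  moreover have "cl {b \<in> B - internal B. e < b} \<subseteq> cl (B - internal B)"
    by (rule cl_mono) (use assms in \<open>auto simp: indep_def\<close>)
  ultimately show "e \<in> cl (B - internal B)" by blast
qed

text \<open>An element of \<open>B\<close> is accepted because everything larger in \<open>A\<close>
  is spanned by larger elements of \<open>B\<close>, and \<open>B\<close> is independent. An element
  outside \<open>B\<close> is externally active and already spanned by larger elements of the
  nonactive part, which \<open>A\<close> contains.\<close>

lemma first_part_eq:
  assumes B: "indep B" and A: "B - internal B \<subseteq> A" "A \<subseteq> B \<union> external B"
  shows "first_part A = A \<inter> B"
proof -
  have BE: "B \<subseteq> E" and XE: "external B \<subseteq> E" using B by (auto simp: indep_def external_def)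
  have AE: "A \<subseteq> E" using A BE XE by auto
  have "a \<in> first_part A" if a: "a \<in> A" "a \<in> B" for a
  proof -
    have sub: "{b \<in> B. a < b} \<subseteq> E" using BE by auto
    have "x \<in> cl {b \<in> B. a < b}" if x: "x \<in> A" "a < x" for x
    proof (cases "x \<in> B")
      case True
      then show ?thesis using x cl_extensive[OF sub] by auto
    next
      case False
      then have "x \<in> cl {b \<in> B. x < b}" using A x by (auto simp: external_def)
      moreover have "cl {b \<in> B. x < b} \<subseteq> cl {b \<in> B. a < b}"
        using x by (intro cl_mono[OF _ sub]) auto
      ultimately show ?thesis by blast
    qed
    then have "cl {x \<in> A. a < x} \<subseteq> cl {b \<in> B. a < b}" by (intro cl_least[OF _ sub]) auto
    also have "\<dots> \<subseteq> cl (B - {a})" using BE by (intro cl_mono) auto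
    finally show ?thesis using B a by (auto simp: indep_def first_part_def)
  qed
  moreover have "a \<notin> first_part A" if a: "a \<in> A" "a \<notin> B" for a
  proof -
    have "a \<in> cl {b \<in> B - internal B. a < b}" using a A by (intro external_in_cl[OF B]) auto
    moreover have "cl {b \<in> B - internal B. a < b} \<subseteq> cl {x \<in> A. a < x}"
      by (rule cl_mono) (use A AE in auto)
    ultimately show ?thesis by (auto simp: first_part_def)
  qed
  ultimately show ?thesis by (auto simp: first_part_def)
qed

text \<open>An element \<open>b\<close> of \<open>B - A\<close> is internally active, so
  \<open>B - {b}\<close> spans \<open>A\<close> and everything below \<open>b\<close>, and
  \<open>b\<close> is accepted. Conversely, an accepted \<open>e\<close> outside \<open>B\<close>
  would have a larger, internally active element in its circuit.\<close>

lemma second_part_eq: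
  assumes B: "B \<in> bases" and A: "B - internal B \<subseteq> A" "A \<subseteq> B \<union> external B"
  shows "second_part A = B - A"
proof -
  have iB: "indep B" and spans: "E \<subseteq> cl B" and BE: "B \<subseteq> E" and XE: "external B \<subseteq> E" and fB: "finite B"
    using B by (auto simp: bases_def indep_def external_def)
  have AE: "A \<subseteq> E" using A BE XE by auto
  have "b \<in> second_part A" if b: "b \<in> B" "b \<notin> A" for b
  proof -
    have sub: "B - {b} \<subseteq> E" using BE by auto
    have bi: "b \<in> internal B" using b A by auto
    have "cl (B - internal B) \<subseteq> cl (B - {b})" using bi by (intro cl_mono[OF _ sub]) auto
    then have "external B \<subseteq> cl (B - {b})" using external_subset_cl[OF iB] by blast
    then have "A \<union> {e \<in> E. e < b} \<subseteq> cl (B - {b})"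
      using A b bi cl_extensive[OF sub] by (auto simp: internal_def)
    then have "cl (A \<union> {e \<in> E. e < b}) \<subseteq> cl (B - {b})" using sub by (rule cl_least)
    then show ?thesis using b iB BE by (auto simp: second_part_def indep_def)
  qed
  moreover have "e \<in> B" if e: "e \<in> second_part A" for e
  proof (rule ccontr)
    assume eB: "e \<notin> B"
    have eE: "e \<in> E" and en: "e \<notin> cl (A \<union> {e' \<in> E. e' < e})" using e by (auto simp: second_part_def)
    obtain T where T: "T \<subseteq> B" "e \<in> cl T" "\<And>t. t \<in> T \<Longrightarrow> e \<notin> cl (T - {t})"
      using minimal_spanning_subset[of B e] fB spans eE by auto
    \<comment> \<open>As \<open>e\<close> was accepted, its circuit must leave both \<open>A\<close>
      and the elements below \<open>e\<close>. The \<open>t\<close> found this way is internally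
      active, because it is missing from \<open>A\<close>, and exceeds \<open>e\<close>.\<close>
    have "\<not> T \<subseteq> A \<union> {e' \<in> E. e' < e}" using cl_mono[of T "A \<union> {e' \<in> E. e' < e}"] T en AE by auto
    then obtain t where t: "t \<in> T" "t \<notin> A" "\<not> t < e" using T BE by auto
    then have "e < t" using T eB by (metis linorder_neqE subsetD)
    then have "t \<notin> internal B" using circuit_internal[OF iB T(1) eE T(2) t(1)] T(3) t by auto
    then show False using t T A by auto
  qed
  ultimately show ?thesis using second_part_disjoint[OF AE] by auto
qed

text \<open>Identifies the fibres of the function \<open>basis_of\<close> with the intervals, so
  that disjointness and covering need no further argument.\<close>

theorem basis_of_eq_iff:
  assumes A: "A \<subseteq> E" and B: "B \<in> bases"
  shows "basis_of A = B \<longleftrightarrow> B - internal B \<subseteq> A \<and> A \<subseteq> B \<union> external B"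
proof
  assume "basis_of A = B"
  then show "B - internal B \<subseteq> A \<and> A \<subseteq> B \<union> external B"
    using second_part_internal[OF A] diff_first_part_external[OF A]
    by (auto simp: basis_of_def first_part_def)
next
  assume "B - internal B \<subseteq> A \<and> A \<subseteq> B \<union> external B"
  then show "basis_of A = B"
    using first_part_eq[of B A] second_part_eq[of B A] B by (auto simp: basis_of_def bases_def)
qed

lemma internal_subset: "internal B \<subseteq> B"
  by (auto simp: internal_def)

lemma external_disjoint: "external B \<inter> B = {}"
  by (auto simp: external_def)

text \<open>The intervals \<open>[B - internal B, B \<union> external B]\<close> partition the power set (Crapo).\<close>

theorem sum_Pow_eq_sum_bases:
  fixes w :: "'e set \<Rightarrow> 'r::comm_monoid_add"
  shows "(\<Sum>A\<in>Pow E. w A) =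
    (\<Sum>B\<in>bases. \<Sum>K\<in>Pow (internal B). \<Sum>L\<in>Pow (external B). w ((B - internal B) \<union> K \<union> L))"
proof -
  have bE: "B \<subseteq> E" if "B \<in> bases" for B using that by (auto simp: bases_def indep_def)
  have fb: "finite bases" by (rule finite_subset[of _ "Pow E"]) (use bE finite_ground in auto)
  have "(\<Sum>A\<in>Pow E. w A) = (\<Sum>B\<in>bases. \<Sum>A\<in>{A \<in> Pow E. basis_of A = B}. w A)"
    by (rule sum.group[symmetric]) (use fb finite_ground basis_of_in_bases in auto)
  also have "\<dots> = (\<Sum>B\<in>bases. \<Sum>K\<in>Pow (internal B). \<Sum>L\<in>Pow (external B). w ((B - internal B) \<union> K \<union> L))"
  proof (rule sum.cong[OF refl])
    fix B assume B: "B \<in> bases"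
    have BE: "B \<subseteq> E" and XE: "external B \<subseteq> E" using bE[OF B] by (auto simp: external_def)
    have "(\<Sum>K\<in>Pow (internal B). \<Sum>L\<in>Pow (external B). w ((B - internal B) \<union> K \<union> L)) =
          (\<Sum>(K, L)\<in>Pow (internal B) \<times> Pow (external B). w ((B - internal B) \<union> K \<union> L))"
      by (rule sum.cartesian_product)
    also have "\<dots> = (\<Sum>A\<in>{A \<in> Pow E. basis_of A = B}. w A)"
    proof (rule sum.reindex_bij_witness[where i = "\<lambda>A. (A \<inter> internal B, A \<inter> external B)"
          and j = "\<lambda>(K, L). (B - internal B) \<union> K \<union> L"])
      fix A assume "A \<in> {A \<in> Pow E. basis_of A = B}"
      then have A: "A \<subseteq> E" "B - internal B \<subseteq> A" "A \<subseteq> B \<union> external B"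
        using basis_of_eq_iff[of A B] B by auto
      show "(case (A \<inter> internal B, A \<inter> external B) of (K, L) \<Rightarrow> (B - internal B) \<union> K \<union> L) = A"
        using A internal_subset[of B] by auto
    next
      fix KL assume "KL \<in> Pow (internal B) \<times> Pow (external B)"
      then obtain K L where KL: "KL = (K, L)" "K \<subseteq> internal B" "L \<subseteq> external B" by auto
      let ?A = "(B - internal B) \<union> K \<union> L"
      have "?A \<subseteq> E" using KL BE XE internal_subset[of B] by auto
      then show "(case KL of (K, L) \<Rightarrow> (B - internal B) \<union> K \<union> L) \<in> {A \<in> Pow E. basis_of A = B}"
        using basis_of_eq_iff[of ?A B] B KL internal_subset[of B] by auto
      show "((case KL of (K, L) \<Rightarrow> (B - internal B) \<union> K \<union> L) \<inter> internal B,
             (case KL of (K, L) \<Rightarrow> (B - internal B) \<union> K \<union> L) \<inter> external B) = KL"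
        using KL internal_subset[of B] external_disjoint[of B] by auto
    qed (auto split: prod.splits)
    finally show "(\<Sum>A\<in>{A \<in> Pow E. basis_of A = B}. w A) =
        (\<Sum>K\<in>Pow (internal B). \<Sum>L\<in>Pow (external B). w ((B - internal B) \<union> K \<union> L))" ..
  qed
  finally show ?thesis .
qed

end

section \<open>Isolators and coset indices\<close>

text \<open>Serves to compare coset counts of different subgroups: only the criteria for two cosets
  to be equal have to be matched.\<close>

lemma card_image_cong:
  assumes "\<And>x y. x \<in> S \<Longrightarrow> y \<in> S \<Longrightarrow> f x = f y \<longleftrightarrow> h x = h y"
  shows "card (f ` S) = card (h ` S)"
proof (rule bij_betw_same_card)
  have "h (inv_into S f (f x)) = h x" if "x \<in> S" for x
    using that assms[of "inv_into S f (f x)" x] by (simp add: f_inv_into_f inv_into_into)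
  then show "bij_betw (\<lambda>z. h (inv_into S f z)) (f ` S) (h ` S)"
    unfolding bij_betw_def inj_on_def using assms by (auto simp: image_image)
qed

text \<open>The saturation, or pure closure, of the subgroup generated by \<open>S\<close>: the
  preimage of the torsion subgroup of the quotient by it.\<close>

definition isolator :: "('a, 'm) monoid_scheme \<Rightarrow> 'a set \<Rightarrow> 'a set" where
  "isolator G S = {x \<in> carrier G. \<exists>k::nat. k > 0 \<and> x [^]\<^bsub>G\<^esub> k \<in> generate G S}"

text \<open>The index of \<open>H\<close> in \<open>D\<close> when \<open>H\<close> is a subgroup of
  a group \<open>D\<close>. An infinite index counts as 0, so positivity is a statement of its own
  (\<open>list_mult_pos\<close>).\<close>

definition coset_index :: "('a, 'm) monoid_scheme \<Rightarrow> 'a set \<Rightarrow> 'a set \<Rightarrow> nat" where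
  "coset_index G D H = card ((\<lambda>x. H #>\<^bsub>G\<^esub> x) ` D)"

context comm_group
begin

lemma subgroup_adjoin:
  assumes H: "subgroup H G" and x: "x \<in> carrier G"
  shows "subgroup {h \<otimes> x [^] (k::int) |h k. h \<in> H} G"
proof (rule subgroupI)
  note HC = subgroup.mem_carrier[OF H]
  show "{h \<otimes> x [^] (k::int) |h k. h \<in> H} \<subseteq> carrier G" using HC x by auto
  show "{h \<otimes> x [^] (k::int) |h k. h \<in> H} \<noteq> {}" using subgroup.one_closed[OF H] by auto
  fix a assume "a \<in> {h \<otimes> x [^] (k::int) |h k. h \<in> H}"
  then obtain h k where a: "a = h \<otimes> x [^] (k::int)" "h \<in> H" by auto
  have "inv a = inv h \<otimes> x [^] (-k)" using a HC x by (simp add: inv_mult int_pow_neg)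
  then show "inv a \<in> {h \<otimes> x [^] (k::int) |h k. h \<in> H}"
    using subgroup.m_inv_closed[OF H a(2)] by blast
  fix b assume "b \<in> {h \<otimes> x [^] (k::int) |h k. h \<in> H}"
  then obtain h' k' where b: "b = h' \<otimes> x [^] (k'::int)" "h' \<in> H" by auto
  have "a \<otimes> b = (h \<otimes> h') \<otimes> x [^] (k + k')" using a b HC x by (simp add: int_pow_mult m_ac)
  then show "a \<otimes> b \<in> {h \<otimes> x [^] (k::int) |h k. h \<in> H}"
    using subgroup.m_closed[OF H a(2) b(2)] by blast
qed

lemma generate_subgroup: "subgroup H G \<Longrightarrow> generate G H = H"
  by (rule generateI[symmetric]) auto

text \<open>The normal form behind the exchange property and behind every induction that adjoins one
  generator at a time.\<close>

lemma generate_insert: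
  assumes S: "S \<subseteq> carrier G" and x: "x \<in> carrier G"
  shows "generate G (insert x S) = {h \<otimes> x [^] (k::int) |h k. h \<in> generate G S}"
proof (rule generateI[symmetric])
  note sub = generate_is_subgroup[OF S]
  show "subgroup {h \<otimes> x [^] (k::int) |h k. h \<in> generate G S} G" by (rule subgroup_adjoin[OF sub x])
  have "x = \<one> \<otimes> x [^] (1::int)" using x by simp
  moreover have "s = s \<otimes> x [^] (0::int)" if "s \<in> S" for s using that S x by auto
  ultimately show "insert x S \<subseteq> {h \<otimes> x [^] (k::int) |h k. h \<in> generate G S}"
    using generate.one[of G S] generate.incl[of _ S G] by blast
  fix K assume K: "subgroup K G" "insert x S \<subseteq> K"
  then have "generate G S \<subseteq> K" by (intro generate_subgroup_incl) auto
  then show "{h \<otimes> x [^] (k::int) |h k. h \<in> generate G S} \<subseteq> K"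
    using subgroup.m_closed[OF K(1)] subgroup_int_pow_closed[OF K(1)] K(2) by auto
qed

lemma generate_insert_subgroup:
  assumes "subgroup H G" "x \<in> carrier G"
  shows "generate G (insert x H) = {h \<otimes> x [^] (k::int) |h k. h \<in> H}"
  using generate_insert[OF subgroup.subset[OF assms(1)] assms(2)] generate_subgroup[OF assms(1)] by simp

lemma generate_insert_generate:
  assumes "S \<subseteq> carrier G" "x \<in> carrier G"
  shows "generate G (insert x (generate G S)) = generate G (insert x S)"
  using generate_insert[OF assms] generate_insert_subgroup[OF generate_is_subgroup] assms by simp

text \<open>The coefficients are indexed by \<open>A\<close> and not by its image, so that repeated
  entries of the list keep separate coefficients.\<close>

lemma mem_generate_image_iff:
  fixes g :: "'e \<Rightarrow> 'a"
  assumes "finite A" "g ` A \<subseteq> carrier G"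
  shows "x \<in> generate G (g ` A) \<longleftrightarrow> (\<exists>c::'e \<Rightarrow> int. x = (\<Otimes>e\<in>A. g e [^] c e))" using assms
proof (induction A arbitrary: x rule: finite_induct)
  case empty
  have "generate G {} = {\<one>}"
    by (rule generateI[symmetric]) (auto intro: triv_subgroup simp: subgroup.one_closed)
  then show ?case by simp
next
  case (insert a A)
  then have gA: "g ` A \<subseteq> carrier G" and ga: "g a \<in> carrier G" by auto
  have prod: "(\<Otimes>e\<in>insert a A. g e [^] (c e::int)) = (\<Otimes>e\<in>A. g e [^] c e) \<otimes> g a [^] c a"
    for c using insert.hyps gA ga by (subst finprod_insert) (auto intro!: m_comm finprod_closed)
  have "x \<in> generate G (g ` insert a A) \<longleftrightarrow>
        (\<exists>h k. x = h \<otimes> g a [^] (k::int) \<and> h \<in> generate G (g ` A))"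
    using generate_insert[OF gA ga] by simp
  also have "\<dots> \<longleftrightarrow> (\<exists>c k. x = (\<Otimes>e\<in>A. g e [^] (c e::int)) \<otimes> g a [^] (k::int))"
    by (auto simp: insert.IH[OF gA])
  also have "\<dots> \<longleftrightarrow> (\<exists>c::'e \<Rightarrow> int. x = (\<Otimes>e\<in>insert a A. g e [^] c e))"
  proof
    assume "\<exists>c k. x = (\<Otimes>e\<in>A. g e [^] (c e::int)) \<otimes> g a [^] (k::int)"
    then obtain c k where ck: "x = (\<Otimes>e\<in>A. g e [^] (c e::int)) \<otimes> g a [^] (k::int)" by blast
    have "(\<Otimes>e\<in>A. g e [^] ((c(a := k)) e)) = (\<Otimes>e\<in>A. g e [^] (c e))"
      using insert.hyps gA by (intro finprod_cong) (auto simp: simp_implies_def)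
    then have "x = (\<Otimes>e\<in>insert a A. g e [^] ((c(a := k)) e))" unfolding prod using ck by simp
    then show "\<exists>c::'e \<Rightarrow> int. x = (\<Otimes>e\<in>insert a A. g e [^] c e)" by blast
  qed (use prod in blast)
  finally show ?case .
qed

lemma mem_isolator_iff:
  "x \<in> isolator G S \<longleftrightarrow> x \<in> carrier G \<and> (\<exists>k::nat. k > 0 \<and> x [^] k \<in> generate G S)"
  by (simp add: isolator_def)

lemma mem_isolator_int_iff:
  assumes "S \<subseteq> carrier G"
  shows "x \<in> isolator G S \<longleftrightarrow> x \<in> carrier G \<and> (\<exists>k::int. k \<noteq> 0 \<and> x [^] k \<in> generate G S)"
proof -
  have "\<exists>k::nat. k > 0 \<and> x [^] k \<in> generate G S"
    if x: "x \<in> carrier G" and k: "k \<noteq> 0" "x [^] (k::int) \<in> generate G S" for k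
  proof -
    have "x [^] \<bar>k\<bar> \<in> generate G S"
      using generate_m_inv_closed[OF assms k(2)] x k by (auto simp: abs_if int_pow_neg)
    moreover have "x [^] \<bar>k\<bar> = x [^] nat \<bar>k\<bar>" by (metis abs_ge_zero pow_nat)
    ultimately show ?thesis using k(1) by (metis zero_less_abs_iff zero_less_nat_eq)
  qed
  moreover have "\<exists>k::int. k \<noteq> 0 \<and> x [^] k \<in> generate G S"
    if "k > 0" "x [^] (k::nat) \<in> generate G S" for k
    using that by (intro exI[of _ "int k"]) (auto simp: int_pow_int)
  ultimately show ?thesis by (auto simp: mem_isolator_iff)
qed

lemma isolator_subset_carrier: "isolator G S \<subseteq> carrier G"
  by (auto simp: isolator_def)

lemma generate_subset_isolator:
  assumes "S \<subseteq> carrier G" shows "generate G S \<subseteq> isolator G S"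
proof
  fix x assume "x \<in> generate G S"
  then have "x \<in> carrier G" "x [^] (1::nat) \<in> generate G S"
    using generate_in_carrier[OF assms] by auto
  then show "x \<in> isolator G S" unfolding mem_isolator_iff by (metis less_one zero_less_one)
qed

lemma subgroup_isolator:
  assumes S: "S \<subseteq> carrier G" shows "subgroup (isolator G S) G"
proof (rule subgroupI)
  note sub = generate_is_subgroup[OF S]
  show "isolator G S \<noteq> {}" using generate_subset_isolator[OF S] generate.one[of G S] by auto
  fix a assume a: "a \<in> isolator G S"
  then obtain k :: int where k: "k \<noteq> 0" "a [^] k \<in> generate G S" and aC: "a \<in> carrier G"
    by (auto simp: mem_isolator_int_iff[OF S])
  have "inv a [^] k \<in> generate G S"
    using generate_m_inv_closed[OF S k(2)] aC by (simp add: int_pow_inv)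
  then show "inv a \<in> isolator G S" using k aC by (auto simp: mem_isolator_int_iff[OF S])
  fix b assume "b \<in> isolator G S"
  then obtain l :: int where l: "l \<noteq> 0" "b [^] l \<in> generate G S" and bC: "b \<in> carrier G"
    by (auto simp: mem_isolator_int_iff[OF S])
  have "(a \<otimes> b) [^] (k * l) = (a [^] k) [^] l \<otimes> (b [^] l) [^] k"
    using aC bC by (simp add: int_pow_distrib int_pow_pow mult.commute)
  also have "\<dots> \<in> generate G S"
    using subgroup.m_closed[OF sub] subgroup_int_pow_closed[OF sub] k l by blast
  finally have "(a \<otimes> b) [^] (k * l) \<in> generate G S" .
  moreover have "k * l \<noteq> 0" using k l by simp
  ultimately show "a \<otimes> b \<in> isolator G S"
    using aC bC unfolding mem_isolator_int_iff[OF S] by blast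
qed (auto simp: isolator_def)

lemma isolator_mono: "S \<subseteq> T \<Longrightarrow> isolator G S \<subseteq> isolator G T"
  using mono_generate[of S T] by (auto simp: isolator_def)

lemma root_in_isolator:
  assumes S: "S \<subseteq> carrier G" and x: "x \<in> carrier G" "k \<noteq> 0" "x [^] (k::int) \<in> isolator G S"
  shows "x \<in> isolator G S"
proof -
  obtain l :: int where l: "l \<noteq> 0" "(x [^] k) [^] l \<in> generate G S"
    using x by (auto simp: mem_isolator_int_iff[OF S])
  then have "k * l \<noteq> 0" "x [^] (k * l) \<in> generate G S" using x by (auto simp: int_pow_pow)
  then show ?thesis using x unfolding mem_isolator_int_iff[OF S] by blast
qed

lemma generate_subset_isolatorI:
  "S \<subseteq> isolator G T \<Longrightarrow> T \<subseteq> carrier G \<Longrightarrow> generate G S \<subseteq> isolator G T"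
  by (rule generate_subgroup_incl[OF _ subgroup_isolator])

lemma isolator_least:
  assumes "S \<subseteq> isolator G T" "T \<subseteq> carrier G"
  shows "isolator G S \<subseteq> isolator G T"
proof
  fix x assume "x \<in> isolator G S"
  then obtain k :: nat where k: "x \<in> carrier G" "k > 0" "x [^] k \<in> generate G S"
    by (auto simp: isolator_def)
  then have "x [^] int k \<in> isolator G T"
    using subsetD[OF generate_subset_isolatorI[OF assms] k(3)] by (simp add: int_pow_int)
  then show "x \<in> isolator G T" using root_in_isolator[OF assms(2) k(1), of "int k"] k(2) by simp
qed

lemma isolator_generate:
  "S \<subseteq> carrier G \<Longrightarrow> isolator G (generate G S) = isolator G S"
  by (simp add: isolator_def generate_subgroup generate_is_subgroup)

text \<open>A power of \<open>x\<close> equals some \<open>h\<close> from the span of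
  \<open>S\<close> times a power of \<open>y\<close>. That exponent of \<open>y\<close> is nonzero,
  as \<open>x\<close> would otherwise be in the isolator of \<open>S\<close>, so the relation can be
  solved for a power of \<open>y\<close>.\<close>

lemma isolator_exchange:
  assumes S: "S \<subseteq> carrier G" and x: "x \<in> carrier G" and y: "y \<in> carrier G"
    and "x \<in> isolator G (insert y S)" "x \<notin> isolator G S"
  shows "y \<in> isolator G (insert x S)"
proof -
  obtain k :: int where k: "k \<noteq> 0" "x [^] k \<in> generate G (insert y S)"
    using assms by (auto simp: mem_isolator_int_iff)
  then obtain h and j :: int where h: "x [^] k = h \<otimes> y [^] j" "h \<in> generate G S"
    unfolding generate_insert[OF S y] by auto
  have hC: "h \<in> carrier G" using h S generate_in_carrier by auto
  have "j \<noteq> 0"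
  proof
    assume "j = 0"
    then have "x [^] k \<in> generate G S" using h hC by simp
    then show False using assms(5) k x by (auto simp: mem_isolator_int_iff[OF S])
  qed
  moreover have "y [^] j = inv h \<otimes> x [^] k" using h hC x y by (simp add: inv_solve_left)
  then have "y [^] j = inv h \<otimes> x [^] k \<and> inv h \<in> generate G S"
    using generate_m_inv_closed[OF S] h by blast
  then have "y [^] j \<in> generate G (insert x S)" unfolding generate_insert[OF S x] by blast
  ultimately show ?thesis using mem_isolator_int_iff[of "insert x S" y] S x y by blast
qed

sublocale sat: pregeometry "carrier G" "isolator G"
proof
  show "S \<subseteq> carrier G \<Longrightarrow> S \<subseteq> isolator G S" for S
    using generate_subset_isolator[of S] generate.incl[of _ S G] by blast
  show "S \<subseteq> carrier G \<Longrightarrow> isolator G (isolator G S) \<subseteq> isolator G S" for S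
    by (rule isolator_least) auto
qed (auto simp: isolator_subset_carrier isolator_exchange dest: isolator_mono
     intro: isolator_subset_carrier[THEN subsetD])

text \<open>A relation with nonzero coefficient at \<open>s\<close> says that a nonzero power of
  \<open>s\<close> lies in the subgroup generated by the others, which is membership of
  \<open>s\<close> in their isolator.\<close>

lemma Z_independent_iff_indep: "Z_independent G S \<longleftrightarrow> sat.indep S"
proof (cases "finite S \<and> S \<subseteq> carrier G")
  case True
  then have fin: "finite S" and SC: "S \<subseteq> carrier G" by auto
  have split: "(\<Otimes>s\<in>S. s [^] (c s::int)) = s [^] c s \<otimes> (\<Otimes>t\<in>S - {s}. t [^] c t)"
    if "s \<in> S" for c s
  proof -
    have "insert s (S - {s}) = S" using that by auto
    moreover have "(\<Otimes>s\<in>insert s (S - {s}). s [^] (c s::int)) = s [^] c s \<otimes> (\<Otimes>t\<in>S - {s}. t [^] c t)"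
      using fin SC that by (subst finprod_insert) auto
    ultimately show ?thesis by simp
  qed
  have gen: "x \<in> generate G (S - {s}) \<longleftrightarrow> (\<exists>c. x = (\<Otimes>t\<in>S - {s}. t [^] (c t::int)))" for x s
    using mem_generate_image_iff[of "S - {s}" id x] fin SC by auto
  have prodC: "(\<Otimes>t\<in>S - {s}. t [^] (c t::int)) \<in> carrier G" for c s
    using SC by (intro finprod_closed) auto
  have sub: "S - {s} \<subseteq> carrier G" for s using SC by auto
  show ?thesis
  proof
    assume Z: "Z_independent G S"
    have "s \<notin> isolator G (S - {s})" if s: "s \<in> S" for s
    proof
      assume "s \<in> isolator G (S - {s})"
      then obtain k :: int and c where k: "k \<noteq> 0" and c: "s [^] k = (\<Otimes>t\<in>S - {s}. t [^] (c t::int))"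
        by (auto simp: mem_isolator_int_iff[OF sub] gen)
      have sC: "s \<in> carrier G" using s SC by auto
      have "(\<Otimes>t\<in>S - {s}. t [^] ((c(s := - k)) t)) = (\<Otimes>t\<in>S - {s}. t [^] c t)"
        using SC by (intro finprod_cong) (auto simp: simp_implies_def)
      then have "(\<Otimes>t\<in>S. t [^] ((c(s := - k)) t)) = s [^] (- k) \<otimes> s [^] k"
        unfolding split[OF s] c by simp
      also have "\<dots> = \<one>" using sC by (simp add: int_pow_neg)
      finally have "(c(s := - k)) s = 0" using Z s unfolding Z_independent_def by blast
      then show False using k by simp
    qed
    then show "sat.indep S" using fin SC by (simp add: sat.indep_def)
  next
    assume I: "sat.indep S"
    have "c s = 0" if c: "(\<Otimes>t\<in>S. t [^] (c t::int)) = \<one>" and s: "s \<in> S" for c s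
    proof (rule ccontr)
      assume "c s \<noteq> 0"
      have sC: "s \<in> carrier G" using s SC by auto
      have "s [^] c s \<otimes> (\<Otimes>t\<in>S - {s}. t [^] c t) = \<one>" using c split[OF s, of c] by simp
      then have "s [^] c s = inv (\<Otimes>t\<in>S - {s}. t [^] c t)"
        using prodC[where s = s and c = c] sC by (metis int_pow_closed inv_equality)
      then have "s [^] c s \<in> generate G (S - {s})"
        using generate_m_inv_closed[OF sub] gen[of _ s] by metis
      then have "s \<in> isolator G (S - {s})"
        using \<open>c s \<noteq> 0\<close> sC by (auto simp: mem_isolator_int_iff[OF sub])
      then show False using I s by (simp add: sat.indep_def)
    qed
    then show "Z_independent G S" using fin SC by (auto simp: Z_independent_def)
  qed
qed (auto simp: Z_independent_def sat.indep_def)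

section \<open>Indices of subgroups and multiplicities\<close>

lemma rcos_eq_iff:
  assumes "subgroup H G" "x \<in> carrier G" "y \<in> carrier G"
  shows "H #> x = H #> y \<longleftrightarrow> x \<otimes> inv y \<in> H"
  by (metis assms coset_join1 coset_join2 coset_mult_inv1 coset_mult_inv2 inv_closed m_closed subgroup.subset)

text \<open>The map from \<open>H\<close>-cosets to \<open>H'\<close>-cosets has fibres of equal
  size: over the coset of \<open>d\<close> lie the translates by \<open>d\<close> of the
  \<open>H\<close>-cosets in \<open>H'\<close>.\<close>

lemma coset_index_mult:
  assumes H: "subgroup H G" and H': "subgroup H' G" and D: "subgroup D G"
    and sub: "H \<subseteq> H'" "H' \<subseteq> D" and fin: "finite ((\<lambda>x. H #> x) ` D)"
  shows "coset_index G D H = coset_index G D H' * coset_index G H' H"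
proof -
  note DC = subgroup.mem_carrier[OF D] and HC = subgroup.mem_carrier[OF H']
  \<comment> \<open>A union over all elements of the coset, so that no representative is chosen; on
    an \<open>H\<close>-coset all its members coincide.\<close>
  define q where "q X = (\<Union>y\<in>X. H' #> y)" for X
  have q: "q (H #> x) = H' #> x" if "x \<in> D" for x
  proof -
    have "H' #> y = H' #> x" if "y \<in> H #> x" for y
    proof -
      have "y \<in> H' #> x" using that sub by (auto simp: r_coset_def)
      then show ?thesis using repr_independence[OF _ DC[OF \<open>x \<in> D\<close>] H'] by simp
    qed
    then have "q (H #> x) = (\<Union>y\<in>H #> x. H' #> x)" unfolding q_def by (rule SUP_cong[OF refl])
    then show ?thesis using rcos_self[OF DC[OF that] H] by blast
  qed
  have fin': "finite ((\<lambda>x. H' #> x) ` D)"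
    by (rule finite_surj[OF fin, of _ q]) (use q in \<open>auto simp: image_iff\<close>)
  have fibre: "card {X \<in> (\<lambda>x. H #> x) ` D. q X = Y} = coset_index G H' H"
    if Y: "Y \<in> (\<lambda>x. H' #> x) ` D" for Y
  proof -
    obtain d where d: "d \<in> D" "Y = H' #> d" using Y by auto
    have "{X \<in> (\<lambda>x. H #> x) ` D. q X = Y} = (\<lambda>h. H #> (h \<otimes> d)) ` H'"
    proof (intro equalityI subsetI)
      fix X assume "X \<in> {X \<in> (\<lambda>x. H #> x) ` D. q X = Y}"
      then obtain x where x: "x \<in> D" "X = H #> x" "q (H #> x) = Y" by blast
      then have "H' #> x = H' #> d" using q[of x] d by simp
      then have "x \<otimes> inv d \<in> H'" using rcos_eq_iff[OF H' DC[OF x(1)] DC[OF d(1)]] by blast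
      moreover have "X = H #> ((x \<otimes> inv d) \<otimes> d)" using x d DC by (simp add: m_assoc)
      ultimately show "X \<in> (\<lambda>h. H #> (h \<otimes> d)) ` H'" by (rule rev_image_eqI)
    next
      fix X assume "X \<in> (\<lambda>h. H #> (h \<otimes> d)) ` H'"
      then obtain h where h: "h \<in> H'" "X = H #> (h \<otimes> d)" by auto
      have hd: "h \<otimes> d \<in> D" using h d sub subgroup.m_closed[OF D] by auto
      have "(h \<otimes> d) \<otimes> inv d \<in> H'" using h d HC DC by (simp add: m_assoc)
      then have "H' #> (h \<otimes> d) = H' #> d" using rcos_eq_iff[OF H'] hd d DC by blast
      then show "X \<in> {X \<in> (\<lambda>x. H #> x) ` D. q X = Y}" using h hd d q[OF hd] by blast
    qed
    moreover have "card ((\<lambda>h. H #> (h \<otimes> d)) ` H') = card ((\<lambda>h. H #> h) ` H')"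
    proof (rule card_image_cong)
      fix x y assume "x \<in> H'" "y \<in> H'"
      then have C: "x \<in> carrier G" "y \<in> carrier G" "d \<in> carrier G" using HC DC d by auto
      have "(x \<otimes> d) \<otimes> inv (y \<otimes> d) = x \<otimes> ((d \<otimes> inv d) \<otimes> inv y)"
        using C by (simp only: inv_mult_group m_assoc inv_closed m_closed)
      then show "(H #> (x \<otimes> d) = H #> (y \<otimes> d)) = (H #> x = H #> y)"
        using C by (simp add: rcos_eq_iff[OF H])
    qed
    ultimately show ?thesis by (simp add: coset_index_def)
  qed
  have "coset_index G D H = (\<Sum>X\<in>(\<lambda>x. H #> x) ` D. 1)" by (simp add: coset_index_def)
  also have "\<dots> = (\<Sum>Y\<in>(\<lambda>x. H' #> x) ` D. \<Sum>X\<in>{X \<in> (\<lambda>x. H #> x) ` D. q X = Y}. 1)"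
    by (rule sum.group[symmetric]) (use fin fin' q in auto)
  also have "\<dots> = (\<Sum>Y\<in>(\<lambda>x. H' #> x) ` D. coset_index G H' H)"
    using fibre by (intro sum.cong) (auto simp del: image_iff)
  finally show ?thesis by (simp add: coset_index_def)
qed

text \<open>Every \<open>C\<close>-coset in the product has a representative in \<open>A'\<close>,
  and for two elements of \<open>A'\<close> equality modulo \<open>C\<close> is equality modulo the
  intersection, which is \<open>A\<close>.\<close>

lemma coset_index_second_iso:
  assumes A': "subgroup A' G" and C: "subgroup C G" and A: "subgroup A G"
    and int: "C \<inter> A' = A"
  shows "coset_index G (C <#> A') C = coset_index G A' A"
proof -
  note cC = subgroup.mem_carrier[OF C] and aC = subgroup.mem_carrier[OF A']
  have "(\<lambda>x. C #> x) ` (C <#> A') = (\<lambda>x. C #> x) ` A'"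
  proof (intro equalityI subsetI)
    fix X assume "X \<in> (\<lambda>x. C #> x) ` (C <#> A')"
    then obtain c a where ca: "c \<in> C" "a \<in> A'" "X = C #> (c \<otimes> a)" unfolding set_mult_def by blast
    have "C #> (c \<otimes> a) = (C #> c) #> a"
      using ca cC aC subgroup.subset[OF C] by (simp add: coset_mult_assoc)
    also have "\<dots> = C #> a" using ca C cC by (simp add: coset_join2)
    finally show "X \<in> (\<lambda>x. C #> x) ` A'" using ca by auto
  next
    fix X assume "X \<in> (\<lambda>x. C #> x) ` A'"
    then obtain a where a: "a \<in> A'" "X = C #> a" by auto
    have "a = \<one> \<otimes> a" using a aC by simp
    then have "a \<in> C <#> A'" using a subgroup.one_closed[OF C] unfolding set_mult_def by blast
    then show "X \<in> (\<lambda>x. C #> x) ` (C <#> A')" using a by auto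
  qed
  moreover have "card ((\<lambda>x. C #> x) ` A') = card ((\<lambda>x. A #> x) ` A')"
  proof (rule card_image_cong)
    fix x y assume xy: "x \<in> A'" "y \<in> A'"
    then have "x \<otimes> inv y \<in> A'" using subgroup.m_closed[OF A'] subgroup.m_inv_closed[OF A'] by blast
    then show "(C #> x = C #> y) = (A #> x = A #> y)"
      using xy aC int by (auto simp: rcos_eq_iff[OF C] rcos_eq_iff[OF A])
  qed
  ultimately show ?thesis by (simp add: coset_index_def)
qed

text \<open>A coset has finite order in the quotient exactly when a positive power of a
  representative lies in \<open>H\<close>.\<close>

lemma order_torsion_Mod:
  assumes H: "subgroup H G"
  shows "carrier (torsion_group (G Mod H)) = (\<lambda>x. H #> x) ` isolator G H"
proof -
  interpret N: normal H G using H by (simp add: normal_iff_subgroup)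
  have "(\<exists>k::nat. k > 0 \<and> (H #> x) [^]\<^bsub>G Mod H\<^esub> k = \<one>\<^bsub>G Mod H\<^esub>) \<longleftrightarrow> x \<in> isolator G H"
    if "x \<in> carrier G" for x
  proof -
    have "(H #> x) [^]\<^bsub>G Mod H\<^esub> k = \<one>\<^bsub>G Mod H\<^esub> \<longleftrightarrow> x [^] k \<in> H" for k :: nat
      using that coset_join1[OF _ _ H] coset_join2[OF _ H] by (auto simp: N.FactGroup_pow)
    then show ?thesis using that by (simp add: isolator_def generate_subgroup[OF H])
  qed
  then show ?thesis using subsetD[OF isolator_subset_carrier[of H]]
    by (auto simp: torsion_group_def carrier_FactGroup)
qed

lemma list_mult_eq_index:
  assumes "g ` A \<subseteq> carrier G"
  shows "list_mult G g A = coset_index G (isolator G (g ` A)) (generate G (g ` A))"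
  using order_torsion_Mod[OF generate_is_subgroup[OF assms]] assms
  by (simp add: list_mult_def list_torsion_def order_def span_list_def coset_index_def isolator_generate)

end

section \<open>Finiteness of torsion and the matroid of a list\<close>

context comm_group
begin

lemma generate_Un_generate:
  assumes "A \<subseteq> carrier G" "B \<subseteq> carrier G"
  shows "generate G (generate G A \<union> B) = generate G (A \<union> B)"
proof (rule generateI)
  show "subgroup (generate G (generate G A \<union> B)) G"
    using assms generate_incl[of A] by (intro generate_is_subgroup) auto
  show "A \<union> B \<subseteq> generate G (generate G A \<union> B)"
    using generate.incl[of _ A G] generate.incl[of _ "generate G A \<union> B" G] by blast
  show "generate G (generate G A \<union> B) \<subseteq> K" if "subgroup K G" "A \<union> B \<subseteq> K" for K
    using that generate_subgroup_incl[of A K] by (intro generate_subgroup_incl) auto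
qed

text \<open>Within one coset of the larger subgroup, the elements of \<open>P\<close> are
  \<open>s [^] j\<close> times a fixed \<open>d\<close> modulo \<open>H\<close>, with
  \<open>s [^] j\<close> in the isolator. If \<open>s\<close> is outside the isolator then
  \<open>j = 0\<close>; otherwise \<open>j\<close> matters only modulo some \<open>k\<close> with
  \<open>s [^] k\<close> in \<open>H\<close>. Either way finitely many \<open>H\<close>-cosets
  remain.\<close>

lemma finite_cosets_adjoin:
  assumes H: "subgroup H G" and s: "s \<in> carrier G" and P: "P \<subseteq> isolator G H"
    and fin: "finite ((\<lambda>x. generate G (insert s H) #> x) ` P)"
  shows "finite ((\<lambda>x. H #> x) ` P)"
proof -
  let ?H' = "generate G (insert s H)"
  note HC = subgroup.mem_carrier[OF H]
  have H': "subgroup ?H' G" using subgroup.subset[OF H] s by (intro generate_is_subgroup) auto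
  have PC: "x \<in> carrier G" if "x \<in> P" for x using that P isolator_subset_carrier by blast
  have T: "subgroup (isolator G H) G" using subgroup.subset[OF H] by (rule subgroup_isolator)
  have HT: "H \<subseteq> isolator G H" using sat.cl_extensive subgroup.subset[OF H] by blast
  have fibre: "finite {X. \<exists>x\<in>P. X = H #> x \<and> ?H' #> x = ?H' #> d}" if d: "d \<in> P" for d
  proof -
    have ex: "\<exists>j. s [^] (j::int) \<in> isolator G H \<and> H #> x = H #> (s [^] j \<otimes> d)"
      if x: "x \<in> P" and eq: "?H' #> x = ?H' #> d" for x
    proof -
      have "x \<otimes> inv d \<in> ?H'" using rcos_eq_iff[OF H' PC[OF x] PC[OF d]] eq by blast
      then obtain h j where h: "x \<otimes> inv d = h \<otimes> s [^] (j::int)" "h \<in> H"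
        unfolding generate_insert_subgroup[OF H s] by blast
      have C: "x \<in> carrier G" "d \<in> carrier G" "h \<in> carrier G" using PC x d HC h by auto
      have sj: "s [^] j = inv h \<otimes> (x \<otimes> inv d)" using h C s by (simp add: inv_solve_left)
      moreover have "inv h \<in> isolator G H" "x \<otimes> inv d \<in> isolator G H"
        using h x d P HT subgroup.m_closed[OF T] subgroup.m_inv_closed[OF T] by blast+
      ultimately have "s [^] j \<in> isolator G H" using subgroup.m_closed[OF T] by simp
      moreover have "x \<otimes> inv (s [^] j \<otimes> d) = h"
      proof -
        have "x = h \<otimes> s [^] j \<otimes> d" using inv_solve_right[of "h \<otimes> s [^] j" x d] h C s by simp
        then show ?thesis using C s by (simp add: m_assoc)
      qed
      ultimately show ?thesis using rcos_eq_iff[OF H, of x "s [^] j \<otimes> d"] C s h by auto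
    qed
    show ?thesis
    proof (cases "s \<in> isolator G H")
      case False
      have "j = 0" if "s [^] (j::int) \<in> isolator G H" for j
        using root_in_isolator[OF subgroup.subset[OF H] s _ that] False by auto
      then have "H #> x = H #> (s [^] (0::int) \<otimes> d)" if "x \<in> P" "?H' #> x = ?H' #> d" for x
        using ex[OF that] by metis
      then have "{X. \<exists>x\<in>P. X = H #> x \<and> ?H' #> x = ?H' #> d} \<subseteq> {H #> (s [^] (0::int) \<otimes> d)}" by blast
      then show ?thesis by (rule finite_subset) simp
    next
      case True
      then obtain k :: nat where k: "k > 0" "s [^] k \<in> H"
        by (auto simp: isolator_def generate_subgroup[OF H])
      have red: "H #> (s [^] j \<otimes> d) = H #> (s [^] (j mod int k) \<otimes> d)" for j
      proof -
        have dC: "d \<in> carrier G" using PC d by simp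
        have "s [^] (int k * (j div int k)) = (s [^] k) [^] (j div int k)"
          using int_pow_pow[OF s, of "int k" "j div int k"] by (simp add: int_pow_int)
        also have "\<dots> \<in> H" using subgroup_int_pow_closed[OF H k(2)] .
        finally have q: "s [^] (int k * (j div int k)) \<in> H" .
        have "s [^] j = s [^] (int k * (j div int k) + j mod int k)" by simp
        also have "\<dots> = s [^] (int k * (j div int k)) \<otimes> s [^] (j mod int k)"
          by (rule int_pow_mult[OF s])
        finally have "(s [^] j \<otimes> d) \<otimes> inv (s [^] (j mod int k) \<otimes> d) = s [^] (int k * (j div int k))"
          using s dC by (simp add: m_assoc)
        then show ?thesis
          using q rcos_eq_iff[OF H, of "s [^] j \<otimes> d" "s [^] (j mod int k) \<otimes> d"] s dC by simp
      qed
      have "H #> x \<in> (\<lambda>j. H #> (s [^] j \<otimes> d)) ` {0..<int k}"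
        if x: "x \<in> P" "?H' #> x = ?H' #> d" for x
      proof -
        obtain j :: int where "H #> x = H #> (s [^] j \<otimes> d)" using ex[OF x] by blast
        then have "H #> x = H #> (s [^] (j mod int k) \<otimes> d)" using red by simp
        moreover have "j mod int k \<in> {0..<int k}" using k by simp
        ultimately show ?thesis by (rule image_eqI)
      qed
      then have "{X. \<exists>x\<in>P. X = H #> x \<and> ?H' #> x = ?H' #> d} \<subseteq>
          (\<lambda>j. H #> (s [^] j \<otimes> d)) ` {0..<int k}" by blast
      then show ?thesis by (rule finite_subset) simp
    qed
  qed
  have "(\<lambda>x. H #> x) ` P \<subseteq> (\<Union>Y\<in>(\<lambda>x. ?H' #> x) ` P. {X. \<exists>x\<in>P. X = H #> x \<and> ?H' #> x = Y})" by blast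
  moreover have "finite (\<Union>Y\<in>(\<lambda>x. ?H' #> x) ` P. {X. \<exists>x\<in>P. X = H #> x \<and> ?H' #> x = Y})"
    using fin fibre by (intro finite_UN_I) auto
  ultimately show ?thesis by (rule finite_subset)
qed

text \<open>One generator at a time moves into \<open>H\<close>, whence \<open>H\<close> is
  arbitrary in the induction. The isolator only grows, so the induction hypothesis covers the set in
  question; with no generators left it is a single coset.\<close>

lemma finite_cosets_generate:
  assumes "finite S" "S \<subseteq> carrier G" "subgroup H G"
  shows "finite ((\<lambda>x. H #> x) ` (isolator G H \<inter> generate G (H \<union> S)))" using assms
proof (induction S arbitrary: H rule: finite_induct)
  case empty
  then have "(\<lambda>x. H #> x) ` (isolator G H \<inter> generate G (H \<union> {})) \<subseteq> {H}"
    using coset_join2[OF subgroup.mem_carrier] by (auto simp: generate_subgroup)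
  then show ?case by (rule finite_subset) simp
next
  case (insert s S)
  let ?H' = "generate G (insert s H)"
  have HC: "H \<subseteq> carrier G" and s: "s \<in> carrier G" and SC: "S \<subseteq> carrier G"
    using insert.prems subgroup.subset by auto
  have H': "subgroup ?H' G" using HC s by (intro generate_is_subgroup) auto
  have "generate G (?H' \<union> S) = generate G (H \<union> insert s S)"
    using generate_Un_generate[of "insert s H" S] HC s SC by (simp add: insert_commute)
  moreover have "isolator G H \<subseteq> isolator G ?H'"
    using generate.incl[of _ "insert s H" G] by (intro isolator_mono) blast
  ultimately have "isolator G H \<inter> generate G (H \<union> insert s S) \<subseteq>
      isolator G ?H' \<inter> generate G (?H' \<union> S)" by blast
  then have "finite ((\<lambda>x. ?H' #> x) ` (isolator G H \<inter> generate G (H \<union> insert s S)))"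
    by (rule finite_subset[OF image_mono insert.IH[OF SC H']])
  then show ?case by (intro finite_cosets_adjoin[OF insert.prems(2) s]) auto
qed

lemma finite_cosets_isolator:
  assumes "finitely_generated_group G" "subgroup H G"
  shows "finite ((\<lambda>x. H #> x) ` isolator G H)"
proof -
  obtain S where S: "finite S" "S \<subseteq> carrier G" "generate G S = carrier G"
    using assms by (auto simp: finitely_generated_group_def)
  have "carrier G \<subseteq> generate G (H \<union> S)" using mono_generate[of S "H \<union> S"] S by simp
  then have "isolator G H \<inter> generate G (H \<union> S) = isolator G H"
    using isolator_subset_carrier[of H] by blast
  then show ?thesis using finite_cosets_generate[OF S(1,2) assms(2)] by simp
qed

end

section \<open>The matroid of a list\<close>

locale group_list = comm_group G for G :: "('a, 'm) monoid_scheme" (structure) +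
  fixes g :: "'e \<Rightarrow> 'a" and E :: "'e set"
  assumes finite_E: "finite E" and g_closed: "g ` E \<subseteq> carrier G"
begin

definition list_cl :: "'e set \<Rightarrow> 'e set" where
  "list_cl = (\<lambda>A. {e \<in> E. g e \<in> isolator G (g ` A)})"

sublocale list: pregeometry E list_cl
  unfolding list_cl_def by (rule sat.pregeometry_comap[OF g_closed])

lemma mem_list_cl: "e \<in> list_cl A \<longleftrightarrow> e \<in> E \<and> g e \<in> isolator G (g ` A)"
  by (simp add: list_cl_def)

lemma image_closed: "A \<subseteq> E \<Longrightarrow> g ` A \<subseteq> carrier G"
  using g_closed by blast

text \<open>A value occurring twice in an independent list would lie in the closure of its twin, so
  independence of indices passes to independence of a set of the same size.\<close>

lemma indep_image:
  assumes J: "list.indep J"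
  shows "inj_on g J" "sat.indep (g ` J)"
proof -
  have JE: "J \<subseteq> E" and fJ: "finite J" using J by (auto simp: list.indep_def)
  have notin: "g e \<notin> isolator G (g ` (J - {e}))" if "e \<in> J" for e
    using J that JE by (auto simp: list.indep_def mem_list_cl)
  show inj: "inj_on g J"
  proof (rule inj_onI, rule ccontr)
    fix e e' assume e: "e \<in> J" "e' \<in> J" "g e = g e'" "e \<noteq> e'"
    then have "g e \<in> g ` (J - {e})" by auto
    moreover have "g ` (J - {e}) \<subseteq> isolator G (g ` (J - {e}))"
      using JE by (intro sat.cl_extensive image_closed) auto
    ultimately show False using notin[OF e(1)] by blast
  qed
  have "g ` J - {g e} = g ` (J - {e})" if "e \<in> J" for e using inj that by (auto simp: inj_on_def)
  then show "sat.indep (g ` J)" using notin fJ image_closed[OF JE] by (auto simp: sat.indep_def)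
qed

text \<open>The span of \<open>A\<close> lies in the isolator of the image of \<open>J\<close>, so
  Steinitz bounds every independent subset of the span by \<open>card J\<close>. The same bound
  supplies the finiteness that \<open>Max\<close> requires, and the image of \<open>J\<close>
  attains it.\<close>

lemma list_rk_eq_card:
  assumes J: "list.indep J" "J \<subseteq> A" and A: "A \<subseteq> E" "A \<subseteq> list_cl J"
  shows "list_rk G g A = card J" unfolding list_rk_def subgroup_rank_def span_list_def
proof (rule Max_eqI)
  have JC: "g ` J \<subseteq> carrier G" and AC: "g ` A \<subseteq> carrier G" using image_closed J A by auto
  have "g ` A \<subseteq> isolator G (g ` J)" using A by (auto simp: mem_list_cl)
  then have span: "generate G (g ` A) \<subseteq> isolator G (g ` J)"
    using JC by (rule generate_subset_isolatorI)
  have fJ: "finite (g ` J)" and cJ: "card (g ` J) = card J"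
    using indep_image[OF J(1)] by (auto simp: sat.indep_def card_image)
  have le: "k \<le> card J" if "k \<in> {card S |S. S \<subseteq> generate G (g ` A) \<and> Z_independent G S}" for k
    using that sat.steinitz[OF _ fJ JC] span unfolding Z_independent_iff_indep cJ[symmetric]
    by blast
  have "{card S |S. S \<subseteq> generate G (g ` A) \<and> Z_independent G S} \<subseteq> {..card J}" using le by blast
  then show "finite {card S |S. S \<subseteq> generate G (g ` A) \<and> Z_independent G S}"
    by (rule finite_subset) simp
  show "k \<le> card J" if "k \<in> {card S |S. S \<subseteq> generate G (g ` A) \<and> Z_independent G S}" for k
    using le[OF that] .
  have "g ` J \<subseteq> generate G (g ` A)" using J generate.incl[of _ "g ` A" G] by blast
  then show "card J \<in> {card S |S. S \<subseteq> generate G (g ` A) \<and> Z_independent G S}"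
    using indep_image[OF J(1)] cJ[symmetric] unfolding Z_independent_iff_indep by blast
qed

text \<open>A maximal independent \<open>J\<close> inside \<open>A\<close> has the cardinality of
  the rank; if this is \<open>card A\<close>, then \<open>J\<close> is all of
  \<open>A\<close>.\<close>

lemma list_indep_iff: "list_indep G g E A \<longleftrightarrow> list.indep A"
proof
  assume A: "list_indep G g E A"
  then have AE: "A \<subseteq> E" and fA: "finite A"
    using finite_E finite_subset by (auto simp: list_indep_def)
  obtain J where J: "J \<subseteq> A" "list.indep J" "A \<subseteq> list_cl J"
    using list.basis_extend[OF fA AE list.indep_empty] by auto
  then have "card J = card A"
    using A list_rk_eq_card[OF J(2,1) AE J(3)] by (simp add: list_indep_def)
  then show "list.indep A" using J(2) card_subset_eq[OF fA J(1)] by simp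
next
  assume A: "list.indep A"
  then have "A \<subseteq> E" by (simp add: list.indep_def)
  then show "list_indep G g E A"
    using list_rk_eq_card[OF A order_refl] list.cl_extensive by (auto simp: list_indep_def)
qed

lemma list_bases_eq: "list_bases G g E = {B. list.indep B \<and> E \<subseteq> list_cl B}"
proof (intro equalityI subsetI)
  fix B assume "B \<in> list_bases G g E"
  then have B: "list.indep B" and max: "\<And>A. list.indep A \<Longrightarrow> B \<subseteq> A \<Longrightarrow> A = B"
    by (auto simp: list_bases_def list_indep_iff)
  have "e \<in> list_cl B" if "e \<in> E" for e
  proof (rule ccontr)
    assume e: "e \<notin> list_cl B"
    then have "insert e B = B" using list.indep_insert[OF B that] by (intro max) auto
    then show False using e B list.cl_extensive[of B] by (auto simp: list.indep_def)
  qed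
  then show "B \<in> {B. list.indep B \<and> E \<subseteq> list_cl B}" using B by auto
next
  fix B assume "B \<in> {B. list.indep B \<and> E \<subseteq> list_cl B}"
  then have B: "list.indep B" "E \<subseteq> list_cl B" by auto
  have "A = B" if A: "list.indep A" "B \<subseteq> A" for A
  proof (rule ccontr)
    assume "A \<noteq> B"
    then obtain a where a: "a \<in> A" "a \<notin> B" using A by auto
    have "list_cl B \<subseteq> list_cl (A - {a})"
      by (rule list.cl_mono) (use A a in \<open>auto simp: list.indep_def\<close>)
    moreover have "a \<in> E" "a \<notin> list_cl (A - {a})" using A a by (auto simp: list.indep_def)
    ultimately show False using B by blast
  qed
  then show "B \<in> list_bases G g E" using B by (auto simp: list_bases_def list_indep_iff)
qed

lemma isolator_image_eq:
  assumes "A \<subseteq> B" "B \<subseteq> E" "B \<subseteq> list_cl A"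
  shows "isolator G (g ` B) = isolator G (g ` A)"
proof (rule antisym)
  show "isolator G (g ` B) \<subseteq> isolator G (g ` A)"
    by (rule isolator_least) (use assms image_closed in \<open>auto simp: mem_list_cl\<close>)
qed (use assms in \<open>auto intro!: isolator_mono\<close>)

text \<open>Independent elements added to \<open>R\<close> create no new element of finite order
  modulo the span of \<open>R\<close>: in \<open>h \<otimes> g k [^] j\<close> membership in the
  isolator forces \<open>j = 0\<close>, as \<open>k\<close> is outside the closure of the
  rest.\<close>

lemma generate_Int_isolator:
  assumes "finite K" "list.indep (R \<union> K)" "R \<inter> K = {}"
  shows "generate G (g ` (R \<union> K)) \<inter> isolator G (g ` R) \<subseteq> generate G (g ` R)" using assms
proof (induction K rule: finite_induct)
  case empty
  then show ?case by simp
next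
  case (insert k K)
  have RK: "list.indep (R \<union> K)" by (rule list.indep_subset[OF insert.prems(1)]) auto
  have E: "R \<union> K \<subseteq> E" "k \<in> E" using insert.prems(1) by (auto simp: list.indep_def)
  have "R \<union> insert k K - {k} = R \<union> K" using insert by auto
  then have k: "k \<notin> list_cl (R \<union> K)" using insert.prems(1) by (auto simp: list.indep_def)
  have C: "g ` (R \<union> K) \<subseteq> carrier G" "g k \<in> carrier G" using image_closed E by auto
  note T = subgroup_isolator[OF C(1)]
  show ?case
  proof
    fix x assume x: "x \<in> generate G (g ` (R \<union> insert k K)) \<inter> isolator G (g ` R)"
    then obtain h j where h: "x = h \<otimes> g k [^] (j::int)" "h \<in> generate G (g ` (R \<union> K))"
      using generate_insert[OF C] by auto
    have hT: "h \<in> isolator G (g ` (R \<union> K))" using h generate_subset_isolator[OF C(1)] by auto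
    have xT: "x \<in> isolator G (g ` (R \<union> K))"
      using x isolator_mono[of "g ` R" "g ` (R \<union> K)"] by auto
    have hC: "h \<in> carrier G" using hT isolator_subset_carrier by blast
    have "g k [^] j = inv h \<otimes> x" using h hC C by (simp add: inv_solve_left)
    also have "\<dots> \<in> isolator G (g ` (R \<union> K))"
      using hT xT subgroup.m_closed[OF T] subgroup.m_inv_closed[OF T] by blast
    finally have "j = 0" using root_in_isolator[OF C(1,2), of j] k E by (auto simp: mem_list_cl)
    then have "x = h" using h hC by simp
    then show "x \<in> generate G (g ` R)" using insert.IH[OF RK] insert.prems h x by auto
  qed
qed

text \<open>The axiom of arithmetic matroids for the molecule \<open>[R, R \<union> K \<union> L]\<close> with free part \<open>K\<close>
  and torsion part \<open>L\<close>.\<close>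

lemma list_mult_molecule:
  assumes fg: "finitely_generated_group G"
    and RK: "list.indep (R \<union> K)" "R \<inter> K = {}" and L: "L \<subseteq> list_cl R"
  shows "list_mult G g (R \<union> K \<union> L) * list_mult G g R =
         list_mult G g (R \<union> K) * list_mult G g (R \<union> L)"
proof -
  have fin: "finite K" and RE: "R \<subseteq> E" and KE: "K \<subseteq> E" and LE: "L \<subseteq> E"
    using RK L by (auto simp: list.indep_def mem_list_cl)
  define A where "A = generate G (g ` R)"
  define A' where "A' = generate G (g ` (R \<union> L))"
  define C where "C = generate G (g ` (R \<union> K))"
  define C' where "C' = generate G (g ` (R \<union> K \<union> L))"
  have sub: "subgroup A G" "subgroup A' G" "subgroup C G" "subgroup C' G"
    unfolding A_def A'_def C_def C'_def using RE KE LE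
    by (auto intro!: generate_is_subgroup image_closed)
  have RT: "R \<subseteq> list_cl R" using RE by (rule list.cl_extensive)
  \<comment> \<open>Since \<open>L\<close> lies in the closure of \<open>R\<close>, adding it
    changes no isolator: the four spans have only two isolators, \<open>sD\<close> with
    \<open>K\<close> and \<open>sT\<close> without.\<close>
  have "list_cl R \<subseteq> list_cl (R \<union> K)" using RE KE by (intro list.cl_mono) auto
  then have D: "isolator G (g ` (R \<union> K \<union> L)) = isolator G (g ` (R \<union> K))"
    using L RE KE LE list.cl_extensive[of "R \<union> K"] by (intro isolator_image_eq) auto
  have T: "isolator G (g ` (R \<union> L)) = isolator G (g ` R)"
    using L RE LE RT by (intro isolator_image_eq) auto
  define sD where "sD = isolator G (g ` (R \<union> K))"
  define sT where "sT = isolator G (g ` R)"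
  have subs: "subgroup sD G" "subgroup sT G"
    unfolding sD_def sT_def using RE KE by (auto intro!: subgroup_isolator image_closed)
  have incl: "A \<subseteq> A'" "C \<subseteq> C'" "A \<subseteq> C" "A' \<subseteq> C'"
    unfolding A_def A'_def C_def C'_def by (auto intro!: mono_generate)
  have A'T: "A' \<subseteq> sT"
    unfolding A'_def sT_def T[symmetric] using RE LE by (intro generate_subset_isolator image_closed) auto
  have C'D: "C' \<subseteq> sD"
    unfolding C'_def sD_def D[symmetric] using RE LE KE by (intro generate_subset_isolator image_closed) auto
  have satA: "isolator G A = sT" and satC: "isolator G C = sD"
    unfolding A_def C_def sT_def sD_def using RE KE
    by (auto intro!: isolator_generate image_closed)
  have "C \<inter> A' = A" using generate_Int_isolator[OF fin RK] A'T incl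
    unfolding A_def C_def sT_def by blast
  moreover have "C' = C <#> A'"
  proof
    have CA: "subgroup (C <#> A') G" by (rule mult_subgroups[OF sub(3,2)])
    have "x \<in> C <#> A'" if "x \<in> C" for x
      using that subgroup.one_closed[OF sub(2)] subgroup.mem_carrier[OF sub(3)]
      unfolding set_mult_def by force
    moreover have "x \<in> C <#> A'" if "x \<in> A'" for x
      using that subgroup.one_closed[OF sub(3)] subgroup.mem_carrier[OF sub(2)]
      unfolding set_mult_def by force
    moreover have "g ` (R \<union> K) \<subseteq> C" "g ` (R \<union> L) \<subseteq> A'"
      unfolding C_def A'_def by (auto intro: generate.incl)
    ultimately have "g ` (R \<union> K \<union> L) \<subseteq> C <#> A'" by blast
    then show "C' \<subseteq> C <#> A'" unfolding C'_def by (rule generate_subgroup_incl[OF _ CA])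
    show "C <#> A' \<subseteq> C'" using subgroup.m_closed[OF sub(4)] incl unfolding set_mult_def by blast
  qed
  \<comment> \<open>This common index is the factor by which adding \<open>L\<close> divides the
    multiplicity, both of \<open>R \<union> K\<close> and of \<open>R\<close>.\<close>
  ultimately have iso: "coset_index G C' C = coset_index G A' A"
    using coset_index_second_iso[OF sub(2,3,1)] by simp
  have "list_mult G g (R \<union> K) = coset_index G sD C"
    using RE KE by (simp add: list_mult_eq_index image_closed sD_def C_def)
  also have "\<dots> = coset_index G sD C' * coset_index G C' C"
    using finite_cosets_isolator[OF fg sub(3)] incl C'D
    by (intro coset_index_mult[OF sub(3,4) subs(1)]) (auto simp: satC)
  finally have 1: "list_mult G g (R \<union> K) = coset_index G sD C' * coset_index G C' C" .
  have "list_mult G g R = coset_index G sT A"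
    using RE by (simp add: list_mult_eq_index image_closed sT_def A_def)
  also have "\<dots> = coset_index G sT A' * coset_index G A' A"
    using finite_cosets_isolator[OF fg sub(1)] incl A'T
    by (intro coset_index_mult[OF sub(1,2) subs(2)]) (auto simp: satA)
  finally have 2: "list_mult G g R = coset_index G sT A' * coset_index G A' A" .
  have 3: "list_mult G g (R \<union> K \<union> L) = coset_index G sD C'"
    using RE KE LE D by (subst list_mult_eq_index) (auto simp: image_closed sD_def C'_def)
  have 4: "list_mult G g (R \<union> L) = coset_index G sT A'"
    using RE LE T by (subst list_mult_eq_index) (auto simp: image_closed sT_def A'_def)
  show ?thesis by (simp add: 1 2 3 4 iso)
qed

text \<open>Allows a multiplicity to be cancelled, and lets a set counted by one be recognised as
  finite.\<close>

lemma list_mult_pos: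
  assumes fg: "finitely_generated_group G" and A: "A \<subseteq> E"
  shows "list_mult G g A > 0"
proof -
  have C: "g ` A \<subseteq> carrier G" using A by (rule image_closed)
  have "finite ((\<lambda>x. generate G (g ` A) #> x) ` isolator G (g ` A))"
    using finite_cosets_isolator[OF fg generate_is_subgroup[OF C]] isolator_generate[OF C] by simp
  moreover have "isolator G (g ` A) \<noteq> {}"
    using subgroup.one_closed[OF subgroup_isolator[OF C]] by auto
  ultimately show ?thesis by (simp add: list_mult_eq_index[OF C] coset_index_def card_gt_0_iff)
qed

end

section \<open>Rank, torsion and isomorphisms\<close>

text \<open>A relation instead of a function: the finite independent set whose isolator is
  everything is part of the assertion, and no number is attached to a group without one.\<close>

definition has_rank :: "('a, 'm) monoid_scheme \<Rightarrow> nat \<Rightarrow> bool" where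
  "has_rank G d \<longleftrightarrow> (\<exists>V. Z_independent G V \<and> carrier G \<subseteq> isolator G V \<and> card V = d)"

context comm_group
begin

lemma has_rank_unique:
  assumes "has_rank G d" "has_rank G d'" shows "d = d'"
proof -
  have le: "card V \<le> card W"
    if "sat.indep V" "sat.indep W" "carrier G \<subseteq> isolator G W" for V W
    using that by (intro sat.steinitz) (auto simp: sat.indep_def)
  show ?thesis using assms le by (auto simp: has_rank_def Z_independent_iff_indep intro!: antisym)
qed

lemma has_rank_exists:
  assumes "finite S" "S \<subseteq> carrier G" "carrier G \<subseteq> isolator G S"
  obtains d where "has_rank G d"
proof -
  obtain V where V: "V \<subseteq> S" "sat.indep V" "S \<subseteq> isolator G V"
    using sat.basis_extend[OF assms(1,2) sat.indep_empty] by auto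
  have "isolator G S \<subseteq> isolator G V" using V assms by (intro isolator_least) auto
  then have "has_rank G (card V)"
    using V(2) assms(3) unfolding has_rank_def Z_independent_iff_indep by blast
  then show ?thesis by (rule that)
qed

lemma has_rank_fg:
  assumes "finitely_generated_group G"
  obtains d where "has_rank G d"
proof -
  obtain S where S: "finite S" "S \<subseteq> carrier G" "generate G S = carrier G"
    using assms by (auto simp: finitely_generated_group_def)
  then show ?thesis
    using has_rank_exists[OF S(1,2)] generate_subset_isolator[OF S(2)] that by auto
qed

end

text \<open>Common ground for the three maps along which ranks travel: isomorphisms, quotient maps
  and the first projection of a product.\<close>

locale comm_group_epi = dom: comm_group A + cod: comm_group Q
  for A :: "('a, 'm) monoid_scheme" and Q :: "('b, 'n) monoid_scheme" +
  fixes p :: "'a \<Rightarrow> 'b"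
  assumes hom_p: "p \<in> hom A Q" and surj_p: "p ` carrier A = carrier Q"
begin

sublocale group_hom A Q p by unfold_locales (rule hom_p)

lemma isolator_image:
  assumes S: "S \<subseteq> carrier A" and x: "x \<in> isolator A S"
  shows "p x \<in> isolator Q (p ` S)"
proof -
  obtain k :: nat where k: "k > 0" "x [^]\<^bsub>A\<^esub> k \<in> generate A S" and xA: "x \<in> carrier A"
    using x by (auto simp: isolator_def)
  have "p x [^]\<^bsub>Q\<^esub> k = p (x [^]\<^bsub>A\<^esub> k)" using xA by (simp add: hom_nat_pow)
  also have "\<dots> \<in> generate Q (p ` S)" using k generate_img[OF S] by auto
  finally show ?thesis using k xA by (auto simp: isolator_def)
qed

lemma has_rank_image:
  assumes "has_rank A d" obtains d' where "has_rank Q d'"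
proof -
  obtain V where V: "dom.sat.indep V" "carrier A \<subseteq> isolator A V"
    using assms by (auto simp: has_rank_def dom.Z_independent_iff_indep)
  then have fV: "finite (p ` V)" and VA: "V \<subseteq> carrier A" by (auto simp: dom.sat.indep_def)
  have "carrier Q \<subseteq> isolator Q (p ` V)"
    using isolator_image[OF VA] V by (auto simp flip: surj_p)
  then show ?thesis using cod.has_rank_exists[OF fV] VA that by (metis image_mono surj_p)
qed

text \<open>Additivity of rank. Preimages of a basis of \<open>Q\<close> are joined to
  \<open>J\<close>. A dependence of one of them on the rest would project to a dependence in
  \<open>Q\<close>, where \<open>J\<close> becomes trivial; and a suitable power of any
  \<open>x\<close> differs from a product of preimages by a kernel element, which \<open>J\<close>
  isolates.\<close>

lemma has_rank_lift:
  assumes J: "Z_independent A J" "J \<subseteq> kernel A Q p" and ker: "kernel A Q p \<subseteq> isolator A J"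
    and d: "has_rank Q d"
  shows "has_rank A (card J + d)"
proof -
  obtain V where V: "cod.sat.indep V" "carrier Q \<subseteq> isolator Q V" "card V = d"
    using d by (auto simp: has_rank_def cod.Z_independent_iff_indep)
  then have fV: "finite V" and VQ: "V \<subseteq> carrier Q" by (auto simp: cod.sat.indep_def)
  have iJ: "dom.sat.indep J" using J by (simp add: dom.Z_independent_iff_indep)
  then have fJ: "finite J" and JA: "J \<subseteq> carrier A" by (auto simp: dom.sat.indep_def)
  define s where "s = inv_into (carrier A) p"
  have s: "s v \<in> carrier A" "p (s v) = v" if "v \<in> V" for v
  proof -
    have "v \<in> p ` carrier A" using that VQ surj_p by auto
    then show "s v \<in> carrier A" "p (s v) = v" by (auto simp: s_def inv_into_into f_inv_into_f)
  qed
  \<comment> \<open>Cardinality is carried along with independence: a preimage outside the closure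
    is in particular a new element.\<close>
  have "dom.sat.indep (J \<union> s ` W) \<and> card (J \<union> s ` W) = card J + card W" if "W \<subseteq> V" for W
    using finite_subset[OF that fV] that
  proof (induction W rule: finite_induct)
    case empty
    then show ?case using iJ by simp
  next
    case (insert w W)
    then have w: "w \<in> V" and WV: "W \<subseteq> V"
      and IH: "dom.sat.indep (J \<union> s ` W)" "card (J \<union> s ` W) = card J + card W" by auto
    have JWA: "J \<union> s ` W \<subseteq> carrier A" using IH(1) by (simp add: dom.sat.indep_def)
    have "s w \<notin> isolator A (J \<union> s ` W)"
    proof
      assume "s w \<in> isolator A (J \<union> s ` W)"
      then have "w \<in> isolator Q (p ` (J \<union> s ` W))" using isolator_image[OF JWA] s[OF w] by metis
      moreover have WQ: "V - {w} \<subseteq> carrier Q" using VQ by auto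
      have "p ` (J \<union> s ` W) \<subseteq> isolator Q (V - {w})"
      proof -
        have "p x = \<one>\<^bsub>Q\<^esub>" if "x \<in> J" for x using J that by (auto simp: kernel_def)
        then have "p ` J \<subseteq> isolator Q (V - {w})"
          using subgroup.one_closed[OF cod.subgroup_isolator[OF WQ]] by auto
        moreover have "p ` s ` W \<subseteq> V - {w}" using s WV insert.hyps by auto
        ultimately show ?thesis using cod.sat.cl_extensive[OF WQ] by blast
      qed
      then have "isolator Q (p ` (J \<union> s ` W)) \<subseteq> isolator Q (V - {w})"
        using WQ by (rule cod.isolator_least)
      ultimately have "w \<in> isolator Q (V - {w})" by blast
      then show False using V w by (auto simp: cod.sat.indep_def)
    qed
    moreover have "s w \<notin> J \<union> s ` W" using calculation dom.sat.cl_extensive[OF JWA] by blast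
    ultimately show ?case
      using dom.sat.indep_insert[OF IH(1) s(1)[OF w]] IH(2) insert.hyps fJ by simp
  qed
  then have W: "dom.sat.indep (J \<union> s ` V)" "card (J \<union> s ` V) = card J + d" using V by auto
  then have JVA: "J \<union> s ` V \<subseteq> carrier A" by (simp add: dom.sat.indep_def)
  have "x \<in> isolator A (J \<union> s ` V)" if x: "x \<in> carrier A" for x
  proof -
    have "p x \<in> isolator Q V" using V x by auto
    then obtain k :: nat where k: "k > 0" "p x [^]\<^bsub>Q\<^esub> k \<in> generate Q V"
      by (auto simp: isolator_def)
    have "p ` s ` V = V" using s by (auto simp: image_image)
    then have "p (x [^]\<^bsub>A\<^esub> k) \<in> p ` generate A (s ` V)"
      using k x generate_img[of "s ` V"] s by (simp add: hom_nat_pow image_subset_iff)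
    then obtain y where y: "y \<in> generate A (s ` V)" "p (x [^]\<^bsub>A\<^esub> k) = p y" by auto
    have yA: "y \<in> carrier A" using y dom.generate_in_carrier[of "s ` V"] s by auto
    note T = dom.subgroup_isolator[OF JVA]
    have "x [^]\<^bsub>A\<^esub> k \<otimes>\<^bsub>A\<^esub> inv\<^bsub>A\<^esub> y \<in> kernel A Q p" using x yA y by (simp add: kernel_def)
    then have "x [^]\<^bsub>A\<^esub> k \<otimes>\<^bsub>A\<^esub> inv\<^bsub>A\<^esub> y \<in> isolator A (J \<union> s ` V)"
      using ker dom.isolator_mono[of J "J \<union> s ` V"] by auto
    moreover have "y \<in> isolator A (J \<union> s ` V)"
      using y dom.mono_generate[of "s ` V" "J \<union> s ` V"] dom.generate_subset_isolator[OF JVA] by auto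
    ultimately have "x [^]\<^bsub>A\<^esub> k \<otimes>\<^bsub>A\<^esub> inv\<^bsub>A\<^esub> y \<otimes>\<^bsub>A\<^esub> y \<in> isolator A (J \<union> s ` V)"
      by (rule subgroup.m_closed[OF T])
    then have "x [^]\<^bsub>A\<^esub> int k \<in> isolator A (J \<union> s ` V)"
      using x yA by (simp add: dom.m_assoc int_pow_int)
    then show ?thesis using dom.root_in_isolator[OF JVA x, of "int k"] k by simp
  qed
  then show ?thesis using W unfolding has_rank_def dom.Z_independent_iff_indep by blast
qed

end

lemma Z_independent_empty: "comm_group G \<Longrightarrow> Z_independent G {}"
  by (simp add: Z_independent_def)

lemma has_rank_iso:
  assumes "comm_group A" "comm_group Q" "A \<cong> Q" "has_rank Q d"
  shows "has_rank A d"
proof -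
  interpret A: comm_group A by fact
  interpret Q: comm_group Q by fact
  obtain p where p: "p \<in> iso A Q" using assms by (auto simp: is_iso_def)
  then interpret comm_group_epi A Q p by unfold_locales (auto simp: iso_def bij_betw_def)
  have "kernel A Q p = {\<one>\<^bsub>A\<^esub>}" using p iso_kernel_image[OF A.is_group Q.is_group] by blast
  then have "kernel A Q p \<subseteq> isolator A {}"
    using subgroup.one_closed[OF A.subgroup_isolator[of "{}"]] by simp
  then show ?thesis using has_rank_lift[OF Z_independent_empty[OF assms(1)] _ _ assms(4)] by simp
qed

lemma comm_group_DirProd:
  assumes "comm_group A" "comm_group B" shows "comm_group (A \<times>\<times> B)"
proof -
  interpret A: comm_group A by fact
  interpret B: comm_group B by fact
  show ?thesis by (rule group.group_comm_groupI[OF DirProd_group[OF A.is_group B.is_group]])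
      (auto simp: DirProd_def A.m_comm B.m_comm)
qed

lemma nat_pow_DirProd: "x [^]\<^bsub>A \<times>\<times> B\<^esub> (k::nat) = (fst x [^]\<^bsub>A\<^esub> k, snd x [^]\<^bsub>B\<^esub> k)"
  by (induction k) (auto simp: nat_pow_def DirProd_def split: prod.splits)

definition torsion :: "('a, 'm) monoid_scheme \<Rightarrow> bool" where
  "torsion G \<longleftrightarrow> (\<forall>x\<in>carrier G. \<exists>k::nat. k > 0 \<and> x [^]\<^bsub>G\<^esub> k = \<one>\<^bsub>G\<^esub>)"

lemma (in comm_group) mem_isolator_empty:
  "x \<in> isolator G {} \<longleftrightarrow> x \<in> carrier G \<and> (\<exists>k::nat. k > 0 \<and> x [^] k = \<one>)"
proof -
  have "generate G {} = {\<one>}"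
    by (rule generateI[symmetric]) (auto intro: triv_subgroup simp: subgroup.one_closed)
  then show ?thesis by (simp add: isolator_def)
qed

lemma (in comm_group) carrier_torsion_group: "carrier (torsion_group G) = isolator G {}"
  by (auto simp: torsion_group_def mem_isolator_empty)

lemma (in comm_group) torsion_group_eq: "torsion_group G = G\<lparr>carrier := isolator G {}\<rparr>"
  using carrier_torsion_group by (simp add: torsion_group_def)

lemma (in comm_group) comm_group_torsion_group: "comm_group (torsion_group G)"
  unfolding torsion_group_eq
  by (rule group.group_comm_groupI[OF subgroup_imp_group[OF subgroup_isolator]])
    (auto simp: mem_isolator_empty m_comm)

lemma (in comm_group) torsion_torsion_group: "torsion (torsion_group G)"
  unfolding torsion_def torsion_group_eq
  by (auto simp: mem_isolator_empty nat_pow_consistent[symmetric])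

lemma (in comm_group) comm_group_epi_Mod:
  assumes H: "subgroup H G"
  shows "comm_group_epi G (G Mod H) (\<lambda>a. H #> a)"
proof -
  interpret N: normal H G using H by (simp add: normal_iff_subgroup)
  interpret Q: comm_group "G Mod H" using H by (rule abelian_FactGroup)
  show ?thesis by unfold_locales (auto simp: N.r_coset_hom_Mod carrier_FactGroup)
qed

lemma (in comm_group) kernel_Mod:
  assumes "subgroup H G" shows "kernel G (G Mod H) (\<lambda>a. H #> a) = H"
  using coset_join1[OF _ _ assms] coset_join2[OF _ assms] subgroup.mem_carrier[OF assms]
  by (auto simp: kernel_def)

lemma comm_group_epi_fst:
  assumes "comm_group A" "comm_group B"
  shows "comm_group_epi (A \<times>\<times> B) A fst"
proof -
  interpret A: comm_group A by fact
  interpret B: comm_group B by fact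
  interpret AB: comm_group "A \<times>\<times> B" using assms by (rule comm_group_DirProd)
  show ?thesis by unfold_locales (auto simp: DirProd_def hom_def image_iff intro: B.one_closed)
qed

text \<open>The kernel of the first projection consists of elements of finite order, hence lies in
  the isolator of the empty set, and \<open>has_rank_lift\<close> applies with nothing to
  add.\<close>

lemma has_rank_DirProd_torsion:
  assumes "comm_group A" "comm_group B" "torsion B" "has_rank A d"
  shows "has_rank (A \<times>\<times> B) d"
proof -
  interpret AB: comm_group "A \<times>\<times> B" using assms by (intro comm_group_DirProd)
  interpret comm_group_epi "A \<times>\<times> B" A fst using assms by (intro comm_group_epi_fst)
  have "kernel (A \<times>\<times> B) A fst \<subseteq> isolator (A \<times>\<times> B) {}"
  proof
    fix x assume "x \<in> kernel (A \<times>\<times> B) A fst"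
    then have x: "x \<in> carrier (A \<times>\<times> B)" "fst x = \<one>\<^bsub>A\<^esub>" "snd x \<in> carrier B"
      by (auto simp: kernel_def)
    then obtain k :: nat where "k > 0" "snd x [^]\<^bsub>B\<^esub> k = \<one>\<^bsub>B\<^esub>"
      using assms(3) by (auto simp: torsion_def)
    then show "x \<in> isolator (A \<times>\<times> B) {}"
      using x by (auto simp: AB.mem_isolator_empty nat_pow_DirProd)
  qed
  then show ?thesis
    using has_rank_lift[OF Z_independent_empty[OF AB.comm_group_axioms] _ _ assms(4)] by simp
qed

lemma order_torsion_group_DirProd:
  assumes "comm_group A" "comm_group B" "torsion B"
  shows "order (torsion_group (A \<times>\<times> B)) = order (torsion_group A) * order B"
proof -
  interpret A: comm_group A by fact
  interpret B: comm_group B by fact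
  interpret AB: comm_group "A \<times>\<times> B" using assms by (intro comm_group_DirProd)
  have "isolator (A \<times>\<times> B) {} = isolator A {} \<times> carrier B"
  proof (intro equalityI subsetI)
    fix x assume "x \<in> isolator (A \<times>\<times> B) {}"
    then show "x \<in> isolator A {} \<times> carrier B"
      by (auto simp: AB.mem_isolator_empty A.mem_isolator_empty nat_pow_DirProd)
  next
    fix x assume "x \<in> isolator A {} \<times> carrier B"
    then obtain a b where x: "x = (a, b)" "a \<in> carrier A" "b \<in> carrier B" "a \<in> isolator A {}"
      by (auto simp: A.mem_isolator_empty)
    then obtain k l :: nat where kl: "k > 0" "a [^]\<^bsub>A\<^esub> k = \<one>\<^bsub>A\<^esub>" "l > 0" "b [^]\<^bsub>B\<^esub> l = \<one>\<^bsub>B\<^esub>"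
      using assms(3) by (auto simp: A.mem_isolator_empty torsion_def)
    have "a [^]\<^bsub>A\<^esub> (k * l) = \<one>\<^bsub>A\<^esub>" using x kl by (simp flip: A.nat_pow_pow)
    moreover have "b [^]\<^bsub>B\<^esub> (l * k) = \<one>\<^bsub>B\<^esub>" using x kl by (simp flip: B.nat_pow_pow)
    ultimately have "x [^]\<^bsub>A \<times>\<times> B\<^esub> (k * l) = \<one>\<^bsub>A \<times>\<times> B\<^esub>"
      using x by (simp add: nat_pow_DirProd mult.commute)
    moreover have "k * l > 0" using kl by simp
    moreover have "x \<in> carrier (A \<times>\<times> B)" using x by simp
    ultimately show "x \<in> isolator (A \<times>\<times> B) {}" unfolding AB.mem_isolator_empty by blast
  qed
  then show ?thesis
    by (simp add: order_def A.carrier_torsion_group AB.carrier_torsion_group card_cartesian_product)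
qed

lemma order_torsion_group_iso:
  assumes "comm_group A" "comm_group B" "A \<cong> B"
  shows "order (torsion_group A) = order (torsion_group B)"
proof -
  interpret A: comm_group A by fact
  interpret B: comm_group B by fact
  obtain p where p: "p \<in> iso A B" using assms by (auto simp: is_iso_def)
  then have hom: "p \<in> hom A B" and bij: "bij_betw p (carrier A) (carrier B)" by (auto simp: iso_def)
  interpret group_hom A B p by unfold_locales (rule hom)
  have eq: "p x [^]\<^bsub>B\<^esub> k = \<one>\<^bsub>B\<^esub> \<longleftrightarrow> x [^]\<^bsub>A\<^esub> k = \<one>\<^bsub>A\<^esub>" if "x \<in> carrier A" for x and k :: nat
  proof -
    have "p (x [^]\<^bsub>A\<^esub> k) = p \<one>\<^bsub>A\<^esub> \<longleftrightarrow> x [^]\<^bsub>A\<^esub> k = \<one>\<^bsub>A\<^esub>"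
      using bij that by (intro inj_on_eq_iff) (auto simp: bij_betw_def)
    then show ?thesis using that by (simp add: hom_nat_pow)
  qed
  have "p ` isolator A {} = isolator B {}"
  proof (intro equalityI subsetI)
    fix y assume "y \<in> isolator B {}"
    then have y: "y \<in> carrier B" "\<exists>k::nat. k > 0 \<and> y [^]\<^bsub>B\<^esub> k = \<one>\<^bsub>B\<^esub>"
      by (auto simp: B.mem_isolator_empty)
    then obtain x where "x \<in> carrier A" "y = p x" using bij by (auto simp: bij_betw_def)
    then show "y \<in> p ` isolator A {}" using y eq[of x] by (auto simp: A.mem_isolator_empty)
  qed (auto simp: A.mem_isolator_empty B.mem_isolator_empty eq)
  moreover have "inj_on p (isolator A {})"
    using bij A.isolator_subset_carrier by (auto simp: bij_betw_def intro: inj_on_subset)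
  ultimately show ?thesis using card_image[of p "isolator A {}"]
    by (simp add: order_def A.carrier_torsion_group B.carrier_torsion_group)
qed

context group_list
begin

lemma span_closed: "A \<subseteq> E \<Longrightarrow> subgroup (span_list G g A) G"
  unfolding span_list_def by (intro generate_is_subgroup image_closed)

text \<open>Additivity of rank for the quotient map, whose kernel is the span of \<open>A\<close>
  and is isolated by the image of \<open>J\<close>.\<close>

lemma has_rank_list_Mod:
  assumes A: "A \<subseteq> E" and J: "list.indep J" "J \<subseteq> A" "A \<subseteq> list_cl J"
    and d: "has_rank (G Mod span_list G g A) d"
  shows "has_rank G (card J + d)"
proof -
  have H: "subgroup (span_list G g A) G" using A by (rule span_closed)
  interpret comm_group_epi G "G Mod span_list G g A" "\<lambda>a. span_list G g A #> a"
    using H by (rule comm_group_epi_Mod)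
  have "g ` A \<subseteq> isolator G (g ` J)" using J by (auto simp: mem_list_cl)
  then have "span_list G g A \<subseteq> isolator G (g ` J)"
    unfolding span_list_def using A J by (intro generate_subset_isolatorI image_closed) auto
  moreover have "g ` J \<subseteq> span_list G g A"
    using J unfolding span_list_def by (auto intro: generate.incl)
  moreover have "Z_independent G (g ` J)" "card (g ` J) = card J"
    using indep_image[OF J(1)] by (auto simp: Z_independent_iff_indep card_image)
  ultimately show ?thesis using has_rank_lift[of "g ` J" d] d by (simp add: kernel_Mod[OF H])
qed

lemma comm_group_Mod: "A \<subseteq> E \<Longrightarrow> comm_group (G Mod span_list G g A)"
  by (intro abelian_FactGroup span_closed)

lemma comm_group_list_torsion:
  assumes "A \<subseteq> E"
  shows "comm_group (list_torsion G g A)" "torsion (list_torsion G g A)"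
  using comm_group.comm_group_torsion_group[OF comm_group_Mod[OF assms]]
    comm_group.torsion_torsion_group[OF comm_group_Mod[OF assms]] by (auto simp: list_torsion_def)

text \<open>The second summand is itself torsion, so it survives whole in the torsion of the direct
  sum and contributes the factor \<open>m(R)\<close>.\<close>

lemma list_mult_iso:
  assumes R: "R \<subseteq> E" "K \<subseteq> E" and Z: "group_list Z f I" and K: "K \<subseteq> I"
    and iso: "G Mod span_list G g (R \<union> K) \<cong> (Z Mod span_list Z f K) \<times>\<times> list_torsion G g R"
  shows "list_mult G g (R \<union> K) = list_mult Z f K * list_mult G g R"
proof -
  interpret Z: group_list Z f I by fact
  have "list_mult G g (R \<union> K) = order (torsion_group (G Mod span_list G g (R \<union> K)))"
    by (simp add: list_mult_def list_torsion_def)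
  also have "\<dots> = order (torsion_group ((Z Mod span_list Z f K) \<times>\<times> list_torsion G g R))"
    using R K by (intro order_torsion_group_iso[OF _ _ iso] comm_group_DirProd comm_group_Mod
        Z.comm_group_Mod comm_group_list_torsion) auto
  also have "\<dots> = order (torsion_group (Z Mod span_list Z f K)) * order (list_torsion G g R)"
    using R K by (intro order_torsion_group_DirProd Z.comm_group_Mod comm_group_list_torsion)
  finally show ?thesis by (simp add: list_mult_def list_torsion_def)
qed

text \<open>Let \<open>d'\<close> and \<open>d\<close> be the ranks of \<open>Z\<close> modulo
  nothing and modulo the span of \<open>f\<close> on \<open>I\<close>. The isomorphisms for
  \<open>K = {}\<close> and \<open>K = I\<close> give
  \<open>card R + d' = card R + card I + d\<close>, while a maximal independent \<open>J\<close> in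
  \<open>I\<close> gives \<open>d' = card J + d\<close>. So \<open>J\<close> has the size of
  \<open>I\<close> and equals it.\<close>

lemma indep_of_iso:
  assumes fg: "finitely_generated_group G" and Z: "group_list Z f I"
    and RI: "list.indep (R \<union> I)" "R \<inter> I = {}"
    and iso: "\<And>K. K \<subseteq> I \<Longrightarrow>
      G Mod span_list G g (R \<union> K) \<cong> (Z Mod span_list Z f K) \<times>\<times> list_torsion G g R"
  shows "pregeometry.indep I (group_list.list_cl Z f I) I"
proof -
  interpret Z: group_list Z f I by fact
  have RE: "R \<subseteq> E" and IE: "I \<subseteq> E" and fin: "finite R" "finite I"
    using RI by (auto simp: list.indep_def)
  let ?F = "list_torsion G g R"
  note F = comm_group_list_torsion[OF RE]
  \<comment> \<open>Existence of a rank is pushed from \<open>G\<close> to its quotient, across the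
    isomorphism and onto the first factor; the value found there is then carried back up to
    \<open>G\<close>.\<close>
  have step: "\<exists>d. has_rank (Z Mod span_list Z f K) d \<and> has_rank G (card (R \<union> K) + d)"
    if K: "K \<subseteq> I" for K
  proof -
    have RK: "R \<union> K \<subseteq> E" "list.indep (R \<union> K)"
      using K RE IE list.indep_subset[OF RI(1), of "R \<union> K"] by auto
    let ?Q = "G Mod span_list G g (R \<union> K)" and ?P = "Z Mod span_list Z f K"
    have cQ: "comm_group ?Q" and cP: "comm_group ?P" and cPF: "comm_group (?P \<times>\<times> ?F)"
      using RK K F by (auto intro!: comm_group_Mod Z.comm_group_Mod comm_group_DirProd)
    obtain d0 where "has_rank G d0" using has_rank_fg[OF fg] .
    then obtain d1 where "has_rank ?Q d1"
      using comm_group_epi.has_rank_image[OF comm_group_epi_Mod[OF span_closed[OF RK(1)]]] by blast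
    moreover have "(?P \<times>\<times> ?F) \<cong> ?Q" using group.iso_sym[OF comm_group.axioms(2)[OF cQ] iso[OF K]] .
    ultimately have "has_rank (?P \<times>\<times> ?F) d1" using has_rank_iso[OF cPF cQ] by blast
    then obtain d where d: "has_rank ?P d"
      using comm_group_epi.has_rank_image[OF comm_group_epi_fst[OF cP F(1)]] by blast
    then have "has_rank (?P \<times>\<times> ?F) d" using has_rank_DirProd_torsion[OF cP F] by blast
    then have "has_rank ?Q d" using has_rank_iso[OF cQ cPF iso[OF K]] by blast
    then have "has_rank G (card (R \<union> K) + d)"
      using has_rank_list_Mod[OF RK(1,2) order_refl list.cl_extensive[OF RK(1)]] by blast
    then show ?thesis using d by blast
  qed
  obtain J where J: "J \<subseteq> I" "Z.list.indep J" "I \<subseteq> Z.list_cl J"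
    using Z.list.basis_extend[OF fin(2) order_refl Z.list.indep_empty] by auto
  obtain d where d: "has_rank (Z Mod span_list Z f I) d" "has_rank G (card (R \<union> I) + d)"
    using step[of I] by auto
  obtain d' where d': "has_rank (Z Mod span_list Z f {}) d'" "has_rank G (card R + d')"
    using step[of "{}"] by auto
  have "has_rank Z (card J + d)" using Z.has_rank_list_Mod[OF order_refl J(2,1,3) d(1)] .
  moreover have "has_rank Z d'" using Z.has_rank_list_Mod[OF _ Z.list.indep_empty _ _ d'(1)] by simp
  ultimately have "d' = card J + d" using Z.has_rank_unique by blast
  moreover have "card R + d' = card (R \<union> I) + d" using has_rank_unique d d' by blast
  ultimately have "card J = card I" using card_Un_disjoint[OF fin RI(2)] by simp
  then have "J = I" using card_subset_eq[OF fin(2) J(1)] by simp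
  then show ?thesis using J by simp
qed

end

section \<open>Agreement of the two descriptions of activity\<close>

locale ordered_group_list = group_list G g E
  for G :: "('a, 'm) monoid_scheme" (structure) and g :: "'e::linorder \<Rightarrow> 'a" and E
begin

sublocale ordered_matroid E list_cl by unfold_locales (rule finite_E)

lemma bases_eq: "list_bases G g E = bases"
  by (simp add: list_bases_eq bases_def)

text \<open>The larger elements of a basis are independent, so adding \<open>e\<close> leaves their
  rank unchanged exactly when \<open>e\<close> is in their closure.\<close>

lemma ext_active_eq:
  assumes "B \<in> bases" shows "ext_active G g E B = external B"
proof -
  have B: "list.indep B" using assms by (simp add: bases_def)
  have "list_rk G g ({b \<in> B. b > e} \<union> {e}) = list_rk G g {b \<in> B. b > e} \<longleftrightarrow> e \<in> list_cl {b \<in> B. e < b}"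
    if e: "e \<in> E" for e
  proof -
    have J: "list.indep {b \<in> B. e < b}" by (rule list.indep_subset[OF B]) auto
    then have JE: "{b \<in> B. e < b} \<subseteq> E" and fJ: "finite {b \<in> B. e < b}"
      by (auto simp: list.indep_def)
    have rJ: "list_rk G g {b \<in> B. e < b} = card {b \<in> B. e < b}"
      using list_rk_eq_card[OF J order_refl JE list.cl_extensive[OF JE]] .
    show ?thesis
    proof (cases "e \<in> list_cl {b \<in> B. e < b}")
      case True
      then have "list_rk G g ({b \<in> B. b > e} \<union> {e}) = card {b \<in> B. e < b}"
        using list.cl_extensive[OF JE] JE e by (intro list_rk_eq_card[OF J]) auto
      then show ?thesis using True rJ by simp
    next
      case False
      then have "list.indep (insert e {b \<in> B. e < b})" using list.indep_insert[OF J e] by simp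
      then have "list_rk G g (insert e {b \<in> B. e < b}) = card (insert e {b \<in> B. e < b})"
        using JE e list.cl_extensive[of "insert e {b \<in> B. e < b}"] by (intro list_rk_eq_card) auto
      then show ?thesis using False rJ fJ by simp
    qed
  qed
  then show ?thesis by (auto simp: ext_active_def external_def)
qed

text \<open>For \<open>f\<close> outside the closure, exchange brings \<open>e\<close> into the
  closure of the new set, which therefore spans. For \<open>f\<close> inside it, a new basis would
  make \<open>B - {e}\<close> span \<open>e\<close>.\<close>

lemma bases_exchange_iff:
  assumes B: "B \<in> bases" and e: "e \<in> B" and f: "f \<in> E"
  shows "insert f (B - {e}) \<in> bases \<longleftrightarrow> f \<notin> list_cl (B - {e})"
proof
  have BE: "B \<subseteq> E" and iB: "list.indep B" and span: "E \<subseteq> list_cl B"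
    using B by (auto simp: bases_def list.indep_def)
  have sub: "B - {e} \<subseteq> E" and en: "e \<notin> list_cl (B - {e})" using iB e by (auto simp: list.indep_def)
  assume f': "f \<notin> list_cl (B - {e})"
  have "list.indep (insert f (B - {e}))"
    using f f' list.indep_subset[OF iB] by (intro list.indep_insert) auto
  moreover have "f \<in> list_cl (insert e (B - {e}))" using f span e by (auto simp: insert_absorb)
  then have "e \<in> list_cl (insert f (B - {e}))" using list.cl_exchange[OF sub f _ _ f'] e BE by auto
  then have "B \<subseteq> list_cl (insert f (B - {e}))"
    using list.cl_extensive[of "insert f (B - {e})"] sub f by auto
  then have "list_cl B \<subseteq> list_cl (insert f (B - {e}))" using sub f by (intro list.cl_least) auto
  ultimately show "insert f (B - {e}) \<in> bases" using span by (auto simp: bases_def)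
next
  have BE: "B \<subseteq> E" and iB: "list.indep B" using B by (auto simp: bases_def list.indep_def)
  assume B': "insert f (B - {e}) \<in> bases"
  show "f \<notin> list_cl (B - {e})"
  proof
    assume f': "f \<in> list_cl (B - {e})"
    have "insert f (B - {e}) \<subseteq> list_cl (B - {e})"
      using f' list.cl_extensive[of "B - {e}"] BE by auto
    then have "list_cl (insert f (B - {e})) \<subseteq> list_cl (B - {e})"
      using BE by (intro list.cl_least) auto
    then have "e \<in> list_cl (B - {e})" using B' e BE by (auto simp: bases_def)
    then show False using iB e by (auto simp: list.indep_def)
  qed
qed

lemma int_active_eq:
  assumes "B \<in> bases" shows "int_active G g E B = internal B"
  using bases_exchange_iff[OF assms] by (auto simp: int_active_def internal_def bases_eq)

end

section \<open>Lattice points\<close>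

lemma power_card_eq_sum:
  fixes y :: "'r::comm_ring_1"
  assumes "finite S"
  shows "y ^ card S = (\<Sum>L\<in>Pow S. (y - 1) ^ card L)"
proof -
  have "y ^ card S = (\<Prod>e\<in>S. (y - 1) + 1)" by simp
  also have "\<dots> = (\<Sum>L\<in>Pow S. (\<Prod>e\<in>L. y - 1) * (\<Prod>e\<in>S - L. 1))" by (rule prod_add[OF assms])
  finally show ?thesis by simp
qed

text \<open>Both inner sums of the theorem are instances: \<open>p\<close> is a lattice point and
  \<open>Q p e\<close> says that its coefficient at \<open>e\<close> vanishes, or \<open>p\<close>
  stands for a component and \<open>Q p e\<close> says that it lies in \<open>H_e\<close>. Each
  power is expanded in \<open>y - 1\<close> over subsets and the sums are swapped.\<close>

lemma sum_power_card_eq: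
  fixes y :: "'r::comm_ring_1"
  assumes "finite P" "finite X"
  shows "(\<Sum>p\<in>P. y ^ card {e \<in> X. Q p e}) =
         (\<Sum>L\<in>Pow X. of_nat (card {p \<in> P. \<forall>e\<in>L. Q p e}) * (y - 1) ^ card L)"
proof -
  have "y ^ card {e \<in> X. Q p e} = (\<Sum>L\<in>Pow X. if \<forall>e\<in>L. Q p e then (y - 1) ^ card L else 0)" for p
  proof -
    have "Pow {e \<in> X. Q p e} = {L \<in> Pow X. \<forall>e\<in>L. Q p e}" by auto
    then have "y ^ card {e \<in> X. Q p e} = (\<Sum>L\<in>{L \<in> Pow X. \<forall>e\<in>L. Q p e}. (y - 1) ^ card L)"
      using power_card_eq_sum[of "{e \<in> X. Q p e}" y] assms by simp
    also have "\<dots> = (\<Sum>L\<in>Pow X. if \<forall>e\<in>L. Q p e then (y - 1) ^ card L else 0)"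
      using assms by (intro sum.inter_filter) auto
    finally show ?thesis .
  qed
  then have "(\<Sum>p\<in>P. y ^ card {e \<in> X. Q p e}) =
      (\<Sum>p\<in>P. \<Sum>L\<in>Pow X. if \<forall>e\<in>L. Q p e then (y - 1) ^ card L else 0)" by simp
  also have "\<dots> = (\<Sum>L\<in>Pow X. \<Sum>p\<in>P. if \<forall>e\<in>L. Q p e then (y - 1) ^ card L else 0)" by (rule sum.swap)
  also have "\<dots> = (\<Sum>L\<in>Pow X. of_nat (card {p \<in> P. \<forall>e\<in>L. Q p e}) * (y - 1) ^ card L)"
    using assms by (simp flip: sum.inter_filter)
  finally show ?thesis .
qed

text \<open>Dirichlet's theorem approximates a real relation, normalised to \<open>u k0 = 1\<close>, by an integer
  vector whose combination of the \<open>F k\<close> is smaller than 1, hence zero.\<close>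

lemma real_indep_of_int_indep:
  fixes F :: "'k \<Rightarrow> nat \<Rightarrow> int" and t :: "'k \<Rightarrow> real"
  assumes fin: "finite I"
    and indep: "\<And>c :: 'k \<Rightarrow> int. (\<forall>i<n. (\<Sum>k\<in>I. c k * F k i) = 0) \<Longrightarrow> \<forall>k\<in>I. c k = 0"
    and t: "\<forall>i<n. (\<Sum>k\<in>I. t k * real_of_int (F k i)) = 0"
    and k0: "k0 \<in> I"
  shows "t k0 = 0"
proof (rule ccontr)
  assume t0: "t k0 \<noteq> 0"
  define u where "u k = t k / t k0" for k
  have u: "(\<Sum>k\<in>I. u k * real_of_int (F k i)) = 0" if "i < n" for i
  proof -
    have "(\<Sum>k\<in>I. u k * real_of_int (F k i)) = (\<Sum>k\<in>I. t k * real_of_int (F k i)) / t k0"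
      by (simp add: u_def sum_divide_distrib)
    then show ?thesis using t that by simp
  qed
  \<comment> \<open>In each coordinate \<open>i < n\<close> the absolute values of the
    \<open>F k i\<close> sum to at most \<open>M\<close>, so errors below \<open>1 / N\<close> in
    the coefficients add up to less than \<open>M / N\<close>, which is below 1.\<close>
  define M where "M = (\<Sum>i<n. \<Sum>k\<in>I. \<bar>real_of_int (F k i)\<bar>)"
  obtain N :: nat where N: "M + 1 < real N" using reals_Archimedean2 by blast
  have M0: "M \<ge> 0" unfolding M_def by (intro sum_nonneg) auto
  have N0: "N > 0" using N M0 by (cases N) auto
  obtain h where h: "bij_betw h {..<card I} I"
    using ex_bij_betw_nat_finite[OF fin] by (auto simp: atLeast0LessThan)
  obtain q p where q: "0 < q" and p: "\<And>j. j < card I \<Longrightarrow> \<bar>of_int q * u (h j) - of_int (p j)\<bar> < 1 / real N"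
    using Dirichlet_approx_simult[OF N0, of "card I" "\<lambda>j. u (h j)"] by metis
  \<comment> \<open>The simultaneous approximation is indexed by natural numbers; \<open>c\<close>
    is its integer vector transported to \<open>I\<close> along the enumeration
    \<open>h\<close>.\<close>
  define c where "c k = p (the_inv_into {..<card I} h k)" for k
  have c: "\<bar>of_int q * u k - of_int (c k)\<bar> < 1 / real N" if k: "k \<in> I" for k
  proof -
    obtain j where j: "j < card I" "k = h j" using h k by (auto simp: bij_betw_def)
    then have "c k = p j" using h by (auto simp: c_def bij_betw_def the_inv_into_f_f)
    then show ?thesis using p[OF j(1)] j by simp
  qed
  have "(\<Sum>k\<in>I. c k * F k i) = 0" if i: "i < n" for i
  proof -
    have "real_of_int (\<Sum>k\<in>I. c k * F k i) =
        (\<Sum>k\<in>I. of_int (c k) * of_int (F k i)) - of_int q * (\<Sum>k\<in>I. u k * of_int (F k i))"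
      using u[OF i] by simp
    also have "\<dots> = (\<Sum>k\<in>I. (of_int (c k) - of_int q * u k) * of_int (F k i))"
      by (simp add: sum_distrib_left sum_subtractf algebra_simps)
    finally have "\<bar>real_of_int (\<Sum>k\<in>I. c k * F k i)\<bar> \<le>
        (\<Sum>k\<in>I. \<bar>(of_int (c k) - of_int q * u k) * of_int (F k i)\<bar>)" by (simp only: sum_abs)
    also have "\<dots> \<le> (\<Sum>k\<in>I. 1 / real N * \<bar>of_int (F k i)\<bar>)" unfolding abs_mult using c
      by (intro sum_mono mult_right_mono) (auto simp: abs_minus_commute intro: less_imp_le)
    also have "\<dots> = (\<Sum>k\<in>I. \<bar>of_int (F k i)\<bar>) / real N" by (simp add: sum_divide_distrib)
    also have "\<dots> \<le> M / real N"
    proof (rule divide_right_mono)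
      show "(\<Sum>k\<in>I. \<bar>real_of_int (F k i)\<bar>) \<le> M" unfolding M_def using i
        by (intro member_le_sum[of i "{..<n}" "\<lambda>i. \<Sum>k\<in>I. \<bar>real_of_int (F k i)\<bar>"]) (auto intro: sum_nonneg)
    qed simp
    also have "\<dots> < 1" using N N0 by (simp add: divide_less_eq)
    finally show ?thesis by linarith
  qed
  then have "c k0 = 0" using indep[of c] k0 by blast
  moreover have "u k0 = 1" using t0 by (simp add: u_def)
  \<comment> \<open>With \<open>u k0 = 1\<close> and \<open>c k0 = 0\<close>, the approximation
    error at \<open>k0\<close> is the positive integer \<open>q\<close> itself.\<close>
  ultimately have "real_of_int q < 1 / real N" using c[OF k0] q by simp
  also have "\<dots> \<le> 1" using N0 by simp
  finally show False using q by simp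
qed

section \<open>The group of integer vectors in coordinates\<close>

lemma comm_group_free_Z: "comm_group (free_Z n)"
  unfolding free_Z_def by (rule group.group_comm_groupI[OF product_group]) (auto simp: add.commute)

lemma free_Z_simps:
  "carrier (free_Z n) = {..<n} \<rightarrow>\<^sub>E UNIV"
  "\<one>\<^bsub>free_Z n\<^esub> = (\<lambda>i\<in>{..<n}. 0)"
  "x \<otimes>\<^bsub>free_Z n\<^esub> y = (\<lambda>i\<in>{..<n}. x i + y i)" by (simp_all add: free_Z_def)

lemma inv_free_Z: "x \<in> carrier (free_Z n) \<Longrightarrow> inv\<^bsub>free_Z n\<^esub> x = (\<lambda>i\<in>{..<n}. - x i)"
  unfolding free_Z_def by (subst inv_product_group) auto

lemma nat_pow_free_Z:
  "x \<in> carrier (free_Z n) \<Longrightarrow> x [^]\<^bsub>free_Z n\<^esub> (k::nat) = (\<lambda>i\<in>{..<n}. int k * x i)"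
proof (induction k)
  case (Suc k)
  interpret comm_group "free_Z n" by (rule comm_group_free_Z)
  have "x [^]\<^bsub>free_Z n\<^esub> Suc k = (\<lambda>i\<in>{..<n}. int k * x i) \<otimes>\<^bsub>free_Z n\<^esub> x"
    by (simp only: nat_pow_Suc Suc.IH[OF Suc.prems])
  then show ?case unfolding free_Z_simps(3) by (auto simp: algebra_simps)
qed (simp add: free_Z_simps(2) comm_group_free_Z)

lemma int_pow_free_Z:
  assumes "x \<in> carrier (free_Z n)"
  shows "x [^]\<^bsub>free_Z n\<^esub> (k::int) = (\<lambda>i\<in>{..<n}. k * x i)"
proof -
  interpret comm_group "free_Z n" by (rule comm_group_free_Z)
  show ?thesis
  proof (cases "k < 0")
    case True
    then have "x [^]\<^bsub>free_Z n\<^esub> k = inv\<^bsub>free_Z n\<^esub> (x [^]\<^bsub>free_Z n\<^esub> nat (- k))"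
      by (subst int_pow_def2) simp
    also have "\<dots> = (\<lambda>i\<in>{..<n}. - (x [^]\<^bsub>free_Z n\<^esub> nat (- k)) i)"
      using assms by (intro inv_free_Z) simp
    also have "\<dots> = (\<lambda>i\<in>{..<n}. k * x i)"
      using True by (simp add: nat_pow_free_Z[OF assms] cong: restrict_cong)
    finally show ?thesis .
  next
    case False
    then have "x [^]\<^bsub>free_Z n\<^esub> k = x [^]\<^bsub>free_Z n\<^esub> nat k" by (subst int_pow_def2) simp
    also have "\<dots> = (\<lambda>i\<in>{..<n}. k * x i)" using False by (simp add: nat_pow_free_Z[OF assms])
    finally show ?thesis .
  qed
qed

lemma finprod_free_Z:
  assumes "finite A" "F \<in> A \<rightarrow> carrier (free_Z n)" "i < n"
  shows "(\<Otimes>\<^bsub>free_Z n\<^esub>e\<in>A. F e) i = (\<Sum>e\<in>A. F e i)" using assms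
proof (induction A rule: finite_induct)
  case empty
  interpret comm_group "free_Z n" by (rule comm_group_free_Z)
  show ?case using empty by (simp add: free_Z_simps)
next
  case (insert a A)
  interpret comm_group "free_Z n" by (rule comm_group_free_Z)
  have "(\<Otimes>\<^bsub>free_Z n\<^esub>e\<in>insert a A. F e) = F a \<otimes>\<^bsub>free_Z n\<^esub> (\<Otimes>\<^bsub>free_Z n\<^esub>e\<in>A. F e)"
    by (rule finprod_insert) (use insert.hyps insert.prems in auto)
  moreover have "(\<Otimes>\<^bsub>free_Z n\<^esub>e\<in>A. F e) i = (\<Sum>e\<in>A. F e i)"
    by (rule insert.IH) (use insert.prems in auto)
  ultimately show ?case using insert.hyps insert.prems(2) by (simp add: free_Z_simps(3))
qed

lemma free_Z_ext:
  assumes "x \<in> carrier (free_Z n)" "y \<in> carrier (free_Z n)" "\<And>i. i < n \<Longrightarrow> x i = y i"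
  shows "x = y" using assms by (auto simp: free_Z_simps intro: PiE_ext)

section \<open>Lattice points of the half-open box over an independent list\<close>

locale lattice_list = group_list "free_Z n" f I
  for n :: nat and f :: "'e \<Rightarrow> nat \<Rightarrow> int" and I :: "'e set" +
  assumes indep: "list.indep I"
begin

abbreviation "Z \<equiv> free_Z n"

lemma mem_generate_iff:
  assumes K: "K \<subseteq> I"
  shows "x \<in> generate Z (f ` K) \<longleftrightarrow>
    x \<in> carrier Z \<and> (\<exists>c. \<forall>i<n. x i = (\<Sum>e\<in>K. c e * f e i))"
proof -
  have fK: "finite K" using K finite_E finite_subset by blast
  have C: "f ` K \<subseteq> carrier Z" using K by (rule image_closed)
  then have fC: "f e \<in> carrier Z" if "e \<in> K" for e using that by auto
  have prod: "(\<Otimes>\<^bsub>Z\<^esub>e\<in>K. f e [^]\<^bsub>Z\<^esub> c e) i = (\<Sum>e\<in>K. c e * f e i)"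
    if "i < n" for c :: "'e \<Rightarrow> int" and i
  proof -
    have "(\<lambda>e. f e [^]\<^bsub>Z\<^esub> c e) \<in> K \<rightarrow> carrier Z" using fC by auto
    then show ?thesis using finprod_free_Z[OF fK _ that] that fC by (simp add: int_pow_free_Z)
  qed
  have prodC: "(\<Otimes>\<^bsub>Z\<^esub>e\<in>K. f e [^]\<^bsub>Z\<^esub> c e) \<in> carrier Z" for c :: "'e \<Rightarrow> int"
    using fC by (intro finprod_closed) auto
  have "x = (\<Otimes>\<^bsub>Z\<^esub>e\<in>K. f e [^]\<^bsub>Z\<^esub> c e) \<longleftrightarrow>
    x \<in> carrier Z \<and> (\<forall>i<n. x i = (\<Sum>e\<in>K. c e * f e i))" for c :: "'e \<Rightarrow> int"
  proof
    assume "x = (\<Otimes>\<^bsub>Z\<^esub>e\<in>K. f e [^]\<^bsub>Z\<^esub> c e)"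
    then show "x \<in> carrier Z \<and> (\<forall>i<n. x i = (\<Sum>e\<in>K. c e * f e i))"
      using prodC[of c] prod[of _ c] by blast
  next
    assume "x \<in> carrier Z \<and> (\<forall>i<n. x i = (\<Sum>e\<in>K. c e * f e i))"
    then show "x = (\<Otimes>\<^bsub>Z\<^esub>e\<in>K. f e [^]\<^bsub>Z\<^esub> c e)"
      using prod[of _ c] by (intro free_Z_ext[OF _ prodC[of c]]) simp_all
  qed
  then show ?thesis unfolding mem_generate_image_iff[OF fK C] by blast
qed

text \<open>Solving the relation for the term at \<open>e\<close> exhibits a nonzero power of
  \<open>f e\<close> in the span of the others.\<close>

lemma int_indep:
  assumes c: "\<forall>i<n. (\<Sum>e\<in>I. c e * f e i) = 0" and e: "e \<in> I"
  shows "c e = (0::int)"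
proof (rule ccontr)
  assume "c e \<noteq> 0"
  have C: "f e \<in> carrier Z" using e g_closed by auto
  have sub: "I - {e} \<subseteq> I" by auto
  have "c e * f e i = (\<Sum>e'\<in>I - {e}. (- c e') * f e' i)" if "i < n" for i
  proof -
    have "(\<Sum>e\<in>I. c e * f e i) = c e * f e i + (\<Sum>e'\<in>I - {e}. c e' * f e' i)"
      using finite_E e by (rule sum.remove)
    then show ?thesis using c that by (simp add: sum_negf)
  qed
  then have "\<forall>i<n. (f e [^]\<^bsub>Z\<^esub> c e) i = (\<Sum>e'\<in>I - {e}. (- c e') * f e' i)"
    using C by (simp add: int_pow_free_Z)
  then have "f e [^]\<^bsub>Z\<^esub> c e \<in> generate Z (f ` (I - {e}))" unfolding mem_generate_iff[OF sub] using C
    by (intro conjI exI[of _ "\<lambda>e. - c e"]) simp_all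
  then have "f e \<in> isolator Z (f ` (I - {e}))"
    using mem_isolator_int_iff[OF image_closed[OF sub]] C \<open>c e \<noteq> 0\<close> by blast
  then show False using indep e by (auto simp: list.indep_def mem_list_cl)
qed

lemma real_indep:
  assumes "\<forall>i<n. (\<Sum>e\<in>I. t e * real_of_int (f e i)) = 0" "e \<in> I"
  shows "t e = 0" using real_indep_of_int_indep[OF finite_E, of n f t e] int_indep assms by blast

text \<open>This gives the description \<open>THE t\<close> inside \<open>box_iota\<close> its
  meaning.\<close>

lemma box_coeffs_unique:
  assumes "box_coeffs n f I p t" "box_coeffs n f I p t'"
  shows "t = t'"
proof -
  have "t e - t' e = 0" if "e \<in> I" for e
  proof (rule real_indep[OF _ that])
    show "\<forall>i<n. (\<Sum>e\<in>I. (t e - t' e) * real_of_int (f e i)) = 0"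
      using assms by (simp add: box_coeffs_def left_diff_distrib sum_subtractf)
  qed
  then show ?thesis using assms by (auto simp: box_coeffs_def intro: PiE_ext)
qed

text \<open>The coefficients stay families on all of \<open>I\<close> and vanish off
  \<open>K\<close>, so the faces for all \<open>K\<close> are subsets of one box and share one
  coefficient function.\<close>

definition face_points :: "'e set \<Rightarrow> (nat \<Rightarrow> int) set" where
  "face_points K = {p \<in> carrier Z. \<exists>t. box_coeffs n f I p t \<and> (\<forall>e\<in>I - K. t e = 0)}"

lemma face_sum:
  assumes "box_coeffs n f I p t" "\<forall>e\<in>I - K. t e = 0" "K \<subseteq> I" "i < n"
  shows "real_of_int (p i) = (\<Sum>e\<in>K. t e * real_of_int (f e i))"
proof -
  have "(\<Sum>e\<in>K. t e * real_of_int (f e i)) = (\<Sum>e\<in>I. t e * real_of_int (f e i))"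
    by (rule sum.mono_neutral_left) (use assms(2,3) finite_E in auto)
  then show ?thesis using assms by (simp add: box_coeffs_def)
qed

text \<open>The point \<open>p\<close> is only known to be a real combination of \<open>f\<close> on
  \<open>K\<close>. Outside the isolator it would be integrally independent together with these
  vectors, hence independent over the reals, against that very combination.\<close>

lemma face_points_isolator:
  assumes K: "K \<subseteq> I" and p: "p \<in> face_points K"
  shows "p \<in> isolator Z (f ` K)"
proof (rule ccontr)
  assume not: "p \<notin> isolator Z (f ` K)"
  have fK: "finite K" using K finite_E finite_subset by blast
  obtain t where pC: "p \<in> carrier Z" and t: "box_coeffs n f I p t" "\<forall>e\<in>I - K. t e = 0"
    using p by (auto simp: face_points_def)
  \<comment> \<open>\<open>None\<close> indexes the additional vector \<open>p\<close>; the
    contradictory real relation gives it the coefficient -1 and the box coefficients to the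
    others.\<close>
  define F where "F = case_option p f"
  define J where "J = insert None (Some ` K)"
  have sum_J: "(\<Sum>k\<in>J. G k) = G None + (\<Sum>e\<in>K. G (Some e))" for G :: "'e option \<Rightarrow> 'r::comm_monoid_add"
    unfolding J_def using fK by (subst sum.insert) (auto simp: sum.reindex)
  have Z: "\<forall>k\<in>J. c k = 0" if c: "\<forall>i<n. (\<Sum>k\<in>J. c k * F k i) = 0" for c :: "'e option \<Rightarrow> int"
  proof -
    have eq: "c None * p i = (\<Sum>e\<in>K. (- c (Some e)) * f e i)" if "i < n" for i
      using c[rule_format, OF that] by (simp add: sum_J F_def sum_negf)
    have c0: "c None = 0"
    proof (rule ccontr)
      assume "c None \<noteq> 0"
      have "\<forall>i<n. (p [^]\<^bsub>Z\<^esub> c None) i = (\<Sum>e\<in>K. (- c (Some e)) * f e i)"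
        using pC eq by (simp add: int_pow_free_Z)
      then have "p [^]\<^bsub>Z\<^esub> c None \<in> generate Z (f ` K)"
        unfolding mem_generate_iff[OF K] using pC int_pow_closed
        by (intro conjI exI[of _ "\<lambda>e. - c (Some e)"]) auto
      then show False
        using not \<open>c None \<noteq> 0\<close> mem_isolator_int_iff[OF image_closed[OF K]] pC by blast
    qed
    define c' where "c' e = (if e \<in> K then c (Some e) else 0)" for e
    have "(\<Sum>e\<in>I. c' e * f e i) = 0" if "i < n" for i
    proof -
      have "(\<Sum>e\<in>I. c' e * f e i) = (\<Sum>e\<in>K. c (Some e) * f e i)"
        using K finite_E by (intro sum.mono_neutral_cong_right) (auto simp: c'_def)
      then show ?thesis using eq[OF that] c0 by (simp add: sum_negf)
    qed
    then have "c' e = 0" if "e \<in> I" for e using int_indep that by blast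
    then have "c (Some e) = 0" if "e \<in> K" for e using that K unfolding c'_def by (metis subsetD)
    then show ?thesis using c0 by (simp add: J_def)
  qed
  have R: "\<forall>i<n. (\<Sum>k\<in>J. case_option (-1) t k * real_of_int (F k i)) = 0"
    using face_sum[OF t K] by (simp add: sum_J F_def)
  have J: "finite J" "None \<in> J" using fK by (auto simp: J_def)
  have "(case_option (-1) t None :: real) = 0" by (rule real_indep_of_int_indep[OF J(1) Z R J(2)])
  then show False by simp
qed

lemma coset_eq_iff:
  assumes K: "K \<subseteq> I" and x: "x \<in> carrier Z" and y: "y \<in> carrier Z"
  shows "generate Z (f ` K) #>\<^bsub>Z\<^esub> x = generate Z (f ` K) #>\<^bsub>Z\<^esub> y \<longleftrightarrow>
    (\<exists>c. \<forall>i<n. x i - y i = (\<Sum>e\<in>K. c e * f e i))"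
proof -
  have "(x \<otimes>\<^bsub>Z\<^esub> inv\<^bsub>Z\<^esub> y) i = x i - y i" if "i < n" for i
    using that y by (simp add: free_Z_simps(3) inv_free_Z)
  then show ?thesis using rcos_eq_iff[OF generate_is_subgroup[OF image_closed[OF K]] x y] x y
    by (simp add: mem_generate_iff[OF K])
qed

text \<open>Each coset in the isolator contains exactly one point of the face. Two points in one
  coset have coefficients differing by integers of absolute value below 1; and every element of the
  isolator has rational coefficients, whose integer parts can be subtracted within the
  coset.\<close>

lemma card_face_points:
  assumes K: "K \<subseteq> I"
  shows "card (face_points K) = list_mult Z f K"
proof -
  let ?H = "generate Z (f ` K)"
  have fK: "finite K" using K finite_E finite_subset by blast
  have fC: "f ` K \<subseteq> carrier Z" using K by (rule image_closed)
  have "bij_betw (\<lambda>p. ?H #>\<^bsub>Z\<^esub> p) (face_points K)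
      ((\<lambda>p. ?H #>\<^bsub>Z\<^esub> p) ` isolator Z (f ` K))" unfolding bij_betw_def
  proof
    show "inj_on (\<lambda>p. ?H #>\<^bsub>Z\<^esub> p) (face_points K)"
    proof (rule inj_onI)
      fix p p' assume "p \<in> face_points K" "p' \<in> face_points K"
        and eq: "?H #>\<^bsub>Z\<^esub> p = ?H #>\<^bsub>Z\<^esub> p'"
      then obtain t t' where p: "p \<in> carrier Z" "box_coeffs n f I p t" "\<forall>e\<in>I - K. t e = 0"
        and p': "p' \<in> carrier Z" "box_coeffs n f I p' t'" "\<forall>e\<in>I - K. t' e = 0"
        by (auto simp: face_points_def)
      obtain c where c: "\<forall>i<n. p i - p' i = (\<Sum>e\<in>K. c e * f e i)"
        using eq coset_eq_iff[OF K p(1) p'(1)] by auto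
      \<comment> \<open>Extended by 0 from \<open>K\<close> to \<open>I\<close>, so that
        independence over the reals can be applied on all of \<open>I\<close>.\<close>
      define d where "d e = (if e \<in> K then real_of_int (c e) else 0)" for e
      have "(\<Sum>e\<in>I. (t e - t' e - d e) * real_of_int (f e i)) = 0" if i: "i < n" for i
      proof -
        have "(\<Sum>e\<in>I. d e * real_of_int (f e i)) = (\<Sum>e\<in>K. real_of_int (c e) * f e i)"
          using K finite_E by (intro sum.mono_neutral_cong_right) (auto simp: d_def)
        also have "\<dots> = real_of_int (p i - p' i)" using c i by simp
        also have "\<dots> = (\<Sum>e\<in>I. (t e - t' e) * real_of_int (f e i))"
          using p(2) p'(2) i by (simp add: box_coeffs_def left_diff_distrib sum_subtractf)
        finally show ?thesis by (simp add: left_diff_distrib sum_subtractf)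
      qed
      then have d: "t e - t' e = d e" if "e \<in> I" for e
        using real_indep[of "\<lambda>e. t e - t' e - d e" e] that by simp
      have "t e = t' e" if e: "e \<in> I" for e
      proof (cases "e \<in> K")
        case True
        have "t e \<in> {0..<1}" "t' e \<in> {0..<1}"
          using p(2) p'(2) e by (auto simp: box_coeffs_def PiE_iff)
        then have "\<bar>real_of_int (c e)\<bar> < 1" using d[OF e] True by (auto simp: d_def)
        then have "c e = 0" by linarith
        then show ?thesis using d[OF e] True by (simp add: d_def)
      qed (use p p' e in auto)
      then have "real_of_int (p i) = real_of_int (p' i)" if "i < n" for i
        using p(2) p'(2) that by (simp add: box_coeffs_def)
      then show "p = p'" using p(1) p'(1) by (intro free_Z_ext) auto
    qed
    show "(\<lambda>p. ?H #>\<^bsub>Z\<^esub> p) ` face_points K = (\<lambda>p. ?H #>\<^bsub>Z\<^esub> p) ` isolator Z (f ` K)"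
    proof (intro equalityI subsetI)
      fix X assume "X \<in> (\<lambda>p. ?H #>\<^bsub>Z\<^esub> p) ` face_points K"
      then show "X \<in> (\<lambda>p. ?H #>\<^bsub>Z\<^esub> p) ` isolator Z (f ` K)"
        using face_points_isolator[OF K] by blast
    next
      fix X assume "X \<in> (\<lambda>p. ?H #>\<^bsub>Z\<^esub> p) ` isolator Z (f ` K)"
      then obtain x where x: "x \<in> isolator Z (f ` K)" "X = ?H #>\<^bsub>Z\<^esub> x" by auto
      then have xC: "x \<in> carrier Z" using isolator_subset_carrier by blast
      obtain k :: int where k: "k \<noteq> 0" "x [^]\<^bsub>Z\<^esub> k \<in> ?H"
        using x mem_isolator_int_iff[OF fC] by blast
      then obtain c where c: "\<forall>i<n. k * x i = (\<Sum>e\<in>K. c e * f e i)"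
        using xC by (auto simp: mem_generate_iff[OF K] int_pow_free_Z)
      \<comment> \<open>Rational coefficients of \<open>x\<close>, read off from a nonzero multiple
        \<open>k\<close> of \<open>x\<close> that lies in the span.\<close>
      define s where "s e = real_of_int (c e) / of_int k" for e
      have xs: "real_of_int (x i) = (\<Sum>e\<in>K. s e * of_int (f e i))" if "i < n" for i
      proof -
        have "real_of_int k * real_of_int (x i) = (\<Sum>e\<in>K. of_int (c e) * of_int (f e i))"
          using c that by (metis (mono_tags, lifting) of_int_mult of_int_sum sum.cong)
        then have "real_of_int (x i) = (\<Sum>e\<in>K. of_int (c e) * of_int (f e i)) / of_int k"
          using k(1) by (simp add: field_simps)
        then show ?thesis by (simp add: s_def sum_divide_distrib)
      qed
      define p where "p = (\<lambda>i\<in>{..<n}. x i - (\<Sum>e\<in>K. \<lfloor>s e\<rfloor> * f e i))"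
      define t where "t = (\<lambda>e\<in>I. if e \<in> K then frac (s e) else 0)"
      have pC: "p \<in> carrier Z" by (simp add: p_def free_Z_simps)
      have "real_of_int (p i) = (\<Sum>e\<in>I. t e * real_of_int (f e i))" if i: "i < n" for i
      proof -
        have "(\<Sum>e\<in>I. t e * real_of_int (f e i)) = (\<Sum>e\<in>K. frac (s e) * real_of_int (f e i))"
          using K finite_E by (intro sum.mono_neutral_cong_right) (auto simp: t_def)
        also have "\<dots> = real_of_int (p i)"
          using i xs[OF i] by (simp add: p_def frac_def left_diff_distrib sum_subtractf)
        finally show ?thesis by simp
      qed
      then have "box_coeffs n f I p t" by (auto simp: box_coeffs_def t_def frac_lt_1)
      moreover have "\<forall>e\<in>I - K. t e = 0" by (simp add: t_def)
      ultimately have "p \<in> face_points K" using pC by (auto simp: face_points_def)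
      moreover have "\<forall>i<n. x i - p i = (\<Sum>e\<in>K. \<lfloor>s e\<rfloor> * f e i)" by (simp add: p_def)
      then have "X = ?H #>\<^bsub>Z\<^esub> p"
        unfolding x(2) coset_eq_iff[OF K xC pC] by (rule exI[of _ "\<lambda>e. \<lfloor>s e\<rfloor>"])
      ultimately show "X \<in> (\<lambda>p. ?H #>\<^bsub>Z\<^esub> p) ` face_points K" by blast
    qed
  qed
  then show ?thesis unfolding list_mult_eq_index[OF fC] coset_index_def by (rule bij_betw_same_card)
qed

text \<open>The points whose coefficients vanish on \<open>L\<close> form the face of the complement
  \<open>I - L\<close>, whence the exponent \<open>card I - card K\<close>. Positivity of the
  multiplicity of \<open>I\<close>, which counts the whole box, makes the box finite.\<close>

lemma sum_box_points:
  fixes x :: "'r::comm_ring_1"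
  assumes pos: "list_mult Z f I > 0"
  shows "(\<Sum>p\<in>box_points n f I. x ^ box_iota n f I p) =
    (\<Sum>K\<in>Pow I. of_nat (list_mult Z f K) * (x - 1) ^ (card I - card K))"
proof -
  define t where "t p = (THE t. box_coeffs n f I p t)" for p
  have t: "t p = u" if "box_coeffs n f I p u" for p u
    unfolding t_def using that box_coeffs_unique by blast
  have all: "box_points n f I = face_points I" by (auto simp: box_points_def face_points_def)
  then have fin: "finite (box_points n f I)"
    using pos card_face_points[OF order_refl] by (intro card_ge_0_finite) simp
  have "{p \<in> box_points n f I. \<forall>e\<in>L. t p e = 0} = face_points (I - L)" if "L \<subseteq> I" for L
    using that t by (fastforce simp: box_points_def face_points_def)
  then have card: "card {p \<in> box_points n f I. \<forall>e\<in>L. t p e = 0} = list_mult Z f (I - L)"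
    if "L \<subseteq> I" for L using that card_face_points[of "I - L"] by auto
  have "(\<Sum>p\<in>box_points n f I. x ^ box_iota n f I p) =
      (\<Sum>p\<in>box_points n f I. x ^ card {e \<in> I. t p e = 0})" by (simp add: box_iota_def t_def)
  also have "\<dots> = (\<Sum>L\<in>Pow I. of_nat (card {p \<in> box_points n f I. \<forall>e\<in>L. t p e = 0}) * (x - 1) ^ card L)"
    using fin finite_E by (rule sum_power_card_eq)
  also have "\<dots> = (\<Sum>L\<in>Pow I. of_nat (list_mult Z f (I - L)) * (x - 1) ^ card L)"
    using card by (intro sum.cong) auto
  also have "\<dots> = (\<Sum>K\<in>Pow I. of_nat (list_mult Z f K) * (x - 1) ^ (card I - card K))"
  proof (rule sum.reindex_bij_witness[where i = "\<lambda>K. I - K" and j = "\<lambda>L. I - L"])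
    fix L assume L: "L \<in> Pow I"
    then have "finite L" "card L \<le> card I" "L \<subseteq> I" using finite_E finite_subset card_mono by auto
    then have "card I - card (I - L) = card L" by (simp add: card_Diff_subset)
    then show "of_nat (list_mult Z f (I - L)) * (x - 1) ^ (card I - card (I - L)) =
        of_nat (list_mult Z f (I - L)) * (x - 1) ^ card L" by simp
  qed auto
  finally show ?thesis .
qed

end

section \<open>Characters\<close>

text \<open>The target stays general because the same extension argument serves the circle, for
  characters, and the additive reals, for their logarithms.\<close>

locale two_comm_groups = comm_group G + cod: comm_group D
  for G :: "('a, 'm) monoid_scheme" (structure) and D :: "('b, 'n) monoid_scheme"
begin

abbreviation hom_on :: "'a set \<Rightarrow> ('a \<Rightarrow> 'b) set" where
  "hom_on H \<equiv> hom (G\<lparr>carrier := H\<rparr>) D"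

lemma hom_on_iff:
  "\<phi> \<in> hom_on H \<longleftrightarrow> (\<forall>x\<in>H. \<phi> x \<in> carrier D) \<and> (\<forall>x\<in>H. \<forall>y\<in>H. \<phi> (x \<otimes> y) = \<phi> x \<otimes>\<^bsub>D\<^esub> \<phi> y)"
  by (auto simp: hom_def)

lemma hom_on_mult: "\<phi> \<in> hom_on H \<Longrightarrow> x \<in> H \<Longrightarrow> y \<in> H \<Longrightarrow> \<phi> (x \<otimes> y) = \<phi> x \<otimes>\<^bsub>D\<^esub> \<phi> y"
  by (simp add: hom_on_iff)

lemma hom_on_closed: "\<phi> \<in> hom_on H \<Longrightarrow> x \<in> H \<Longrightarrow> \<phi> x \<in> carrier D"
  by (simp add: hom_on_iff)

lemma hom_on_subset: "\<phi> \<in> hom_on H \<Longrightarrow> K \<subseteq> H \<Longrightarrow> \<phi> \<in> hom_on K"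
  unfolding hom_on_iff by blast

lemma hom_on_cong:
  assumes H: "subgroup H G" and eq: "\<And>x. x \<in> H \<Longrightarrow> \<phi> x = \<psi> x" and \<phi>: "\<phi> \<in> hom_on H"
  shows "\<psi> \<in> hom_on H"
proof -
  have "\<psi> (x \<otimes> y) = \<psi> x \<otimes>\<^bsub>D\<^esub> \<psi> y" if "x \<in> H" "y \<in> H" for x y
    using eq[OF subgroup.m_closed[OF H that]] eq[OF that(1)] eq[OF that(2)] hom_on_mult[OF \<phi> that] by simp
  moreover have "\<psi> x \<in> carrier D" if "x \<in> H" for x
    using hom_on_closed[OF \<phi> that] eq[OF that] by simp
  ultimately show ?thesis by (simp add: hom_on_iff)
qed

lemma hom_on_group_hom:
  assumes "subgroup H G" "\<phi> \<in> hom_on H" shows "group_hom (G\<lparr>carrier := H\<rparr>) D \<phi>"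
  using assms subgroup_imp_group by (simp add: group_hom_def group_hom_axioms_def)

lemma hom_on_one: "subgroup H G \<Longrightarrow> \<phi> \<in> hom_on H \<Longrightarrow> \<phi> \<one> = \<one>\<^bsub>D\<^esub>"
  using group_hom.hom_one[OF hom_on_group_hom] by simp

lemma hom_on_inv: "subgroup H G \<Longrightarrow> \<phi> \<in> hom_on H \<Longrightarrow> x \<in> H \<Longrightarrow> \<phi> (inv x) = inv\<^bsub>D\<^esub> \<phi> x"
  using group_hom.hom_inv[OF hom_on_group_hom, of H \<phi> x] by simp

lemma hom_on_int_pow:
  "subgroup H G \<Longrightarrow> \<phi> \<in> hom_on H \<Longrightarrow> x \<in> H \<Longrightarrow> \<phi> (x [^] (k::int)) = \<phi> x [^]\<^bsub>D\<^esub> k"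
  using group_hom.hom_int_pow[OF hom_on_group_hom, of H \<phi> x k] int_pow_consistent[of H x k] by simp

lemma hom_on_eqI:
  assumes H: "subgroup H G" and x: "x \<in> carrier G"
    and \<phi>: "\<phi> \<in> hom_on (generate G (insert x H))" and \<psi>: "\<psi> \<in> hom_on (generate G (insert x H))"
    and eq: "\<And>h. h \<in> H \<Longrightarrow> \<phi> h = \<psi> h" "\<phi> x = \<psi> x" and y: "y \<in> generate G (insert x H)"
  shows "\<phi> y = \<psi> y"
proof -
  let ?M = "generate G (insert x H)"
  have M: "subgroup ?M G" using subgroup.subset[OF H] x by (intro generate_is_subgroup) auto
  obtain h k where h: "y = h \<otimes> x [^] (k::int)" "h \<in> H"
    using y unfolding generate_insert_subgroup[OF H x] by blast
  have hM: "h \<in> ?M" and xM: "x \<in> ?M" using h by (auto intro: generate.incl)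
  have xk: "x [^] k \<in> ?M" using subgroup_int_pow_closed[OF M xM] .
  show ?thesis unfolding h(1) hom_on_mult[OF \<phi> hM xk] hom_on_mult[OF \<psi> hM xk]
      hom_on_int_pow[OF M \<phi> xM] hom_on_int_pow[OF M \<psi> xM] using eq h by simp
qed

text \<open>The extension sends \<open>h \<otimes> x [^] k\<close> to the image of \<open>h\<close>
  times the k-th power of \<open>z\<close>. Two such expressions of one element differ by a power of
  \<open>x\<close> lying in \<open>H\<close>, so \<open>compat\<close> is exactly the condition for
  this to be well defined.\<close>

lemma hom_on_adjoin:
  assumes H: "subgroup H G" and x: "x \<in> carrier G" and \<phi>: "\<phi> \<in> hom_on H"
    and z: "z \<in> carrier D" and compat: "\<And>k::int. x [^] k \<in> H \<Longrightarrow> \<phi> (x [^] k) = z [^]\<^bsub>D\<^esub> k"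
  obtains \<psi> where "\<psi> \<in> hom_on (generate G (insert x H))" "\<And>h. h \<in> H \<Longrightarrow> \<psi> h = \<phi> h" "\<psi> x = z"
proof -
  note HC = subgroup.mem_carrier[OF H] and DC = hom_on_closed[OF \<phi>]
  have wd: "\<phi> h \<otimes>\<^bsub>D\<^esub> z [^]\<^bsub>D\<^esub> k = \<phi> h' \<otimes>\<^bsub>D\<^esub> z [^]\<^bsub>D\<^esub> k'"
    if h: "h \<in> H" "h' \<in> H" and eq: "h \<otimes> x [^] k = h' \<otimes> x [^] k'" for h h' and k k' :: int
  proof -
    have "x [^] (k - k') = inv h \<otimes> h'"
    proof -
      have "x [^] k = inv h \<otimes> (h' \<otimes> x [^] k')"
        using eq h HC x by (metis inv_solve_left int_pow_closed m_closed)
      then have "x [^] k \<otimes> inv (x [^] k') = inv h \<otimes> h'" using h HC x by (simp add: m_assoc)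
      then show ?thesis by (simp add: int_pow_diff[OF x])
    qed
    moreover have ih: "inv h \<in> H" "inv h \<otimes> h' \<in> H"
      using h H by (auto simp: subgroup.m_closed subgroup.m_inv_closed)
    ultimately have "\<phi> (inv h \<otimes> h') = z [^]\<^bsub>D\<^esub> (k - k')" using compat by metis
    then have "inv\<^bsub>D\<^esub> \<phi> h \<otimes>\<^bsub>D\<^esub> \<phi> h' = z [^]\<^bsub>D\<^esub> k \<otimes>\<^bsub>D\<^esub> inv\<^bsub>D\<^esub> (z [^]\<^bsub>D\<^esub> k')"
      using hom_on_mult[OF \<phi> ih(1) h(2)] hom_on_inv[OF H \<phi> h(1)] cod.int_pow_diff[OF z] by simp
    then have "\<phi> h \<otimes>\<^bsub>D\<^esub> (inv\<^bsub>D\<^esub> \<phi> h \<otimes>\<^bsub>D\<^esub> \<phi> h') \<otimes>\<^bsub>D\<^esub> z [^]\<^bsub>D\<^esub> k' =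
        \<phi> h \<otimes>\<^bsub>D\<^esub> (z [^]\<^bsub>D\<^esub> k \<otimes>\<^bsub>D\<^esub> inv\<^bsub>D\<^esub> (z [^]\<^bsub>D\<^esub> k')) \<otimes>\<^bsub>D\<^esub> z [^]\<^bsub>D\<^esub> k'" by simp
    moreover have "\<phi> h \<otimes>\<^bsub>D\<^esub> (inv\<^bsub>D\<^esub> \<phi> h \<otimes>\<^bsub>D\<^esub> \<phi> h') = \<phi> h'" using DC h by (simp flip: cod.m_assoc)
    moreover have "\<phi> h \<otimes>\<^bsub>D\<^esub> (z [^]\<^bsub>D\<^esub> k \<otimes>\<^bsub>D\<^esub> inv\<^bsub>D\<^esub> (z [^]\<^bsub>D\<^esub> k')) \<otimes>\<^bsub>D\<^esub> z [^]\<^bsub>D\<^esub> k' = \<phi> h \<otimes>\<^bsub>D\<^esub> z [^]\<^bsub>D\<^esub> k"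
      using DC h z by (simp add: cod.m_assoc)
    ultimately show ?thesis by simp
  qed
  define \<psi> where "\<psi> y = (SOME w. \<exists>h\<in>H. \<exists>k::int. y = h \<otimes> x [^] k \<and> w = \<phi> h \<otimes>\<^bsub>D\<^esub> z [^]\<^bsub>D\<^esub> k)" for y
  have \<psi>: "\<psi> (h \<otimes> x [^] k) = \<phi> h \<otimes>\<^bsub>D\<^esub> z [^]\<^bsub>D\<^esub> k" if h: "h \<in> H" for h and k :: int unfolding \<psi>_def
  proof (rule some_equality)
    show "\<exists>h'\<in>H. \<exists>k'::int. h \<otimes> x [^] k = h' \<otimes> x [^] k' \<and>
        \<phi> h \<otimes>\<^bsub>D\<^esub> z [^]\<^bsub>D\<^esub> k = \<phi> h' \<otimes>\<^bsub>D\<^esub> z [^]\<^bsub>D\<^esub> k'" using h by blast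
    fix w assume "\<exists>h'\<in>H. \<exists>k'::int. h \<otimes> x [^] k = h' \<otimes> x [^] k' \<and> w = \<phi> h' \<otimes>\<^bsub>D\<^esub> z [^]\<^bsub>D\<^esub> k'"
    then show "w = \<phi> h \<otimes>\<^bsub>D\<^esub> z [^]\<^bsub>D\<^esub> k" using wd h by metis
  qed
  have "\<psi> (a \<otimes> b) = \<psi> a \<otimes>\<^bsub>D\<^esub> \<psi> b"
    if ab: "a \<in> generate G (insert x H)" "b \<in> generate G (insert x H)" for a b
  proof -
    obtain h k h' k' where a: "a = h \<otimes> x [^] (k::int)" "h \<in> H" and b: "b = h' \<otimes> x [^] (k'::int)" "h' \<in> H"
      using ab unfolding generate_insert_subgroup[OF H x] by blast
    have "a \<otimes> b = (h \<otimes> h') \<otimes> x [^] (k + k')" using a b HC x by (simp add: int_pow_mult m_ac)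
    then have "\<psi> (a \<otimes> b) = \<phi> (h \<otimes> h') \<otimes>\<^bsub>D\<^esub> z [^]\<^bsub>D\<^esub> (k + k')"
      using \<psi>[OF subgroup.m_closed[OF H a(2) b(2)]] by simp
    also have "\<dots> = (\<phi> h \<otimes>\<^bsub>D\<^esub> z [^]\<^bsub>D\<^esub> k) \<otimes>\<^bsub>D\<^esub> (\<phi> h' \<otimes>\<^bsub>D\<^esub> z [^]\<^bsub>D\<^esub> k')"
      using a b DC z by (simp add: hom_on_mult[OF \<phi>] cod.int_pow_mult cod.m_ac)
    finally show ?thesis using \<psi> a b by simp
  qed
  moreover have "\<psi> a \<in> carrier D" if a: "a \<in> generate G (insert x H)" for a
    using a \<psi> DC z unfolding generate_insert_subgroup[OF H x] by auto
  ultimately have "\<psi> \<in> hom_on (generate G (insert x H))" by (simp add: hom_on_iff)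
  moreover have "\<psi> h = \<phi> h" if "h \<in> H" for h using \<psi>[OF that, of 0] HC[OF that] DC[OF that] by simp
  moreover have "\<psi> x = z" using \<psi>[OF subgroup.one_closed[OF H], of 1] x z hom_on_one[OF H \<phi>] by simp
  ultimately show ?thesis using that by blast
qed

end

lemma (in comm_group) relative_order:
  assumes H: "subgroup H G" and x: "x \<in> isolator G H"
  obtains k :: nat where "k > 0" "\<And>j::int. x [^] j \<in> H \<longleftrightarrow> int k dvd j"
proof -
  have xC: "x \<in> carrier G" using x by (simp add: mem_isolator_iff)
  let ?P = "\<lambda>k::nat. k > 0 \<and> x [^] k \<in> H"
  define k where "k = (LEAST k. ?P k)"
  have "\<exists>k. ?P k" using x by (simp add: mem_isolator_iff generate_subgroup[OF H])
  then have k: "k > 0" "x [^] int k \<in> H" using LeastI_ex[of ?P] by (auto simp: k_def int_pow_int)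
  have mul: "x [^] (int k * q) \<in> H" for q
    using subgroup_int_pow_closed[OF H k(2), of q] xC by (simp add: int_pow_pow)
  have "int k dvd j" if j: "x [^] j \<in> H" for j
  proof (rule ccontr)
    assume nd: "\<not> int k dvd j"
    have "x [^] (j mod int k) = x [^] (j + int k * (- (j div int k)))"
      by (simp add: minus_div_mult_eq_mod[symmetric] algebra_simps)
    also have "\<dots> = x [^] j \<otimes> x [^] (int k * (- (j div int k)))" by (rule int_pow_mult[OF xC])
    also have "\<dots> \<in> H" using subgroup.m_closed[OF H j mul] .
    finally have "x [^] nat (j mod int k) \<in> H" using k by (simp add: pow_nat)
    moreover have pos: "j mod int k > 0"
    proof -
      have "j mod int k \<noteq> 0" "j mod int k \<ge> 0" using nd k by auto
      then show ?thesis by linarith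
    qed
    ultimately have "?P (nat (j mod int k))" by simp
    then have "(LEAST k. ?P k) \<le> nat (j mod int k)" by (rule Least_le)
    then have "k \<le> nat (j mod int k)" by (simp only: k_def[symmetric])
    moreover have "j mod int k < int k" using k by simp
    ultimately show False using pos by linarith
  qed
  then show ?thesis using that[of k] k mul by (auto elim: dvdE)
qed

section \<open>The circle, the additive reals, and extension of characters\<close>

lemma comm_group_circle: "comm_group circle_group"
proof (rule comm_groupI)
  fix x assume "x \<in> carrier circle_group"
  then have "norm x = 1" "x \<noteq> 0" by (auto simp: circle_group_def)
  then show "\<exists>y\<in>carrier circle_group. y \<otimes>\<^bsub>circle_group\<^esub> x = \<one>\<^bsub>circle_group\<^esub>"
    by (intro bexI[of _ "inverse x"]) (auto simp: circle_group_def norm_inverse)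
qed (auto simp: circle_group_def norm_mult)

lemma circle_simps:
  "carrier circle_group = sphere 0 1" "x \<otimes>\<^bsub>circle_group\<^esub> y = x * y" "\<one>\<^bsub>circle_group\<^esub> = 1"
  by (simp_all add: circle_group_def)

lemma nat_pow_circle: "x [^]\<^bsub>circle_group\<^esub> (k::nat) = x ^ k"
  by (induction k) (simp_all add: nat_pow_def circle_simps)

definition real_group :: "real monoid" where
  "real_group = \<lparr>carrier = UNIV, monoid.mult = (+), one = 0\<rparr>"

lemma comm_group_real: "comm_group real_group"
proof (rule comm_groupI)
  fix x :: real
  show "\<exists>y\<in>carrier real_group. y \<otimes>\<^bsub>real_group\<^esub> x = \<one>\<^bsub>real_group\<^esub>"
    by (intro bexI[of _ "- x"]) (auto simp: real_group_def)
qed (auto simp: real_group_def)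

lemma real_group_simps:
  "carrier real_group = UNIV" "x \<otimes>\<^bsub>real_group\<^esub> y = x + y" "\<one>\<^bsub>real_group\<^esub> = 0"
  by (simp_all add: real_group_def)

lemma int_pow_real_group: "x [^]\<^bsub>real_group\<^esub> (k::int) = of_int k * x"
proof -
  interpret comm_group real_group by (rule comm_group_real)
  have nat: "x [^]\<^bsub>real_group\<^esub> (k::nat) = of_nat k * x" for k
    by (induction k) (simp_all add: nat_pow_def real_group_simps algebra_simps)
  have inv: "inv\<^bsub>real_group\<^esub> y = - y" for y by (rule inv_equality) (simp_all add: real_group_simps)
  show ?thesis by (subst int_pow_def2) (simp add: nat inv)
qed

lemma circle_root:
  assumes "k > 0" "w \<in> carrier circle_group"
  obtains z where "z \<in> carrier circle_group" "z ^ k = w"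
proof -
  have w: "norm w = 1" using assms by (simp add: circle_simps)
  then have "card {z. z ^ k = w} = k" using assms by (intro card_nth_roots) auto
  then have "{z. z ^ k = w} \<noteq> {}" using assms(1) by (metis card.empty less_irrefl)
  then obtain z where z: "z ^ k = w" by blast
  then have "norm z ^ k = 1" using w norm_power[of z k] by simp
  then have "norm z = 1" using power_eq_imp_eq_base[of "norm z" k 1] assms(1) by simp
  then show ?thesis using z that by (auto simp: circle_simps)
qed

context comm_group
begin

interpretation circ: two_comm_groups G circle_group
  by (intro two_comm_groups.intro comm_group_axioms comm_group_circle)

interpretation re: two_comm_groups G real_group
  by (intro two_comm_groups.intro comm_group_axioms comm_group_real)

text \<open>The exponents leading into \<open>H\<close> are the multiples of \<open>k\<close>, so
  compatibility has to be checked at \<open>k\<close> only: \<open>z\<close> may be any k-th root of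
  the prescribed value.\<close>

lemma circle_hom_adjoin:
  assumes H: "subgroup H G" and x: "x \<in> carrier G" and \<phi>: "\<phi> \<in> circ.hom_on H"
    and k: "\<And>j::int. x [^] j \<in> H \<longleftrightarrow> int k dvd j"
    and z: "z \<in> carrier circle_group" "z ^ k = \<phi> (x [^] k)"
  obtains \<psi> where "\<psi> \<in> circ.hom_on (generate G (insert x H))" "\<And>h. h \<in> H \<Longrightarrow> \<psi> h = \<phi> h" "\<psi> x = z"
proof (rule circ.hom_on_adjoin[OF H x \<phi> z(1)])
  fix j :: int assume j: "x [^] j \<in> H"
  then obtain q where q: "j = int k * q" using k by (auto elim: dvdE)
  have xk: "x [^] int k \<in> H" using k by simp
  have "x [^] j = (x [^] int k) [^] q" using x by (simp add: q int_pow_pow)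
  then have "\<phi> (x [^] j) = \<phi> (x [^] int k) [^]\<^bsub>circle_group\<^esub> q"
    using circ.hom_on_int_pow[OF H \<phi> xk] by simp
  also have "\<phi> (x [^] int k) = z [^]\<^bsub>circle_group\<^esub> int k"
    using z by (simp add: int_pow_int nat_pow_circle)
  finally show "\<phi> (x [^] j) = z [^]\<^bsub>circle_group\<^esub> j"
    using circ.cod.int_pow_pow[OF z(1)] by (simp add: q)
qed (use that in blast)

text \<open>Divisibility of the circle. A generator of finite order over the subgroup reached so far
  receives a root of a prescribed value; any other generator may be sent anywhere.\<close>

lemma circle_hom_extend:
  assumes "finite S" "S \<subseteq> carrier G" "subgroup H G" "\<phi> \<in> circ.hom_on H"
  shows "\<exists>\<psi>. \<psi> \<in> circ.hom_on (generate G (H \<union> S)) \<and> (\<forall>h\<in>H. \<psi> h = \<phi> h)" using assms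
proof (induction S rule: finite_induct)
  case empty
  then show ?case by (auto simp: generate_subgroup)
next
  case (insert x S)
  then obtain \<phi>' where \<phi>': "\<phi>' \<in> circ.hom_on (generate G (H \<union> S))" "\<forall>h\<in>H. \<phi>' h = \<phi> h" by auto
  let ?M = "generate G (H \<union> S)"
  have C: "H \<union> S \<subseteq> carrier G" "x \<in> carrier G" using insert.prems subgroup.subset by auto
  have M: "subgroup ?M G" using C by (intro generate_is_subgroup)
  have HM: "H \<subseteq> ?M" by (auto intro: generate.incl)
  have eq: "generate G (insert x ?M) = generate G (H \<union> insert x S)"
    using generate_insert_generate[OF C] by simp
  have "\<exists>\<psi>. \<psi> \<in> circ.hom_on (generate G (insert x ?M)) \<and> (\<forall>h\<in>?M. \<psi> h = \<phi>' h)"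
  proof (cases "x \<in> isolator G ?M")
    case True
    then obtain k :: nat where k: "k > 0" "\<And>j::int. x [^] j \<in> ?M \<longleftrightarrow> int k dvd j"
      using relative_order[OF M] by blast
    have "x [^] int k \<in> ?M" using k by simp
    then have "\<phi>' (x [^] k) \<in> carrier circle_group"
      using circ.hom_on_closed[OF \<phi>'(1)] by (simp add: int_pow_int)
    then obtain z where z: "z \<in> carrier circle_group" "z ^ k = \<phi>' (x [^] k)"
      using circle_root[OF k(1)] by blast
    show ?thesis using circle_hom_adjoin[OF M C(2) \<phi>'(1) k(2) z] by metis
  next
    case False
    \<comment> \<open>Only the trivial power of \<open>x\<close> lies in \<open>?M\<close>, so every
      value is compatible; 1 is chosen.\<close>
    have z: "\<phi>' (x [^] j) = \<one>\<^bsub>circle_group\<^esub> [^]\<^bsub>circle_group\<^esub> j" if j: "x [^] (j::int) \<in> ?M" for j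
    proof -
      have "j = 0"
        using False j C mem_isolator_int_iff[OF subgroup.subset[OF M]] generate_subgroup[OF M] by blast
      then show ?thesis using circ.hom_on_one[OF M \<phi>'(1)] by simp
    qed
    show ?thesis using circ.hom_on_adjoin[OF M C(2) \<phi>'(1) circ.cod.one_closed z] by metis
  qed
  then show ?case using \<phi>'(2) HM unfolding eq by (metis subsetD)
qed

section \<open>Counting the extensions of a character\<close>

lemma coset_index_adjoin:
  assumes H: "subgroup H G" and x: "x \<in> carrier G"
    and k: "k > 0" "\<And>j::int. x [^] j \<in> H \<longleftrightarrow> int k dvd j"
  shows "coset_index G (generate G (insert x H)) H = k"
proof -
  note HC = subgroup.mem_carrier[OF H]
  have eq: "H #> (h \<otimes> x [^] j) = H #> (x [^] (j mod int k))" if h: "h \<in> H" for h and j :: int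
  proof -
    have "(h \<otimes> x [^] j) \<otimes> inv (x [^] (j mod int k)) = h \<otimes> x [^] (j - j mod int k)"
      using HC[OF h] x by (simp add: m_assoc int_pow_diff)
    also have "\<dots> \<in> H"
      using subgroup.m_closed[OF H h] k(2)[of "j - j mod int k"] by (simp add: minus_mod_eq_mult_div)
    finally show ?thesis using rcos_eq_iff[OF H] HC[OF h] x by simp
  qed
  have "(\<lambda>y. H #> y) ` generate G (insert x H) = (\<lambda>j. H #> x [^] int j) ` {..<k}"
  proof (intro equalityI subsetI)
    fix X assume "X \<in> (\<lambda>y. H #> y) ` generate G (insert x H)"
    then obtain h j where "X = H #> (h \<otimes> x [^] (j::int))" "h \<in> H"
      unfolding generate_insert_subgroup[OF H x] by blast
    then have "X = H #> (x [^] int (nat (j mod int k)))" using eq[of h j] k by simp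
    moreover have "nat (j mod int k) \<in> {..<k}" using k by (simp add: nat_less_iff)
    ultimately show "X \<in> (\<lambda>j. H #> x [^] int j) ` {..<k}" by blast
  next
    fix X assume "X \<in> (\<lambda>j. H #> x [^] int j) ` {..<k}"
    then obtain j where j: "X = H #> x [^] int j" by blast
    have "x [^] int j = \<one> \<otimes> x [^] int j" using x by simp
    then have "x [^] int j \<in> generate G (insert x H)"
      using subgroup.one_closed[OF H] unfolding generate_insert_subgroup[OF H x] by blast
    then show "X \<in> (\<lambda>y. H #> y) ` generate G (insert x H)" using j by blast
  qed
  moreover have "inj_on (\<lambda>j. H #> x [^] int j) {..<k}"
  proof (rule inj_onI)
    fix i j assume ij: "i \<in> {..<k}" "j \<in> {..<k}" "H #> x [^] int i = H #> x [^] int j"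
    then have "x [^] int i \<otimes> inv (x [^] int j) \<in> H" using rcos_eq_iff[OF H] x by simp
    then have "int k dvd int i - int j" using k(2)[of "int i - int j"] x by (simp add: int_pow_diff)
    moreover have "\<bar>int i - int j\<bar> < int k" using ij by auto
    ultimately have "int i - int j = 0" using zdvd_not_zless[of "\<bar>int i - int j\<bar>" "int k"] by auto
    then show "i = j" by simp
  qed
  ultimately show ?thesis by (simp add: coset_index_def card_image)
qed

text \<open>Extensionality on \<open>K\<close> makes these functions determined by their values on
  \<open>K\<close>, so that they can be counted.\<close>

definition extensions :: "'a set \<Rightarrow> 'a set \<Rightarrow> ('a \<Rightarrow> complex) \<Rightarrow> ('a \<Rightarrow> complex) set" where
  "extensions K H \<phi> = {\<psi> \<in> circ.hom_on K \<inter> extensional K. \<forall>h\<in>H. \<psi> h = \<phi> h}"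

text \<open>An extension is determined by its value at \<open>x\<close>, which must be a k-th root
  of a number of norm 1; each such root lies on the circle and occurs.\<close>

lemma bij_betw_extensions_adjoin:
  assumes H: "subgroup H G" and x: "x \<in> carrier G" and \<phi>: "\<phi> \<in> circ.hom_on H"
    and k: "k > 0" "\<And>j::int. x [^] j \<in> H \<longleftrightarrow> int k dvd j"
  shows "bij_betw (\<lambda>\<psi>. \<psi> x) (extensions (generate G (insert x H)) H \<phi>) {z. z ^ k = \<phi> (x [^] k)}"
proof -
  let ?M = "generate G (insert x H)"
  have M: "subgroup ?M G" using subgroup.subset[OF H] x by (intro generate_is_subgroup) auto
  have xM: "x \<in> ?M" and HM: "H \<subseteq> ?M" by (auto intro: generate.incl)
  have xk: "x [^] k \<in> H" using k(2)[of "int k"] by (simp add: int_pow_int)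
  have nk: "norm (\<phi> (x [^] k)) = 1" using circ.hom_on_closed[OF \<phi> xk] by (simp add: circle_simps)
  show ?thesis unfolding bij_betw_def
  proof
    show "inj_on (\<lambda>\<psi>. \<psi> x) (extensions ?M H \<phi>)"
    proof (rule inj_onI)
      fix \<psi> \<psi>' assume "\<psi> \<in> extensions ?M H \<phi>" "\<psi>' \<in> extensions ?M H \<phi>" and eq: "\<psi> x = \<psi>' x"
      then have \<psi>: "\<psi> \<in> circ.hom_on ?M" "\<psi> \<in> extensional ?M" "\<forall>h\<in>H. \<psi> h = \<phi> h"
        and \<psi>': "\<psi>' \<in> circ.hom_on ?M" "\<psi>' \<in> extensional ?M" "\<forall>h\<in>H. \<psi>' h = \<phi> h"
        by (auto simp: extensions_def)
      have "\<psi> y = \<psi>' y" if "y \<in> ?M" for y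
        using circ.hom_on_eqI[OF H x \<psi>(1) \<psi>'(1) _ eq that] \<psi>(3) \<psi>'(3) by simp
      then show "\<psi> = \<psi>'" by (rule extensionalityI[OF \<psi>(2) \<psi>'(2)])
    qed
    show "(\<lambda>\<psi>. \<psi> x) ` extensions ?M H \<phi> = {z. z ^ k = \<phi> (x [^] k)}"
    proof (intro equalityI subsetI)
      fix z assume "z \<in> (\<lambda>\<psi>. \<psi> x) ` extensions ?M H \<phi>"
      then obtain \<psi> where \<psi>: "\<psi> \<in> circ.hom_on ?M" "\<forall>h\<in>H. \<psi> h = \<phi> h" "z = \<psi> x"
        by (auto simp: extensions_def)
      have "\<psi> (x [^] int k) = \<psi> x [^]\<^bsub>circle_group\<^esub> int k"
        by (rule circ.hom_on_int_pow[OF M \<psi>(1) xM])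
      then show "z \<in> {z. z ^ k = \<phi> (x [^] k)}" using \<psi> xk by (simp add: int_pow_int nat_pow_circle)
    next
      fix z assume z: "z \<in> {z. z ^ k = \<phi> (x [^] k)}"
      then have "norm z ^ k = 1" using nk norm_power[of z k] by simp
      then have "norm z = 1" using power_eq_imp_eq_base[of "norm z" k 1] k(1) by simp
      then have zC: "z \<in> carrier circle_group" by (simp add: circle_simps)
      obtain \<psi> where \<psi>: "\<psi> \<in> circ.hom_on ?M" "\<And>h. h \<in> H \<Longrightarrow> \<psi> h = \<phi> h" "\<psi> x = z"
        using circle_hom_adjoin[OF H x \<phi> k(2) zC] z by blast
      have "restrict \<psi> ?M \<in> circ.hom_on ?M" by (rule circ.hom_on_cong[OF M _ \<psi>(1)]) simp
      then have "restrict \<psi> ?M \<in> extensions ?M H \<phi>"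
        using \<psi> HM by (auto simp: extensions_def)
      moreover have "restrict \<psi> ?M x = z" using \<psi> xM by simp
      ultimately show "z \<in> (\<lambda>\<psi>. \<psi> x) ` extensions ?M H \<phi>" by blast
    qed
  qed
qed

text \<open>Induction on the index. Adjoining some \<open>x\<close> of order \<open>k\<close> modulo
  \<open>H\<close> gives \<open>k\<close> extensions to the intermediate group, one per k-th root;
  each extends further in as many ways as the remaining index says, and restriction separates these
  families.\<close>

theorem card_extensions:
  assumes "subgroup H G" "subgroup K G" "H \<subseteq> K" "K \<subseteq> isolator G H" "finite ((\<lambda>x. H #> x) ` K)"
    "\<phi> \<in> circ.hom_on H"
  shows "finite (extensions K H \<phi>) \<and> card (extensions K H \<phi>) = coset_index G K H"
  using assms
proof (induction "coset_index G K H" arbitrary: H \<phi> rule: less_induct)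
  case less
  note H = less.prems(1) and K = less.prems(2) and \<phi> = less.prems(6)
  note KC = subgroup.mem_carrier[OF K]
  show ?case
  proof (cases "H = K")
    case True
    have "\<psi> = restrict \<phi> K" if "\<psi> \<in> extensions K H \<phi>" for \<psi>
      using that True by (intro extensionalityI[of _ K]) (auto simp: extensions_def)
    moreover have "restrict \<phi> K \<in> extensions K H \<phi>"
      using circ.hom_on_cong[OF H _ \<phi>, of "restrict \<phi> K"] True by (auto simp: extensions_def)
    ultimately have "extensions K H \<phi> = {restrict \<phi> K}" by blast
    moreover have "(\<lambda>x. H #> x) ` K = {H}"
      using coset_join2[OF _ H] KC True subgroup.one_closed[OF K] by auto
    ultimately show ?thesis by (simp add: coset_index_def)
  next
    case False
    then obtain x where x: "x \<in> K" "x \<notin> H" using less.prems(3) by blast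
    have xC: "x \<in> carrier G" using KC x by simp
    obtain k :: nat where k: "k > 0" "\<And>j::int. x [^] j \<in> H \<longleftrightarrow> int k dvd j"
      using relative_order[OF H] x less.prems(4) by blast
    \<comment> \<open>Exponent 1 does not lead into \<open>H\<close>, so the index strictly drops
      when \<open>x\<close> is adjoined.\<close>
    have k1: "k > 1"
    proof (rule ccontr)
      assume "\<not> k > 1"
      then have "k = 1" using k by simp
      then show False using k(2)[of 1] x xC by simp
    qed
    let ?M = "generate G (insert x H)"
    have M: "subgroup ?M G" using subgroup.subset[OF H] xC by (intro generate_is_subgroup) auto
    have HM: "H \<subseteq> ?M" by (auto intro: generate.incl)
    have MK: "?M \<subseteq> K" using x less.prems(3) by (intro generate_subgroup_incl[OF _ K]) auto
    have mult: "coset_index G K H = coset_index G K ?M * k"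
      using coset_index_mult[OF H M K HM MK less.prems(5)] coset_index_adjoin[OF H xC k] by simp
    have fin: "finite ((\<lambda>x. ?M #> x) ` K)"
    proof (rule finite_surj[OF less.prems(5), of _ "\<lambda>X. ?M <#> X"], rule subsetI)
      fix Y assume "Y \<in> (\<lambda>x. ?M #> x) ` K"
      then obtain y where y: "y \<in> K" "Y = ?M #> y" by blast
      have "?M <#> (H #> y) = (?M <#> H) #> y"
        using setmult_rcos_assoc[of ?M H y] subgroup.subset[OF M] subgroup.subset[OF H] KC y by simp
      also have "?M <#> H = ?M"
      proof
        show "?M <#> H \<subseteq> ?M" using HM subgroup.m_closed[OF M] unfolding set_mult_def by blast
        show "?M \<subseteq> ?M <#> H"
        proof
          fix m assume m: "m \<in> ?M"
          then have "m = m \<otimes> \<one>" using subgroup.mem_carrier[OF M] by simp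
          then show "m \<in> ?M <#> H" using m subgroup.one_closed[OF H] unfolding set_mult_def by blast
        qed
      qed
      finally show "Y \<in> (\<lambda>X. ?M <#> X) ` (\<lambda>x. H #> x) ` K" using y by blast
    qed
    have "(\<lambda>x. ?M #> x) ` K \<noteq> {}" using x by blast
    then have "coset_index G K ?M > 0" using fin by (simp add: coset_index_def card_gt_0_iff)
    then have lt: "coset_index G K ?M < coset_index G K H" using mult k1 by simp
    have sat: "K \<subseteq> isolator G ?M" using less.prems(4) isolator_mono[OF HM] by blast
    have IH: "finite (extensions K ?M \<psi>) \<and> card (extensions K ?M \<psi>) = coset_index G K ?M"
      if "\<psi> \<in> extensions ?M H \<phi>" for \<psi>
      using that by (intro less.hyps[OF lt M K MK sat fin]) (auto simp: extensions_def)
    have Y: "finite (extensions ?M H \<phi>) \<and> card (extensions ?M H \<phi>) = k"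
    proof -
      have xk: "x [^] k \<in> H" using k(2)[of "int k"] by (simp add: int_pow_int)
      have "\<phi> (x [^] k) \<noteq> 0" using circ.hom_on_closed[OF \<phi> xk] by (auto simp: circle_simps)
      then have "card {z. z ^ k = \<phi> (x [^] k)} = k" using k by (intro card_nth_roots)
      moreover from this have "finite {z. z ^ k = \<phi> (x [^] k)}" using k by (intro card_ge_0_finite) simp
      ultimately show ?thesis
        using bij_betw_extensions_adjoin[OF H xC \<phi> k] bij_betw_same_card bij_betw_finite by metis
    qed
    have U: "extensions K H \<phi> = (\<Union>\<psi>\<in>extensions ?M H \<phi>. extensions K ?M \<psi>)"
    proof (intro equalityI subsetI)
      fix \<psi> assume \<psi>: "\<psi> \<in> extensions K H \<phi>"
      then have hom: "\<psi> \<in> circ.hom_on K" and eq: "\<forall>h\<in>H. \<psi> h = \<phi> h"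
        by (simp_all add: extensions_def)
      have "restrict \<psi> ?M \<in> circ.hom_on ?M"
        by (rule circ.hom_on_cong[OF M _ circ.hom_on_subset[OF hom MK]]) simp
      then have "restrict \<psi> ?M \<in> extensions ?M H \<phi>"
        using eq HM by (simp add: extensions_def subset_iff)
      moreover have "\<psi> \<in> extensions K ?M (restrict \<psi> ?M)"
        using \<psi> by (simp add: extensions_def)
      ultimately show "\<psi> \<in> (\<Union>\<psi>\<in>extensions ?M H \<phi>. extensions K ?M \<psi>)" by blast
    next
      fix \<psi> assume "\<psi> \<in> (\<Union>\<psi>\<in>extensions ?M H \<phi>. extensions K ?M \<psi>)"
      then show "\<psi> \<in> extensions K H \<phi>" using HM by (fastforce simp: extensions_def)
    qed
    have disj: "extensions K ?M \<psi> \<inter> extensions K ?M \<psi>' = {}"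
      if "\<psi> \<in> extensions ?M H \<phi>" "\<psi>' \<in> extensions ?M H \<phi>" "\<psi> \<noteq> \<psi>'" for \<psi> \<psi>'
    proof (rule ccontr)
      assume "extensions K ?M \<psi> \<inter> extensions K ?M \<psi>' \<noteq> {}"
      then have "\<psi> y = \<psi>' y" if "y \<in> ?M" for y using that by (force simp: extensions_def)
      then have "\<psi> = \<psi>'"
        using \<open>\<psi> \<in> _\<close> \<open>\<psi>' \<in> _\<close> by (intro extensionalityI[of \<psi> ?M \<psi>']) (auto simp: extensions_def)
      then show False using that by simp
    qed
    have "card (extensions K H \<phi>) = (\<Sum>\<psi>\<in>extensions ?M H \<phi>. card (extensions K ?M \<psi>))"
      unfolding U using Y IH disj by (intro card_UN_disjoint) auto
    also have "\<dots> = coset_index G K H" using Y IH mult by simp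
    finally show ?thesis using Y IH unfolding U by auto
  qed
qed

section \<open>Real logarithms of characters\<close>

lemma circle_hom_of_real:
  assumes "l \<in> re.hom_on M" shows "(\<lambda>y. cis (c * l y)) \<in> circ.hom_on M"
  using assms by (auto simp: circ.hom_on_iff re.hom_on_iff circle_simps real_group_simps cis_mult algebra_simps)

lemma circle_hom_power: "\<tau> \<in> circ.hom_on M \<Longrightarrow> (\<lambda>y. \<tau> y ^ k) \<in> circ.hom_on M"
  by (auto simp: circ.hom_on_iff circle_simps power_mult_distrib norm_power)

text \<open>The exponent \<open>N\<close> must not depend on \<open>\<tau>\<close>: the lemma is applied to an \<open>N\<close>-th root of a given
  character.\<close>

lemma circle_hom_power_lift:
  assumes "finite S" "S \<subseteq> carrier G" "subgroup H G"
  shows "\<exists>N::nat. N > 0 \<and> (\<forall>\<tau>\<in>hom G circle_group. (\<forall>h\<in>H. \<tau> h = 1) \<longrightarrow>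
    (\<exists>l\<in>re.hom_on (generate G (H \<union> S)). (\<forall>h\<in>H. l h = 0) \<and>
       (\<forall>y\<in>generate G (H \<union> S). cis (real N * l y) = \<tau> y ^ N)))" using assms(1,2)
proof (induction S rule: finite_induct)
  case empty
  have "(\<lambda>_. 0) \<in> re.hom_on H" by (simp add: re.hom_on_iff real_group_simps)
  then show ?case using assms(3) by (intro exI[of _ 1]) (auto simp: generate_subgroup)
next
  case (insert x S)
  let ?M = "generate G (H \<union> S)" and ?M' = "generate G (H \<union> insert x S)"
  have C: "H \<union> S \<subseteq> carrier G" "x \<in> carrier G"
    using insert.prems subgroup.subset[OF assms(3)] by auto
  have M: "subgroup ?M G" using C by (intro generate_is_subgroup)
  have HM: "H \<subseteq> ?M" by (auto intro: generate.incl)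
  have eq: "?M' = generate G (insert x ?M)" using generate_insert_generate[OF C] by simp
  have M'C: "?M' \<subseteq> carrier G" using C by (intro generate_incl) auto
  have xM': "x \<in> ?M'" by (auto intro: generate.incl)
  obtain N :: nat where N: "N > 0" and lift: "\<And>\<tau>. \<tau> \<in> hom G circle_group \<Longrightarrow> \<forall>h\<in>H. \<tau> h = 1 \<Longrightarrow>
    \<exists>l\<in>re.hom_on ?M. (\<forall>h\<in>H. l h = 0) \<and> (\<forall>y\<in>?M. cis (real N * l y) = \<tau> y ^ N)"
    using insert.IH insert.prems by (metis insert_subset)
  \<comment> \<open>The factor by which the exponent grows at this generator: it is 1 when
    \<open>x\<close> has infinite order modulo \<open>?M\<close>.\<close>
  obtain k :: nat where k: "k > 0" "x \<in> isolator G ?M \<Longrightarrow> x [^] k \<in> ?M"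
    "x \<notin> isolator G ?M \<Longrightarrow> k = 1"
  proof (cases "x \<in> isolator G ?M")
    case True
    then obtain k :: nat where "k > 0" "x [^] k \<in> ?M"
      by (auto simp: mem_isolator_iff generate_subgroup[OF M])
    then show ?thesis using that True by blast
  qed (use that[of 1] in auto)
  have "\<exists>l\<in>re.hom_on ?M'. (\<forall>h\<in>H. l h = 0) \<and> (\<forall>y\<in>?M'. cis (real (N * k) * l y) = \<tau> y ^ (N * k))"
    if \<tau>: "\<tau> \<in> hom G circle_group" "\<forall>h\<in>H. \<tau> h = 1" for \<tau>
  proof -
    obtain l where l: "l \<in> re.hom_on ?M" "\<forall>h\<in>H. l h = 0" "\<forall>y\<in>?M. cis (real N * l y) = \<tau> y ^ N"
      using lift[OF \<tau>] by blast
    have \<tau>on: "\<tau> \<in> circ.hom_on (carrier G)" using \<tau> by simp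
    have \<tau>M': "\<tau> \<in> circ.hom_on ?M'" using circ.hom_on_subset[OF \<tau>on M'C] .
    have n\<tau>: "norm (\<tau> x) = 1" using circ.hom_on_closed[OF \<tau>on C(2)] by (simp add: circle_simps)
    \<comment> \<open>For \<open>x\<close> of finite order modulo \<open>?M\<close> the real value
      is forced by \<open>l (x [^] k)\<close>, and \<open>cis (real N * a)\<close> can miss the N-th
      power of the value at \<open>x\<close> by a k-th root of unity; hence the new exponent
      \<open>N * k\<close>. Otherwise any logarithm is admissible, and \<open>Arg\<close> is
      one.\<close>
    define a where "a = (if x \<in> isolator G ?M then l (x [^] k) / real k else Arg (\<tau> x))"
    have compat: "l (x [^] j) = a [^]\<^bsub>real_group\<^esub> j" if j: "x [^] (j::int) \<in> ?M" for j
    proof (cases "x \<in> isolator G ?M")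
      case True
      then have xk: "x [^] int k \<in> ?M" using k by (simp add: int_pow_int)
      have "(x [^] j) [^] int k = (x [^] int k) [^] j"
        using C by (simp add: int_pow_pow mult.commute)
      then have "of_int (int k) * l (x [^] j) = of_int j * l (x [^] int k)"
        using re.hom_on_int_pow[OF M l(1) j, of "int k"] re.hom_on_int_pow[OF M l(1) xk, of j]
        by (simp add: int_pow_real_group)
      then show ?thesis
        using True k(1) by (simp add: int_pow_real_group a_def int_pow_int field_simps)
    next
      case False
      then have "j = 0"
        using j C mem_isolator_int_iff[OF subgroup.subset[OF M]] generate_subgroup[OF M] by blast
      then show ?thesis using re.hom_on_one[OF M l(1)] by (simp add: real_group_simps)
    qed
    obtain l' where l': "l' \<in> re.hom_on ?M'" "\<And>h. h \<in> ?M \<Longrightarrow> l' h = l h" "l' x = a"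
      using re.hom_on_adjoin[OF M C(2) l(1) _ compat] unfolding eq real_group_simps by blast
    have "cis (real (N * k) * l' y) = \<tau> y ^ (N * k)" if y: "y \<in> ?M'" for y
    proof (rule circ.hom_on_eqI[OF M C(2)])
      show "(\<lambda>y. cis (real (N * k) * l' y)) \<in> circ.hom_on (generate G (insert x ?M))"
        using circle_hom_of_real[OF l'(1)] unfolding eq .
      show "(\<lambda>y. \<tau> y ^ (N * k)) \<in> circ.hom_on (generate G (insert x ?M))"
        using circle_hom_power[OF \<tau>M'] unfolding eq .
      show "y \<in> generate G (insert x ?M)" using y unfolding eq .
      show "cis (real (N * k) * l' h) = \<tau> h ^ (N * k)" if h: "h \<in> ?M" for h
      proof -
        have "real (N * k) * l' h = real k * (real N * l h)" using l'(2)[OF h] by simp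
        then have "cis (real (N * k) * l' h) = cis (real N * l h) ^ k"
          by (simp only: Complex.DeMoivre)
        then show ?thesis using l(3) h by (simp add: power_mult)
      qed
      show "cis (real (N * k) * l' x) = \<tau> x ^ (N * k)"
      proof (cases "x \<in> isolator G ?M")
        case True
        then have xk: "x [^] k \<in> ?M" using k by simp
        have "\<tau> (x [^] k) = \<tau> x ^ k"
          using circ.hom_on_int_pow[OF subgroup_self \<tau>on C(2), of "int k"]
          by (simp add: int_pow_int nat_pow_circle)
        moreover have "real (N * k) * l' x = real N * l (x [^] k)"
          using True k(1) l'(3) by (simp add: a_def)
        moreover have "cis (real N * l (x [^] k)) = \<tau> (x [^] k) ^ N" using l(3) xk by blast
        moreover have "(\<tau> x ^ k) ^ N = \<tau> x ^ (N * k)" by (simp add: power_mult[symmetric] mult.commute)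
        ultimately show ?thesis by (simp only:)
      next
        case False
        have "\<tau> x \<noteq> 0" using n\<tau> by force
        then have "cis (Arg (\<tau> x)) = \<tau> x" using n\<tau> cis_Arg[of "\<tau> x"] by (simp add: sgn_div_norm)
        then have "cis (Arg (\<tau> x)) ^ (N * k) = \<tau> x ^ (N * k)" by simp
        then show ?thesis using False l'(3) by (simp add: a_def Complex.DeMoivre)
      qed
    qed
    moreover have "\<forall>h\<in>H. l' h = 0" using l'(2) l(2) HM by auto
    ultimately show ?thesis using l'(1) by blast
  qed
  moreover have "N * k > 0" using N k by simp
  ultimately show ?case by blast
qed

text \<open>The root is prescribed on products of \<open>T\<close> with N-th powers by sending
  \<open>t \<otimes> x [^] N\<close> to the value of \<open>\<tau>\<close> at \<open>x\<close>, and
  is then extended to \<open>G\<close> by divisibility of the circle.\<close>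

lemma circle_hom_root:
  assumes fg: "finitely_generated_group G" and T: "subgroup T G" "isolator G T \<subseteq> T" and N: "N > 0"
    and \<tau>: "\<tau> \<in> hom G circle_group" "\<forall>t\<in>T. \<tau> t = 1"
  shows "\<exists>\<psi>\<in>hom G circle_group. (\<forall>t\<in>T. \<psi> t = 1) \<and> (\<forall>y\<in>carrier G. \<psi> y ^ N = \<tau> y)"
proof -
  note TC = subgroup.mem_carrier[OF T(1)]
  have \<tau>on: "\<tau> \<in> circ.hom_on (carrier G)" using \<tau> by simp
  define M where "M = T <#> ((\<lambda>x. x [^] int N) ` carrier G)"
  have "subgroup ((\<lambda>x. x [^] int N) ` carrier G) G"
  proof (rule subgroupI)
    fix a b assume "a \<in> (\<lambda>x. x [^] int N) ` carrier G" "b \<in> (\<lambda>x. x [^] int N) ` carrier G"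
    then show "a \<otimes> b \<in> (\<lambda>x. x [^] int N) ` carrier G"
      by (auto simp: int_pow_distrib[symmetric] intro!: imageI)
  next
    fix a assume "a \<in> (\<lambda>x. x [^] int N) ` carrier G"
    then show "inv a \<in> (\<lambda>x. x [^] int N) ` carrier G"
      by (auto simp: int_pow_inv[symmetric] intro!: imageI)
  qed auto
  then have M: "subgroup M G" unfolding M_def by (intro mult_subgroups T)
  have memM: "y \<in> M \<longleftrightarrow> (\<exists>t\<in>T. \<exists>x\<in>carrier G. y = t \<otimes> x [^] int N)" for y
    by (auto simp: M_def set_mult_def)
  \<comment> \<open>Two such expressions of one element give an N-th power in \<open>T\<close>; as
    \<open>T\<close> is its own isolator, \<open>x\<close> and \<open>x'\<close> differ by an
    element of \<open>T\<close>, where \<open>\<tau>\<close> is trivial.\<close>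
  have wd: "\<tau> x = \<tau> x'"
    if tx: "t \<in> T" "t' \<in> T" "x \<in> carrier G" "x' \<in> carrier G"
      and e: "t \<otimes> x [^] int N = t' \<otimes> x' [^] int N" for t t' x x'
  proof -
    have "x [^] int N = inv t \<otimes> (t' \<otimes> x' [^] int N)"
      using e tx TC by (metis inv_solve_left int_pow_closed m_closed)
    then have "(x \<otimes> inv x') [^] int N = inv t \<otimes> t'"
      using tx TC by (simp add: int_pow_distrib int_pow_inv m_assoc)
    also have "\<dots> \<in> T" using tx T by (simp add: subgroup.m_closed subgroup.m_inv_closed)
    finally have "(x \<otimes> inv x') [^] int N \<in> T" .
    then have "(x \<otimes> inv x') [^] int N \<in> isolator G T"
      using sat.cl_extensive[OF subgroup.subset[OF T(1)]] by blast
    then have "x \<otimes> inv x' \<in> isolator G T"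
      using root_in_isolator[OF subgroup.subset[OF T(1)], of "x \<otimes> inv x'" "int N"] tx N by simp
    then have one: "\<tau> (x \<otimes> inv x') = 1" using T \<tau> by blast
    have "x = (x \<otimes> inv x') \<otimes> x'" using tx by (simp add: m_assoc)
    then have "\<tau> x = \<tau> (x \<otimes> inv x') * \<tau> x'"
      using circ.hom_on_mult[OF \<tau>on, of "x \<otimes> inv x'" x'] tx by (simp add: circle_simps)
    then show ?thesis using one by simp
  qed
  define \<psi>0 where "\<psi>0 y = (SOME z. \<exists>t\<in>T. \<exists>x\<in>carrier G. y = t \<otimes> x [^] int N \<and> z = \<tau> x)" for y
  have \<psi>0: "\<psi>0 (t \<otimes> x [^] int N) = \<tau> x" if tx: "t \<in> T" "x \<in> carrier G" for t x unfolding \<psi>0_def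
  proof (rule some_equality)
    show "\<exists>t'\<in>T. \<exists>x'\<in>carrier G. t \<otimes> x [^] int N = t' \<otimes> x' [^] int N \<and> \<tau> x = \<tau> x'" using tx by blast
    fix z assume "\<exists>t'\<in>T. \<exists>x'\<in>carrier G. t \<otimes> x [^] int N = t' \<otimes> x' [^] int N \<and> z = \<tau> x'"
    then show "z = \<tau> x" using wd tx by metis
  qed
  have "\<psi>0 (a \<otimes> b) = \<psi>0 a * \<psi>0 b" if ab: "a \<in> M" "b \<in> M" for a b
  proof -
    obtain t x t' x' where a: "a = t \<otimes> x [^] int N" "t \<in> T" "x \<in> carrier G"
      and b: "b = t' \<otimes> x' [^] int N" "t' \<in> T" "x' \<in> carrier G" using ab unfolding memM by blast
    have "a \<otimes> b = (t \<otimes> t') \<otimes> (x \<otimes> x') [^] int N" using a b TC by (simp add: int_pow_distrib m_ac)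
    then have "\<psi>0 (a \<otimes> b) = \<tau> (x \<otimes> x')"
      using \<psi>0[OF subgroup.m_closed[OF T(1) a(2) b(2)], of "x \<otimes> x'"] a b by simp
    also have "\<dots> = \<tau> x * \<tau> x'" using circ.hom_on_mult[OF \<tau>on a(3) b(3)] by (simp add: circle_simps)
    finally show ?thesis using \<psi>0 a b by simp
  qed
  moreover have "\<psi>0 a \<in> carrier circle_group" if a: "a \<in> M" for a
    using a \<psi>0 circ.hom_on_closed[OF \<tau>on] unfolding memM by auto
  ultimately have hom: "\<psi>0 \<in> circ.hom_on M" by (simp add: circ.hom_on_iff circle_simps)
  obtain S where S: "finite S" "S \<subseteq> carrier G" "generate G S = carrier G"
    using fg by (auto simp: finitely_generated_group_def)
  have "generate G (M \<union> S) = carrier G"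
    using mono_generate[of S "M \<union> S"] S generate_incl[of "M \<union> S"] subgroup.subset[OF M] by auto
  then obtain \<psi> where \<psi>: "\<psi> \<in> hom G circle_group" "\<forall>h\<in>M. \<psi> h = \<psi>0 h"
    using circle_hom_extend[OF S(1,2) M hom] by auto
  have \<psi>on: "\<psi> \<in> circ.hom_on (carrier G)" using \<psi> by simp
  have "\<psi> t = 1" if t: "t \<in> T" for t
  proof -
    have "t = t \<otimes> \<one> [^] int N" using TC t by simp
    then have "t \<in> M" "\<psi>0 t = \<tau> \<one>" using \<psi>0[OF t one_closed] t memM by (blast, metis)
    then show ?thesis using \<psi> circ.hom_on_one[OF subgroup_self \<tau>on] by (simp add: circle_simps)
  qed
  moreover have "\<psi> y ^ N = \<tau> y" if y: "y \<in> carrier G" for y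
  proof -
    have e: "y [^] int N = \<one> \<otimes> y [^] int N" using y by simp
    then have "y [^] int N \<in> M" using memM y subgroup.one_closed[OF T(1)] by blast
    then have "\<psi> (y [^] int N) = \<tau> y" using \<psi> \<psi>0[OF subgroup.one_closed[OF T(1)] y] e by simp
    then show ?thesis
      using circ.hom_on_int_pow[OF subgroup_self \<psi>on y, of "int N"] by (simp add: int_pow_int nat_pow_circle)
  qed
  ultimately show ?thesis using \<psi> by blast
qed

text \<open>The lifting lemma reproduces only N-th powers of a character. Applied to an N-th root of
  \<open>\<tau>\<close>, it reproduces \<open>\<tau>\<close>, with \<open>N\<close> times the lift
  as logarithm.\<close>

lemma circle_hom_eq_cis:
  assumes fg: "finitely_generated_group G" and T: "subgroup T G" "isolator G T \<subseteq> T"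
    and \<tau>: "\<tau> \<in> hom G circle_group" "\<forall>t\<in>T. \<tau> t = 1"
  obtains l where "l \<in> hom G real_group" "\<forall>t\<in>T. l t = 0" "\<forall>y\<in>carrier G. cis (l y) = \<tau> y"
proof -
  obtain S where S: "finite S" "S \<subseteq> carrier G" "generate G S = carrier G"
    using fg by (auto simp: finitely_generated_group_def)
  have gen: "generate G (T \<union> S) = carrier G"
    using mono_generate[of S "T \<union> S"] S generate_incl[of "T \<union> S"] subgroup.subset[OF T(1)] by auto
  obtain N :: nat where N: "N > 0" and lift: "\<And>\<tau>. \<tau> \<in> hom G circle_group \<Longrightarrow> \<forall>h\<in>T. \<tau> h = 1 \<Longrightarrow>
    \<exists>l\<in>re.hom_on (carrier G). (\<forall>h\<in>T. l h = 0) \<and> (\<forall>y\<in>carrier G. cis (real N * l y) = \<tau> y ^ N)"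
    using circle_hom_power_lift[OF S(1,2) T(1)] unfolding gen by blast
  obtain \<psi> where \<psi>: "\<psi> \<in> hom G circle_group" "\<forall>t\<in>T. \<psi> t = 1" "\<forall>y\<in>carrier G. \<psi> y ^ N = \<tau> y"
    using circle_hom_root[OF fg T N \<tau>] by blast
  obtain l where l: "l \<in> re.hom_on (carrier G)" "\<forall>t\<in>T. l t = 0" "\<forall>y\<in>carrier G. cis (real N * l y) = \<psi> y ^ N"
    using lift[OF \<psi>(1,2)] by blast
  have "(\<lambda>y. real N * l y) \<in> hom G real_group"
    using l(1) by (auto simp: hom_def real_group_simps algebra_simps)
  then show ?thesis using that l \<psi>(3) by auto
qed

end

section \<open>Components of toric intersections\<close>

lemma component_eq_clopen:
  assumes "connectedin X S" "openin X S" "closedin X S" "x \<in> S"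
  shows "connected_component_of_set X x = S"
proof
  show "S \<subseteq> connected_component_of_set X x" by (rule connected_component_of_maximal[OF assms(1,4)])
  have "connectedin X (connected_component_of_set X x)" by (rule connectedin_connected_component_of)
  then have "connected_component_of_set X x \<subseteq> S \<or> disjnt (connected_component_of_set X x) S"
    using assms by (intro connectedin_clopen_cases)
  moreover have "x \<in> connected_component_of_set X x"
    using assms openin_subset by (fastforce simp: connected_component_of_refl)
  ultimately show "connected_component_of_set X x \<subseteq> S" using assms by (auto simp: disjnt_def)
qed

context group_list
begin

interpretation circ: two_comm_groups G circle_group
  by (intro two_comm_groups.intro comm_group_axioms comm_group_circle)

lemma mem_characters: "\<phi> \<in> characters G \<longleftrightarrow> \<phi> \<in> circ.hom_on (carrier G) \<and> \<phi> \<in> extensional (carrier G)"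
  by (simp add: characters_def)

lemma circle_hom_trivial_iff:
  assumes A: "g ` A \<subseteq> K" and K: "subgroup K G" and \<psi>: "\<psi> \<in> circ.hom_on K"
  shows "(\<forall>e\<in>A. \<psi> (g e) = 1) \<longleftrightarrow> (\<forall>h\<in>generate G (g ` A). \<psi> h = 1)"
proof
  assume triv: "\<forall>e\<in>A. \<psi> (g e) = 1"
  have "subgroup {h \<in> K. \<psi> h = 1} G"
  proof (rule subgroupI)
    show "{h \<in> K. \<psi> h = 1} \<noteq> {}"
      using subgroup.one_closed[OF K] circ.hom_on_one[OF K \<psi>] by (auto simp: circle_simps)
    show "inv a \<in> {h \<in> K. \<psi> h = 1}" if "a \<in> {h \<in> K. \<psi> h = 1}" for a
    proof -
      have a: "a \<in> K" "inv a \<in> K" "\<psi> a = 1" using that subgroup.m_inv_closed[OF K] by auto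
      have "\<psi> (a \<otimes> inv a) = \<psi> a * \<psi> (inv a)"
        using circ.hom_on_mult[OF \<psi> a(1,2)] by (simp add: circle_simps)
      then have "\<psi> (inv a) = 1"
        using a subgroup.mem_carrier[OF K a(1)] circ.hom_on_one[OF K \<psi>] by (simp add: circle_simps)
      then show ?thesis using a by simp
    qed
    show "a \<otimes> b \<in> {h \<in> K. \<psi> h = 1}" if "a \<in> {h \<in> K. \<psi> h = 1}" "b \<in> {h \<in> K. \<psi> h = 1}" for a b
      using that subgroup.m_closed[OF K, of a b] circ.hom_on_mult[OF \<psi>, of a b] by (simp add: circle_simps)
  qed (use subgroup.subset[OF K] in auto)
  then have "generate G (g ` A) \<subseteq> {h \<in> K. \<psi> h = 1}"
    by (rule generate_subgroup_incl[rotated]) (use A triv in auto)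
  then show "\<forall>h\<in>generate G (g ` A). \<psi> h = 1" by blast
qed (use generate.incl[of _ "g ` A" G] in blast)

definition toric_locus :: "'e set \<Rightarrow> ('a \<Rightarrow> complex) set" where
  "toric_locus R = characters G \<inter> (\<Inter>e\<in>R. toric_hyp G g e)"

text \<open>When nonempty, a translate of the group of characters that are trivial on the isolator
  of the span of \<open>R\<close>.\<close>

definition toric_fibre :: "'e set \<Rightarrow> ('a \<Rightarrow> complex) \<Rightarrow> ('a \<Rightarrow> complex) set" where
  "toric_fibre R \<psi> = {\<phi> \<in> toric_locus R. \<forall>t\<in>isolator G (g ` R). \<phi> t = \<psi> t}"

text \<open>The dual of the torsion group \<open>G_R\<close>, encoded as characters of the isolator
  that are trivial on the span; it indexes the components.\<close>

definition torsion_chars :: "'e set \<Rightarrow> ('a \<Rightarrow> complex) set" where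
  "torsion_chars R = extensions (isolator G (g ` R)) (generate G (g ` R)) (\<lambda>_. 1)"

abbreviation toric_topology :: "'e set \<Rightarrow> ('a \<Rightarrow> complex) topology" where
  "toric_topology R \<equiv> subtopology (character_topology G) (toric_locus R)"

lemma mem_toric_locus:
  "\<phi> \<in> toric_locus R \<longleftrightarrow> \<phi> \<in> characters G \<and> (\<forall>e\<in>R. \<phi> (g e) = 1)"
  by (auto simp: toric_locus_def toric_hyp_def)

lemma toric_topology_eq:
  "toric_topology R =
    subtopology (product_topology (\<lambda>_. top_of_set (sphere 0 1)) (carrier G)) (toric_locus R)"
proof -
  have "characters G \<inter> toric_locus R = toric_locus R"
    by (auto simp: toric_locus_def)
  then show ?thesis by (simp add: character_topology_def subtopology_subtopology)
qed

lemma topspace_toric_topology: "topspace (toric_topology R) = toric_locus R"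
proof -
  have "toric_locus R \<subseteq> carrier G \<rightarrow>\<^sub>E sphere 0 1"
    by (auto simp: mem_toric_locus characters_def hom_def circle_simps extensional_def Pi_iff)
  then show ?thesis by (auto simp: toric_topology_eq)
qed

context
  fixes R :: "'e set"
  assumes fg: "finitely_generated_group G" and R: "R \<subseteq> E"
begin

private abbreviation "T \<equiv> isolator G (g ` R)"
private abbreviation "H \<equiv> generate G (g ` R)"

lemma subgroups: "subgroup T G" "subgroup H G" "H \<subseteq> T" "isolator G T \<subseteq> T" "T \<subseteq> isolator G H"
  using image_closed[OF R] by (auto simp: subgroup_isolator generate_is_subgroup isolator_generate
      intro: subsetD[OF generate_subset_isolator] dest: subsetD[OF sat.cl_idem])

lemma gR_T: "e \<in> R \<Longrightarrow> g e \<in> T"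
  using subgroups(3) generate.incl[of _ "g ` R" G] by blast

lemma one_hom: "(\<lambda>_. 1) \<in> circ.hom_on K"
  by (simp add: circ.hom_on_iff circle_simps)

lemma finite_torsion_chars: "finite (torsion_chars R)"
proof -
  have "finite ((\<lambda>x. H #> x) ` T)"
    using finite_cosets_isolator[OF fg subgroups(2)] isolator_generate[OF image_closed[OF R]] by simp
  then show ?thesis unfolding torsion_chars_def
    using card_extensions[OF subgroups(2,1,3,5) _ one_hom] by blast
qed

lemma restrict_torsion_chars:
  assumes "\<phi> \<in> toric_locus R" shows "restrict \<phi> T \<in> torsion_chars R"
proof -
  have \<phi>: "\<phi> \<in> circ.hom_on (carrier G)" "\<forall>e\<in>R. \<phi> (g e) = 1"
    using assms by (auto simp: mem_toric_locus mem_characters)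
  have hom: "restrict \<phi> T \<in> circ.hom_on T"
    by (rule circ.hom_on_cong[OF subgroups(1) _ circ.hom_on_subset[OF \<phi>(1) isolator_subset_carrier]]) simp
  have "g ` R \<subseteq> T" "\<forall>e\<in>R. restrict \<phi> T (g e) = 1" using gR_T \<phi>(2) by auto
  then have "\<forall>h\<in>H. restrict \<phi> T h = 1"
    using circle_hom_trivial_iff[OF _ subgroups(1) hom, of R] by blast
  then show ?thesis using hom by (simp add: torsion_chars_def extensions_def)
qed

text \<open>Divisibility of the circle makes every fibre nonempty, so that different indices give
  different components.\<close>

lemma torsion_chars_extend:
  assumes \<psi>: "\<psi> \<in> torsion_chars R" obtains \<phi> where "\<phi> \<in> toric_fibre R \<psi>"
proof -
  obtain S where S: "finite S" "S \<subseteq> carrier G" "generate G S = carrier G"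
    using fg by (auto simp: finitely_generated_group_def)
  have "generate G (T \<union> S) = carrier G"
    using mono_generate[of S "T \<union> S"] S generate_incl[of "T \<union> S"] subgroup.subset[OF subgroups(1)] by auto
  moreover have hom: "\<psi> \<in> circ.hom_on T" and triv: "\<forall>h\<in>H. \<psi> h = 1"
    using \<psi> by (auto simp: torsion_chars_def extensions_def)
  ultimately obtain \<phi> where \<phi>: "\<phi> \<in> circ.hom_on (carrier G)" "\<forall>t\<in>T. \<phi> t = \<psi> t"
    using circle_hom_extend[OF S(1,2) subgroups(1) hom] by auto
  have "restrict \<phi> (carrier G) \<in> circ.hom_on (carrier G)"
    by (rule circ.hom_on_cong[OF subgroup_self _ \<phi>(1)]) simp
  moreover have TC: "t \<in> carrier G" if "t \<in> T" for t using subgroup.mem_carrier[OF subgroups(1) that] .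
  moreover have "\<psi> (g e) = 1" if "e \<in> R" for e
    using triv that generate.incl[of "g e" "g ` R" G] by blast
  ultimately have "restrict \<phi> (carrier G) \<in> toric_fibre R \<psi>"
    using \<phi>(2) gR_T by (simp add: toric_fibre_def mem_toric_locus mem_characters)
  then show ?thesis by (rule that)
qed

lemma restrict_toric_fibre:
  assumes "\<psi> \<in> torsion_chars R" "\<phi> \<in> toric_fibre R \<psi>" shows "restrict \<phi> T = \<psi>"
  by (rule extensionalityI[of _ T])
    (use assms in \<open>auto simp: toric_fibre_def torsion_chars_def extensions_def\<close>)

lemma closedin_toric_fibre: "closedin (toric_topology R) (toric_fibre R \<psi>)"
proof -
  have "closedin (toric_topology R) {\<phi> \<in> topspace (toric_topology R). \<phi> t = \<psi> t}" if t: "t \<in> T" for t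
  proof -
    have tC: "t \<in> carrier G" using subgroup.mem_carrier[OF subgroups(1) t] .
    have "continuous_map (toric_topology R) (top_of_set (sphere 0 1)) (\<lambda>\<phi>. \<phi> t)"
      unfolding toric_topology_eq
      using continuous_map_product_coordinates[OF tC] by (rule continuous_map_from_subtopology)
    then have "continuous_map (toric_topology R) euclidean (\<lambda>\<phi>. \<phi> t)"
      by (simp add: continuous_map_in_subtopology)
    then show ?thesis
      using closedin_continuous_map_preimage[of "toric_topology R" euclidean "\<lambda>\<phi>. \<phi> t" "{\<psi> t}"] by simp
  qed
  then have "closedin (toric_topology R) (\<Inter>t\<in>T. {\<phi> \<in> topspace (toric_topology R). \<phi> t = \<psi> t})"
    using subgroup.one_closed[OF subgroups(1)] by (intro closedin_Inter) auto
  moreover have "(\<Inter>t\<in>T. {\<phi> \<in> topspace (toric_topology R). \<phi> t = \<psi> t}) = toric_fibre R \<psi>"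
    using subgroup.one_closed[OF subgroups(1)] unfolding topspace_toric_topology toric_fibre_def by blast
  ultimately show ?thesis by simp
qed

text \<open>The fibres partition the locus, and finiteness of \<open>torsion_chars R\<close> makes
  the complement of one fibre a finite union of closed ones.\<close>

lemma openin_toric_fibre:
  assumes \<psi>: "\<psi> \<in> torsion_chars R" shows "openin (toric_topology R) (toric_fibre R \<psi>)"
proof -
  have "closedin (toric_topology R) (\<Union>\<psi>'\<in>torsion_chars R - {\<psi>}. toric_fibre R \<psi>')"
    using finite_torsion_chars closedin_toric_fibre by (intro closedin_Union) auto
  moreover have "toric_locus R - (\<Union>\<psi>'\<in>torsion_chars R - {\<psi>}. toric_fibre R \<psi>') = toric_fibre R \<psi>"
  proof (intro equalityI subsetI)
    fix \<phi> assume \<phi>: "\<phi> \<in> toric_locus R - (\<Union>\<psi>'\<in>torsion_chars R - {\<psi>}. toric_fibre R \<psi>')"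
    then have "restrict \<phi> T \<in> torsion_chars R" by (intro restrict_torsion_chars) simp
    moreover have "\<phi> \<in> toric_fibre R (restrict \<phi> T)" using \<phi> by (simp add: toric_fibre_def)
    ultimately have "restrict \<phi> T = \<psi>" using \<phi> by blast
    then show "\<phi> \<in> toric_fibre R \<psi>" using \<open>\<phi> \<in> toric_fibre R (restrict \<phi> T)\<close> by simp
  next
    fix \<phi> assume \<phi>: "\<phi> \<in> toric_fibre R \<psi>"
    then have "\<phi> \<notin> toric_fibre R \<psi>'" if "\<psi>' \<in> torsion_chars R - {\<psi>}" for \<psi>'
      using restrict_toric_fibre[OF \<psi> \<phi>] restrict_toric_fibre[of \<psi>' \<phi>] that by auto
    then show "\<phi> \<in> toric_locus R - (\<Union>\<psi>'\<in>torsion_chars R - {\<psi>}. toric_fibre R \<psi>')"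
      using \<phi> by (auto simp: toric_fibre_def)
  qed
  ultimately show ?thesis using openin_diff[OF openin_topspace] topspace_toric_topology by metis
qed

text \<open>The quotient of two characters in a fibre is trivial on \<open>T\<close>, hence
  \<open>cis\<close> of a real homomorphism \<open>l\<close>. Scaling \<open>l\<close> from 0 to 1
  joins the two by a path, which stays in the fibre because \<open>l\<close> vanishes on
  \<open>T\<close>.\<close>

lemma connectedin_toric_fibre: "connectedin (toric_topology R) (toric_fibre R \<psi>)"
proof (rule path_connectedin_imp_connectedin, unfold path_connectedin, intro conjI ballI)
  show "toric_fibre R \<psi> \<subseteq> topspace (toric_topology R)"
    unfolding topspace_toric_topology by (auto simp: toric_fibre_def)
  fix \<phi> \<phi>' assume "\<phi> \<in> toric_fibre R \<psi>" "\<phi>' \<in> toric_fibre R \<psi>"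
  then have \<phi>: "\<phi> \<in> circ.hom_on (carrier G)" "\<phi> \<in> extensional (carrier G)" "\<forall>e\<in>R. \<phi> (g e) = 1" "\<forall>t\<in>T. \<phi> t = \<psi> t"
    and \<phi>': "\<phi>' \<in> circ.hom_on (carrier G)" "\<phi>' \<in> extensional (carrier G)" "\<forall>t\<in>T. \<phi>' t = \<psi> t"
    by (auto simp: toric_fibre_def mem_toric_locus mem_characters)
  have norm: "norm (\<phi> y) = 1" "norm (\<phi>' y) = 1" if "y \<in> carrier G" for y
    using circ.hom_on_closed[OF \<phi>(1) that] circ.hom_on_closed[OF \<phi>'(1) that]
    by (simp_all add: circle_simps)
  then have nz: "\<phi> y \<noteq> 0" if "y \<in> carrier G" for y using that by force
  define \<tau> where "\<tau> y = \<phi>' y / \<phi> y" for y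
  have \<tau>: "\<tau> \<in> hom G circle_group"
    using \<phi>(1) \<phi>'(1) norm by (auto simp: hom_def circ.hom_on_iff circle_simps \<tau>_def norm_divide)
  have "\<forall>t\<in>T. \<tau> t = 1"
    using \<phi>(4) \<phi>'(3) nz subgroup.mem_carrier[OF subgroups(1)] by (metis \<tau>_def divide_self)
  then obtain l where l: "l \<in> hom G real_group" "\<forall>t\<in>T. l t = 0" "\<forall>y\<in>carrier G. cis (l y) = \<tau> y"
    using circle_hom_eq_cis[OF fg subgroups(1,4) \<tau>] by blast
  have l_mult: "l (x \<otimes> y) = l x + l y" if "x \<in> carrier G" "y \<in> carrier G" for x y
    using l(1) that by (auto simp: hom_def real_group_simps)
  define p where "p s = (\<lambda>y\<in>carrier G. \<phi> y * cis (s * l y))" for s :: real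
  have p_fibre: "p s \<in> toric_fibre R \<psi>" for s
  proof -
    have "p s \<in> circ.hom_on (carrier G)" using \<phi>(1) l_mult
      by (auto simp: hom_def circle_simps p_def norm_mult distrib_left simp flip: cis_mult)
    moreover have "\<forall>t\<in>T. p s t = \<phi> t"
      using l(2) subgroup.mem_carrier[OF subgroups(1)] by (simp add: p_def)
    ultimately show ?thesis
      using \<phi>(3,4) gR_T by (simp add: toric_fibre_def mem_toric_locus mem_characters p_def)
  qed
  have "continuous_map (top_of_set {0..1}) (top_of_set (sphere 0 1)) (\<lambda>s. p s y)" if y: "y \<in> carrier G" for y
  proof -
    have "continuous_on {0..1} (\<lambda>s. \<phi> y * cis (s * l y))" by (intro continuous_intros)
    then have "continuous_on {0..1} (\<lambda>s. p s y)" using y by (simp add: p_def)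
    moreover have "norm (p s y) = 1" for s using y norm by (simp add: p_def norm_mult)
    ultimately show ?thesis by (auto simp: continuous_map_in_subtopology)
  qed
  then have "continuous_map (top_of_set {0..1}) (product_topology (\<lambda>_. top_of_set (sphere 0 1)) (carrier G)) p"
    by (intro continuous_map_coordinatewise_then_product) (auto simp: p_def)
  then have "pathin (toric_topology R) p"
    using p_fibre unfolding pathin_def toric_topology_eq continuous_map_in_subtopology
    by (auto simp: toric_fibre_def)
  moreover have "p 0 = \<phi>" using \<phi>(2) by (intro extensionalityI[of _ "carrier G"]) (auto simp: p_def)
  moreover have "p 1 = \<phi>'"
    using \<phi>'(2) l(3) nz by (intro extensionalityI[of _ "carrier G"]) (auto simp: p_def \<tau>_def)
  ultimately show "\<exists>p. pathin (toric_topology R) p \<and> p \<in> {0..1} \<rightarrow> toric_fibre R \<psi> \<and> p 0 = \<phi> \<and> p 1 = \<phi>'"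
    using p_fibre by blast
qed

text \<open>Each fibre is connected, open and closed, hence the component of each of its points, and
  the fibres cover the locus.\<close>

lemma toric_components_eq: "toric_components G g R = toric_fibre R ` torsion_chars R"
proof -
  have comp: "connected_component_of_set (toric_topology R) \<phi> = toric_fibre R (restrict \<phi> T)"
    if \<phi>: "\<phi> \<in> toric_locus R" for \<phi> using restrict_torsion_chars[OF \<phi>] \<phi>
    by (intro component_eq_clopen connectedin_toric_fibre openin_toric_fibre closedin_toric_fibre)
      (auto simp: toric_fibre_def)
  have "(\<lambda>\<phi>. restrict \<phi> T) ` toric_locus R = torsion_chars R"
  proof (intro equalityI subsetI)
    fix \<psi> assume \<psi>: "\<psi> \<in> torsion_chars R"
    then obtain \<phi> where \<phi>: "\<phi> \<in> toric_fibre R \<psi>" by (rule torsion_chars_extend)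
    then have "\<phi> \<in> toric_locus R" by (simp add: toric_fibre_def)
    then show "\<psi> \<in> (\<lambda>\<phi>. restrict \<phi> T) ` toric_locus R"
      using restrict_toric_fibre[OF \<psi> \<phi>] by blast
  qed (use restrict_torsion_chars in blast)
  moreover have "toric_components G g R = (\<lambda>\<phi>. toric_fibre R (restrict \<phi> T)) ` toric_locus R"
    unfolding toric_components_def connected_components_of_def toric_locus_def[symmetric]
      topspace_toric_topology using comp by (rule image_cong[OF refl])
  ultimately show ?thesis by (metis image_image)
qed

text \<open>As \<open>g e\<close> lies in \<open>T\<close> for \<open>e\<close> in \<open>X\<close>,
  evaluation at it is constant on each fibre, so the fibre of \<open>\<psi>\<close> lies in
  \<open>H_e\<close> exactly when \<open>\<psi> (g e) = 1\<close>. The characters meeting this for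
  all \<open>e\<close> in \<open>L\<close> are counted by an index.\<close>

lemma sum_toric_components:
  fixes y :: "'r::comm_ring_1"
  assumes X: "X \<subseteq> list_cl R"
  shows "(\<Sum>c\<in>toric_components G g R. y ^ toric_eta G g X c) =
    (\<Sum>L\<in>Pow X. of_nat (list_mult G g (R \<union> L)) * (y - 1) ^ card L)"
proof -
  have gX: "g e \<in> T" if "e \<in> X" for e using X that by (auto simp: mem_list_cl)
  have XE: "X \<subseteq> E" using X by (auto simp: mem_list_cl)
  then have fX: "finite X" using finite_E finite_subset by blast
  have inj: "inj_on (toric_fibre R) (torsion_chars R)"
  proof (rule inj_onI)
    fix \<psi> \<psi>' assume \<psi>: "\<psi> \<in> torsion_chars R" "\<psi>' \<in> torsion_chars R" "toric_fibre R \<psi> = toric_fibre R \<psi>'"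
    obtain \<phi> where "\<phi> \<in> toric_fibre R \<psi>" using torsion_chars_extend[OF \<psi>(1)] .
    then show "\<psi> = \<psi>'" using restrict_toric_fibre \<psi> by metis
  qed
  have eta: "toric_eta G g X (toric_fibre R \<psi>) = card {e \<in> X. \<psi> (g e) = 1}" if \<psi>: "\<psi> \<in> torsion_chars R" for \<psi>
  proof -
    obtain \<phi> where \<phi>: "\<phi> \<in> toric_fibre R \<psi>" using torsion_chars_extend[OF \<psi>] .
    have "toric_fibre R \<psi> \<subseteq> toric_hyp G g e \<longleftrightarrow> \<psi> (g e) = 1" if e: "e \<in> X" for e
      using gX[OF e] \<phi> by (auto simp: toric_fibre_def toric_hyp_def mem_toric_locus)
    then show ?thesis unfolding toric_eta_def by metis
  qed
  have card: "card {\<psi> \<in> torsion_chars R. \<forall>e\<in>L. \<psi> (g e) = 1} = list_mult G g (R \<union> L)" if L: "L \<subseteq> X" for L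
  proof -
    have RL: "R \<union> L \<subseteq> E" using R L XE by blast
    have C: "g ` (R \<union> L) \<subseteq> carrier G" using RL by (rule image_closed)
    have "R \<subseteq> list_cl R" using R by (rule list.cl_extensive)
    \<comment> \<open>The isolator of \<open>R \<union> L\<close> is still \<open>T\<close>, so the
      index of the larger span in \<open>T\<close> is \<open>m(R \<union> L)\<close>.\<close>
    then have T: "isolator G (g ` (R \<union> L)) = T" using RL L X by (intro isolator_image_eq) auto
    let ?H' = "generate G (g ` (R \<union> L))"
    have gRL: "g ` (R \<union> L) \<subseteq> T" using gR_T gX L by blast
    have H': "subgroup ?H' G" "?H' \<subseteq> T" "T \<subseteq> isolator G ?H'"
      using C gRL subgroups(1) by (auto simp: generate_is_subgroup isolator_generate T
          intro: subsetD[OF generate_subgroup_incl])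
    have "{\<psi> \<in> torsion_chars R. \<forall>e\<in>L. \<psi> (g e) = 1} = extensions T ?H' (\<lambda>_. 1)"
    proof -
      have "(\<forall>h\<in>H. \<psi> h = 1) \<and> (\<forall>e\<in>L. \<psi> (g e) = 1) \<longleftrightarrow> (\<forall>h\<in>?H'. \<psi> h = 1)"
        if \<psi>: "\<psi> \<in> circ.hom_on T" for \<psi> using circle_hom_trivial_iff[OF _ subgroups(1) \<psi>, of R] gR_T
          circle_hom_trivial_iff[OF gRL subgroups(1) \<psi>] by blast
      then show ?thesis unfolding torsion_chars_def extensions_def by blast
    qed
    moreover have "finite ((\<lambda>x. ?H' #> x) ` T)"
      using finite_cosets_isolator[OF fg H'(1)] isolator_generate[OF C] T by simp
    ultimately show ?thesis using card_extensions[OF H'(1) subgroups(1) H'(2,3) _ one_hom] T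
      by (simp add: list_mult_eq_index[OF C])
  qed
  have "(\<Sum>c\<in>toric_components G g R. y ^ toric_eta G g X c) =
      (\<Sum>\<psi>\<in>torsion_chars R. y ^ card {e \<in> X. \<psi> (g e) = 1})"
    unfolding toric_components_eq using inj eta by (simp add: sum.reindex)
  also have "\<dots> = (\<Sum>L\<in>Pow X. of_nat (card {\<psi> \<in> torsion_chars R. \<forall>e\<in>L. \<psi> (g e) = 1}) * (y - 1) ^ card L)"
    using finite_torsion_chars fX by (rule sum_power_card_eq)
  also have "\<dots> = (\<Sum>L\<in>Pow X. of_nat (list_mult G g (R \<union> L)) * (y - 1) ^ card L)"
    using card by (intro sum.cong) auto
  finally show ?thesis .
qed

end

end

section \<open>The activity expansion\<close>

theorem theorem6p3:
  fixes G :: "('a, 'm) monoid_scheme"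
    and E :: "'e::linorder set"
    and g :: "'e \<Rightarrow> 'a"
    and n :: "'e set \<Rightarrow> nat"
    and f :: "'e set \<Rightarrow> 'e \<Rightarrow> nat \<Rightarrow> int"
    and x y :: "'r::comm_ring_1"
  assumes "comm_group G"
    and "finitely_generated_group G"
    and "finite E"
    and "g ` E \<subseteq> carrier G"
    and "\<And>B. B \<in> list_bases G g E \<Longrightarrow>
           f B ` int_active G g E B \<subseteq> carrier (free_Z (n B))"
    and "\<And>B K. B \<in> list_bases G g E \<Longrightarrow> K \<subseteq> int_active G g E B \<Longrightarrow>
           G Mod span_list G g (nonactive_part G g E B \<union> K)
             \<cong> (free_Z (n B) Mod span_list (free_Z (n B)) (f B) K)
               \<times>\<times> list_torsion G g (nonactive_part G g E B)"
  shows "arith_Tutte G g E x y =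
    (\<Sum>B\<in>list_bases G g E.
       (\<Sum>p\<in>box_points (n B) (f B) (int_active G g E B).
          x ^ box_iota (n B) (f B) (int_active G g E B) p)
     * (\<Sum>c\<in>toric_components G g (nonactive_part G g E B).
          y ^ toric_eta G g (ext_active G g E B) c))"
proof -
  interpret ordered_group_list G g E
    by (intro ordered_group_list.intro group_list.intro group_list_axioms.intro assms)
  define w where "w A = of_nat (list_mult G g A) * (x - 1) ^ (list_rk G g E - list_rk G g A)
        * (y - 1) ^ (card A - list_rk G g A)" for A
  have "arith_Tutte G g E x y = (\<Sum>A\<in>Pow E. w A)" by (simp add: arith_Tutte_def w_def)
  also have "\<dots> = (\<Sum>B\<in>bases. \<Sum>K\<in>Pow (internal B). \<Sum>L\<in>Pow (external B). w ((B - internal B) \<union> K \<union> L))"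
    by (rule sum_Pow_eq_sum_bases)
  also have "\<dots> = (\<Sum>B\<in>list_bases G g E.
       (\<Sum>p\<in>box_points (n B) (f B) (int_active G g E B).
          x ^ box_iota (n B) (f B) (int_active G g E B) p)
     * (\<Sum>c\<in>toric_components G g (nonactive_part G g E B).
          y ^ toric_eta G g (ext_active G g E B) c))" unfolding bases_eq
  proof (rule sum.cong[OF refl])
    fix B assume B: "B \<in> bases"
    define R where "R = B - internal B"
    let ?Z = "free_Z (n B)" and ?I = "internal B"
    have iB: "list.indep B" and BE: "B \<subseteq> E" and fB: "finite B"
      using B by (auto simp: bases_def list.indep_def)
    have IB: "?I \<subseteq> B" by (rule internal_subset)
    have RE: "R \<subseteq> E" and IE: "?I \<subseteq> E" and RI: "R \<inter> ?I = {}" and RuI: "R \<union> ?I = B"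
      using BE IB by (auto simp: R_def)
    have eqs: "int_active G g E B = ?I" "ext_active G g E B = external B" "nonactive_part G g E B = R"
      using B by (simp_all add: int_active_eq ext_active_eq nonactive_part_def R_def)
    have X: "external B \<subseteq> list_cl R" unfolding R_def by (rule external_subset_cl[OF iB])
    have Z: "group_list ?Z (f B) ?I" using assms(5)[of B] B IE finite_subset[OF IE assms(3)]
      by (intro group_list.intro group_list_axioms.intro comm_group_free_Z) (auto simp: bases_eq eqs)
    have iso: "G Mod span_list G g (R \<union> K) \<cong> (?Z Mod span_list ?Z (f B) K) \<times>\<times> list_torsion G g R"
      if "K \<subseteq> ?I" for K using assms(6)[of B K] B that by (simp add: bases_eq eqs)
    \<comment> \<open>Independence of \<open>f B\<close> on the internally active elements enters
      here, obtained from the isomorphisms and the independence of \<open>B\<close>.\<close>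
    interpret L: lattice_list "n B" "f B" ?I using Z indep_of_iso[OF assms(2) Z _ RI iso] iB RuI
      by (intro lattice_list.intro lattice_list_axioms.intro) auto
    have mult: "list_mult G g (R \<union> K) = list_mult ?Z (f B) K * list_mult G g R" if "K \<subseteq> ?I" for K
      using that IE by (intro list_mult_iso[OF RE _ Z that iso]) auto
    have pos: "list_mult G g A > 0" if "A \<subseteq> E" for A by (rule list_mult_pos[OF assms(2) that])
    \<comment> \<open>The case \<open>K = I(B)\<close> reads \<open>m(B) = m'(I(B)) m(R)\<close>
      with a positive left side.\<close>
    have "list_mult ?Z (f B) ?I > 0"
      using mult[of ?I] pos[OF BE] RuI by (cases "list_mult ?Z (f B) ?I") auto
    note x_sum = L.sum_box_points[OF this, of x]
    have w: "w (R \<union> K \<union> L) =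
        (of_nat (list_mult ?Z (f B) K) * (x - 1) ^ (card ?I - card K)) *
        (of_nat (list_mult G g (R \<union> L)) * (y - 1) ^ card L)"
      if K: "K \<subseteq> ?I" and L: "L \<subseteq> external B" for K L
    proof -
      have RK: "list.indep (R \<union> K)"
        by (rule list.indep_subset[OF iB]) (use K IB in \<open>auto simp: R_def\<close>)
      have RKE: "R \<union> K \<subseteq> E" and XE: "L \<subseteq> E" using RE IE K L X by (auto simp: mem_list_cl)
      have fin: "finite R" "finite K" "finite L" "finite ?I"
        using RKE XE IE assms(3) finite_subset by auto
      \<comment> \<open>The molecule identity and \<open>m(R \<union> K) = m'(K) m(R)\<close> share
        the factor \<open>m(R)\<close>, which is positive and cancels.\<close>
      have "list_mult G g (R \<union> K \<union> L) * list_mult G g R =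
          list_mult ?Z (f B) K * list_mult G g R * list_mult G g (R \<union> L)"
        using list_mult_molecule[OF assms(2) RK _ order_trans[OF L X]] mult[OF K] RI K by auto
      then have m: "list_mult G g (R \<union> K \<union> L) = list_mult ?Z (f B) K * list_mult G g (R \<union> L)"
        using pos[OF RE] by (simp add: mult_ac)
      have "list_cl R \<subseteq> list_cl (R \<union> K)" using RKE by (intro list.cl_mono) auto
      \<comment> \<open>\<open>L\<close> lies in the closure of \<open>R\<close> and adds nothing to
        the rank, so the corank depends on \<open>K\<close> alone and the nullity is
        \<open>card L\<close>; this is what separates the two sums.\<close>
      then have "list_rk G g (R \<union> K \<union> L) = card (R \<union> K)"
        using L X RKE XE list.cl_extensive[OF RKE] by (intro list_rk_eq_card[OF RK]) auto
      then have rA: "list_rk G g (R \<union> K \<union> L) = card R + card K"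
        using fin RI K by (subst (asm) card_Un_disjoint) auto
      have "list_rk G g E = card B"
        using B BE by (intro list_rk_eq_card[OF iB]) (auto simp: bases_def)
      then have rE: "list_rk G g E = card R + card ?I"
        using fin RI RuI card_Un_disjoint[of R ?I] by simp
      have "R \<union> K \<subseteq> B" using K IB by (auto simp: R_def)
      then have "(R \<union> K) \<inter> L = {}" "R \<inter> K = {}" using L external_disjoint[of B] RI K by auto
      then have "card (R \<union> K \<union> L) = card R + card K + card L"
        using fin by (simp add: card_Un_disjoint)
      then show ?thesis by (simp add: w_def m rA rE mult_ac)
    qed
    have "(\<Sum>K\<in>Pow ?I. \<Sum>L\<in>Pow (external B). w (R \<union> K \<union> L)) =
        (\<Sum>K\<in>Pow ?I. of_nat (list_mult ?Z (f B) K) * (x - 1) ^ (card ?I - card K)) *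
        (\<Sum>L\<in>Pow (external B). of_nat (list_mult G g (R \<union> L)) * (y - 1) ^ card L)"
      unfolding sum_product by (intro sum.cong refl) (auto intro!: w)
    then show "(\<Sum>K\<in>Pow ?I. \<Sum>L\<in>Pow (external B). w ((B - internal B) \<union> K \<union> L)) =
        (\<Sum>p\<in>box_points (n B) (f B) (int_active G g E B).
          x ^ box_iota (n B) (f B) (int_active G g E B) p)
     * (\<Sum>c\<in>toric_components G g (nonactive_part G g E B).
          y ^ toric_eta G g (ext_active G g E B) c)"
      unfolding eqs x_sum sum_toric_components[OF assms(2) RE X] R_def[symmetric] .
  qed
  finally show ?thesis .
qed

end
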